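(* Let $n\ge 2$. If $\delta>\frac{n-1}{2}$, then the bilinear Bochner-Riesz operator $S^{\delta}$ is bounded from $L^2(\mathbb{R}^n)\times L^\infty(\mathbb{R}^n)$ to $L^2(\mathbb{R}^n)$. Moreover, for some constant $C=C_\delta$ we have $$\|S^{\delta}\|_{L^{2}\times L^{\infty}\to L^{2}}\le C .$$
   Context: The Fourier transform on $\mathbb{R}^n$ is $\widehat f(\xi)=\int_{\mathbb{R}^n}e^{-2\pi i x\cdot\xi}f(x)\,dx$. For $\delta\ge 0$ and Schwartz functions $f,g$ on $\mathbb{R}^n$, the bilinear Bochner-Riesz operator is $$S^{\delta}(f,g)(x)=\iint_{|\xi|^2+|\eta|^2\le 1}(1-|\xi|^2-|\eta|^2)^{\delta}\,\widehat f(\xi)\,\widehat g(\eta)\,e^{2\pi i x\cdot(\xi+\eta)}\,d\xi\,d\eta .$$ "Bounded from $L^{p_1}\times L^{p_2}$ to $L^p$" means that there is a constant $C$ with $\|S^\delta(f,g)\|_p\le C\|f\|_{p_1}\|g\|_{p_2}$ for all Schwartz $f,g$; the least such $C$ is the operator norm $\|S^\delta\|_{L^{p_1}\times L^{p_2}\to L^p}$. *)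

theory Defs
  imports "HOL-Analysis.Analysis" "HOL-Probability.Essential_Supremum"
begin

definition partial_deriv :: "'n::finite \<Rightarrow> (real ^ 'n \<Rightarrow> complex) \<Rightarrow> real ^ 'n \<Rightarrow> complex" where
  "partial_deriv i f x = frechet_derivative f (at x) (axis i 1)"

text \<open>Iterated partial derivatives are indexed by lists of coordinates instead of multi-indices;
  for smooth functions the order of the list does not matter.\<close>

definition iter_partial_deriv :: "'n::finite list \<Rightarrow> (real ^ 'n \<Rightarrow> complex) \<Rightarrow> real ^ 'n \<Rightarrow> complex" where
  "iter_partial_deriv is f = foldr partial_deriv is f"

text \<open>Total differentiability of every iterated partial derivative makes all of them continuous,
  so this is the usual class of infinitely differentiable functions.\<close>

definition smooth :: "(real ^ 'n::finite \<Rightarrow> complex) \<Rightarrow> bool" where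
  "smooth f \<longleftrightarrow> (\<forall>is. iter_partial_deriv is f differentiable_on UNIV)"

definition schwartz :: "(real ^ 'n::finite \<Rightarrow> complex) \<Rightarrow> bool" where
  "schwartz f \<longleftrightarrow> smooth f \<and>
     (\<forall>(\<alpha> :: 'n \<Rightarrow> nat) is.
        bounded (range (\<lambda>x. (\<Prod>i\<in>UNIV. (x $ i) ^ \<alpha> i) *\<^sub>R iter_partial_deriv is f x)))"

definition fourier :: "(real ^ 'n::finite \<Rightarrow> complex) \<Rightarrow> real ^ 'n \<Rightarrow> complex" where
  "fourier f \<xi> = (LINT x|lborel. exp (- 2 * complex_of_real pi * \<i> * complex_of_real (x \<bullet> \<xi>)) * f x)"

text \<open>The integrand vanishes on the boundary sphere also for \<open>\<delta> = 0\<close>, because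
  \<open>0 powr 0 = 0\<close>; the sphere is a null set.\<close>

definition bilinear_bochner_riesz ::
    "real \<Rightarrow> (real ^ 'n::finite \<Rightarrow> complex) \<Rightarrow> (real ^ 'n \<Rightarrow> complex) \<Rightarrow> real ^ 'n \<Rightarrow> complex" where
  "bilinear_bochner_riesz \<delta> f g x =
     (LINT p:{(\<xi>, \<eta>). (norm \<xi>)\<^sup>2 + (norm \<eta>)\<^sup>2 \<le> 1}|lborel \<Otimes>\<^sub>M lborel.
        (case p of (\<xi>, \<eta>) \<Rightarrow>
          complex_of_real ((1 - (norm \<xi>)\<^sup>2 - (norm \<eta>)\<^sup>2) powr \<delta>) * fourier f \<xi> * fourier g \<eta> *
          exp (2 * complex_of_real pi * \<i> * complex_of_real (x \<bullet> (\<xi> + \<eta>)))))"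

text \<open>The \<open>L\<^sup>p\<close> (quasi-)norm for \<open>0 < p \<le> \<infinity>\<close>; it is infinite for functions outside \<open>L\<^sup>p\<close>.\<close>

definition Lp_norm :: "ennreal \<Rightarrow> (real ^ 'n::finite \<Rightarrow> complex) \<Rightarrow> ennreal" where
  "Lp_norm p f =
     (if p = \<infinity> then esssup lborel (\<lambda>x. ennreal (norm (f x)))
      else let I = (\<integral>\<^sup>+ x. ennreal (norm (f x) powr enn2real p) \<partial>lborel)
           in if I = \<infinity> then \<infinity> else ennreal (enn2real I powr (1 / enn2real p)))"

definition bilinear_bound ::
    "((real ^ 'n::finite \<Rightarrow> complex) \<Rightarrow> (real ^ 'n \<Rightarrow> complex) \<Rightarrow> real ^ 'n \<Rightarrow> complex) \<Rightarrow>
     ennreal \<Rightarrow> ennreal \<Rightarrow> ennreal \<Rightarrow> real \<Rightarrow> bool" where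
  "bilinear_bound T p\<^sub>1 p\<^sub>2 p C \<longleftrightarrow> 0 \<le> C \<and>
     (\<forall>f g. schwartz f \<longrightarrow> schwartz g \<longrightarrow>
        Lp_norm p (T f g) \<le> ennreal C * Lp_norm p\<^sub>1 f * Lp_norm p\<^sub>2 g)"

definition bilinear_bounded ::
    "((real ^ 'n::finite \<Rightarrow> complex) \<Rightarrow> (real ^ 'n \<Rightarrow> complex) \<Rightarrow> real ^ 'n \<Rightarrow> complex) \<Rightarrow>
     ennreal \<Rightarrow> ennreal \<Rightarrow> ennreal \<Rightarrow> bool" where
  "bilinear_bounded T p\<^sub>1 p\<^sub>2 p \<longleftrightarrow> (\<exists>C. bilinear_bound T p\<^sub>1 p\<^sub>2 p C)"

text \<open>The infimum over the empty set is \<open>\<infinity>\<close>, so unbounded operators have infinite norm.\<close>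

definition bilinear_opnorm ::
    "((real ^ 'n::finite \<Rightarrow> complex) \<Rightarrow> (real ^ 'n \<Rightarrow> complex) \<Rightarrow> real ^ 'n \<Rightarrow> complex) \<Rightarrow>
     ennreal \<Rightarrow> ennreal \<Rightarrow> ennreal \<Rightarrow> ennreal" where
  "bilinear_opnorm T p\<^sub>1 p\<^sub>2 p = (INF C \<in> {C. bilinear_bound T p\<^sub>1 p\<^sub>2 p C}. ennreal C)"

end

theory Submission
  imports Defs "HOL-Probability.Probability" "HOL-Real_Asymp.Real_Asymp"
begin

text \<open>Fourier inversion of the Gamma density writes \<open>(1 - \<bar>\<xi>\<bar>\<^sup>2 - \<bar>\<eta>\<bar>\<^sup>2) powr \<delta>\<close> (truncated at zero) as a
  superposition, over \<open>z = 1 + \<i> t\<close>, of the products \<open>exp (- z \<bar>\<xi>\<bar>\<^sup>2) exp (- z \<bar>\<eta>\<bar>\<^sup>2)\<close> with a weight of size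
  \<open>\<bar>z\<bar> powr (- \<delta> - 1)\<close>. So the operator is an integral in \<open>t\<close> of products of complex-time heat extensions
  of \<open>f\<close> and \<open>g\<close>, and the Cauchy-Schwarz inequality in \<open>t\<close> separates the two. For \<open>f\<close>, the extension is a
  contraction of \<open>L\<^sup>2\<close> for each \<open>t\<close> and it suffices that \<open>\<bar>z\<bar> powr (- 1 - 2 \<theta>)\<close> is integrable. For \<open>g\<close>,
  the square function with weight \<open>\<bar>z\<bar> powr (- n - 2 \<theta>)\<close> is bounded pointwise by the supremum norm of \<open>g\<close>:
  expanding the square, the oscillation of the Gaussian kernels \<open>exp (- \<pi>\<^sup>2 \<bar>y\<bar>\<^sup>2 / z)\<close> in \<open>t\<close> makes the
  resulting kernel absolutely integrable. This gains the half derivative over the trivial \<open>L\<^sup>1\<close> bound of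
  the heat kernels, and the condition for \<open>\<theta> > 0\<close> is exactly \<open>\<delta> > (n - 1) / 2\<close>.\<close>

section \<open>Oscillatory parameter integrals\<close>

text \<open>Why \<open>L^1\<close> bounds stop at a worse threshold: the heat kernel at
  \<open>z = 1 + i t\<close> has \<open>L^1\<close> norm of order \<open>|z|^(n/2)\<close>. Bounding
  the extension of \<open>g\<close> separately for each \<open>t\<close> against a weight
  \<open>|z|^(-2b)\<close> thus needs \<open>2b > n + 1\<close>, and with the
  \<open>|z|^(-2a)\<close>, \<open>2a > 1\<close>, spent on \<open>f\<close> this yields only
  \<open>a + b = \<delta> + 1 > n/2 + 1\<close>. Oscillation lowers the requirement to
  \<open>2b > n\<close>. In the expanded square, the sum of two squared radii governs the damping
  and their difference the frequency of the phase \<open>t / (1 + t^2)\<close>. This phase is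
  stationary at \<open>t = 1\<close> and \<open>t = -1\<close>, so \<open>|t| \<le> 2\<close> is
  treated by absolute values; there the kernels are dominated by one fixed Gaussian. No branch of a
  complex power is ever chosen: at complex parameters the Gaussian and Gamma transforms are
  controlled through linear differential equations that determine their moduli, and the prefactors
  enter the estimates only through their moduli. The assumption \<open>n \<ge> 2\<close> enters
  twice: it forces \<open>\<delta> > 0\<close>, which makes the transform of the Gamma density
  integrable, and it keeps the density of the squared norm free of a singularity at 0.\<close>

lemma norm_cis_diff_le: "norm (cis a - cis b) \<le> \<bar>a - b\<bar>"
proof -
  have "cis a - cis b = cis b * (cis (a - b) - 1)"
    by (simp add: algebra_simps cis_mult)
  then have "norm (cis a - cis b) = norm (cis (a - b) - 1)"
    by (simp add: norm_mult)
  also have "\<dots> \<le> \<bar>a - b\<bar>"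
    using iexp_approx1[of "a - b" 0] by (simp add: cis_conv_exp)
  finally show ?thesis .
qed

lemma cis_has_vector_derivative:
  assumes "(p has_real_derivative p') (at t within S)"
  shows "((\<lambda>t. cis (p t)) has_vector_derivative (\<i> * complex_of_real p' * cis (p t))) (at t within S)"
  using has_derivative_cis[of p "(*) p'" t S] assms
  by (simp add: has_vector_derivative_def has_field_derivative_def scaleR_conv_of_real mult_ac)

lemma borel_measurable_cis [measurable]: "cis \<in> borel_measurable borel"
  by (intro borel_measurable_continuous_onI continuous_intros)

lemma integrable_cis_mult:
  fixes h :: "'b \<Rightarrow> complex"
  assumes "integrable M h" and [measurable]: "p \<in> borel_measurable M"
  shows "integrable M (\<lambda>u. cis (p u) * h u)"
proof (rule Bochner_Integration.integrable_bound[OF assms(1)])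
  have [measurable]: "h \<in> borel_measurable M" using assms(1) by auto
  show "(\<lambda>u. cis (p u) * h u) \<in> borel_measurable M" by measurable
qed (simp add: norm_mult)

text \<open>Difference quotients can be tested along sequences, the form to which dominated
  convergence applies.\<close>

lemma has_vector_derivative_iff_quotient:
  "(f has_vector_derivative D) (at x) \<longleftrightarrow> ((\<lambda>h. (f (x + h) - f x) /\<^sub>R h) \<longlongrightarrow> D) (at 0)"
proof -
  have "((\<lambda>h. (f (x + h) - f x) /\<^sub>R h) \<longlongrightarrow> D) (at 0)
      \<longleftrightarrow> ((\<lambda>h. norm ((f (x + h) - f x) /\<^sub>R h - D)) \<longlongrightarrow> 0) (at 0)"
    by (simp add: LIM_zero_iff tendsto_norm_zero_iff)
  also have "\<dots> \<longleftrightarrow> ((\<lambda>h. norm (f (x + h) - f x - h *\<^sub>R D) / norm h) \<longlongrightarrow> 0) (at 0)"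
  proof (rule filterlim_cong[OF refl refl], unfold eventually_at, intro exI[of _ 1] conjI ballI impI)
    fix h :: real assume "h \<noteq> 0 \<and> dist h 0 < 1"
    then have "(f (x + h) - f x) /\<^sub>R h - D = (f (x + h) - f x - h *\<^sub>R D) /\<^sub>R h"
      by (simp add: scaleR_diff_right)
    then show "norm ((f (x + h) - f x) /\<^sub>R h - D) = norm (f (x + h) - f x - h *\<^sub>R D) / norm h"
      by (simp add: divide_inverse mult.commute)
  qed simp
  also have "\<dots> \<longleftrightarrow> (f has_vector_derivative D) (at x)"
    by (simp add: has_vector_derivative_def has_derivative_at bounded_linear_scaleR_left)
  finally show ?thesis ..
qed

text \<open>Since \<open>cis\<close> is 1-Lipschitz, every difference quotient of the integrand is
  at most \<open>|p u| * |h u|\<close>, which is an integrable majorant independent of the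
  increment.\<close>

lemma has_vector_derivative_integral_cis:
  fixes h :: "'b \<Rightarrow> complex"
  assumes h: "integrable M h" and p[measurable]: "p \<in> borel_measurable M"
    and ph: "integrable M (\<lambda>u. complex_of_real (p u) * h u)"
  shows "((\<lambda>t. LINT u|M. cis (t * p u) * h u) has_vector_derivative
          (LINT u|M. \<i> * complex_of_real (p u) * (cis (t * p u) * h u))) (at t)"
proof -
  have [measurable]: "h \<in> borel_measurable M" using h by auto
  let ?F = "\<lambda>t. LINT u|M. cis (t * p u) * h u"
  have int: "integrable M (\<lambda>u. cis (t * p u) * h u)" for t
    by (rule integrable_cis_mult[OF h]) simp
  have "((\<lambda>s. (?F (t + s) - ?F t) /\<^sub>R s) \<longlongrightarrow> (LINT u|M. \<i> * complex_of_real (p u) * (cis (t * p u) * h u))) (at 0)"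
    unfolding tendsto_at_iff_sequentially comp_def
  proof (intro allI impI)
    fix X :: "nat \<Rightarrow> real" assume X: "\<forall>i. X i \<in> UNIV - {0}" "X \<longlonglongrightarrow> 0"
    have eq: "(?F (t + X i) - ?F t) /\<^sub>R X i = (LINT u|M. ((cis ((t + X i) * p u) - cis (t * p u)) * h u) /\<^sub>R X i)" for i
    proof -
      have "(LINT u|M. ((cis ((t + X i) * p u) - cis (t * p u)) * h u) /\<^sub>R X i)
          = (LINT u|M. cis ((t + X i) * p u) * h u - cis (t * p u) * h u) /\<^sub>R X i"
        by (simp only: left_diff_distrib integral_scaleR_right)
      also have "\<dots> = (?F (t + X i) - ?F t) /\<^sub>R X i"
        by (simp only: Bochner_Integration.integral_diff[OF int int])
      finally show ?thesis ..
    qed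
    show "(\<lambda>i. (?F (t + X i) - ?F t) /\<^sub>R X i) \<longlonglongrightarrow> (LINT u|M. \<i> * complex_of_real (p u) * (cis (t * p u) * h u))"
      unfolding eq
    proof (rule integral_dominated_convergence)
      show "integrable M (\<lambda>u. norm (complex_of_real (p u) * h u))" using ph by simp
      show "AE u in M. (\<lambda>i. ((cis ((t + X i) * p u) - cis (t * p u)) * h u) /\<^sub>R X i)
          \<longlonglongrightarrow> \<i> * complex_of_real (p u) * (cis (t * p u) * h u)"
      proof (rule AE_I2)
        fix u
        have "((\<lambda>s. cis (s * p u)) has_vector_derivative (\<i> * complex_of_real (p u) * cis (t * p u))) (at t)"
          by (rule cis_has_vector_derivative) (auto intro!: derivative_eq_intros)
        then have "((\<lambda>s. (cis ((t + s) * p u) - cis (t * p u)) /\<^sub>R s) \<longlongrightarrow> \<i> * complex_of_real (p u) * cis (t * p u)) (at 0)"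
          by (simp add: has_vector_derivative_iff_quotient)
        then have "(\<lambda>i. (cis ((t + X i) * p u) - cis (t * p u)) /\<^sub>R X i) \<longlonglongrightarrow> \<i> * complex_of_real (p u) * cis (t * p u)"
          using X unfolding tendsto_at_iff_sequentially comp_def by auto
        from tendsto_mult_right[OF this, of "h u"]
        show "(\<lambda>i. ((cis ((t + X i) * p u) - cis (t * p u)) * h u) /\<^sub>R X i)
          \<longlonglongrightarrow> \<i> * complex_of_real (p u) * (cis (t * p u) * h u)"
          by (simp add: mult.assoc)
      qed
      show "AE u in M. norm (((cis ((t + X i) * p u) - cis (t * p u)) * h u) /\<^sub>R X i)
          \<le> norm (complex_of_real (p u) * h u)" for i
      proof (rule AE_I2)
        fix u
        have "norm (cis ((t + X i) * p u) - cis (t * p u)) \<le> \<bar>X i\<bar> * \<bar>p u\<bar>"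
          using norm_cis_diff_le[of "(t + X i) * p u" "t * p u"] by (simp add: algebra_simps abs_mult)
        then have "norm (cis ((t + X i) * p u) - cis (t * p u)) * norm (h u) / \<bar>X i\<bar> \<le> (\<bar>X i\<bar> * \<bar>p u\<bar>) * norm (h u) / \<bar>X i\<bar>"
          by (intro divide_right_mono mult_right_mono) auto
        also have "\<dots> = \<bar>p u\<bar> * norm (h u)" using spec[OF X(1), of i] by simp
        finally have "norm (cis ((t + X i) * p u) - cis (t * p u)) * norm (h u) / \<bar>X i\<bar> \<le> \<bar>p u\<bar> * norm (h u)" .
        then show "norm (((cis ((t + X i) * p u) - cis (t * p u)) * h u) /\<^sub>R X i)
          \<le> norm (complex_of_real (p u) * h u)"
          by (simp only: norm_mult norm_scaleR norm_inverse real_norm_def norm_of_real abs_inverse divide_inverse mult_ac)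
      qed
    qed measurable
  qed
  then show ?thesis by (simp add: has_vector_derivative_iff_quotient)
qed

text \<open>The equation says that \<open>y (s + \<i> t) powr \<kappa>\<close> is constant; only its modulus is needed.\<close>

lemma norm_solution_of_power_ode:
  fixes y :: "real \<Rightarrow> complex"
  assumes s: "s > 0"
    and ode: "\<And>t. (y has_vector_derivative (- \<i> * complex_of_real \<kappa> / Complex s t * y t)) (at t)"
  shows "(norm (y t))\<^sup>2 = (norm (y 0))\<^sup>2 * (s\<^sup>2 / (s\<^sup>2 + t\<^sup>2)) powr \<kappa>"
proof -
  \<comment> \<open>This is the squared modulus of \<open>y (s + i t)^\<kappa>\<close>; in this form
    it is a real function and involves only real powers.\<close>
  let ?f = "\<lambda>t. (y t \<bullet> y t) * (s\<^sup>2 + t\<^sup>2) powr \<kappa>"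
  have pos: "s\<^sup>2 + t\<^sup>2 > 0" for t using s by (simp add: add_pos_nonneg)
  have D: "(?f has_real_derivative 0) (at t)" for t
  proof -
    let ?y' = "- \<i> * complex_of_real \<kappa> / Complex s t * y t"
    \<comment> \<open>Multiplying \<open>y\<close> by a complex number rotates and scales it, so
      only the real part of the coefficient changes the modulus.\<close>
    have i: "y t \<bullet> ?y' = - \<kappa> * t / (s\<^sup>2 + t\<^sup>2) * (y t \<bullet> y t)"
    proof -
      have "- \<i> * complex_of_real \<kappa> / Complex s t = Complex (- \<kappa> * t / (s\<^sup>2 + t\<^sup>2)) (- \<kappa> * s / (s\<^sup>2 + t\<^sup>2))"
        by (simp add: complex_eq_iff Re_divide Im_divide power2_eq_square)
      then show ?thesis
        by (simp add: inner_complex_def algebra_simps add_divide_distrib)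
    qed
    have d1: "((\<lambda>t. y t \<bullet> y t) has_real_derivative (2 * (y t \<bullet> ?y'))) (at t)"
    proof -
      define v where "v = ?y'"
      have "((\<lambda>t. y t \<bullet> y t) has_derivative (\<lambda>h. y t \<bullet> (h *\<^sub>R v) + (h *\<^sub>R v) \<bullet> y t)) (at t)"
        by (rule has_derivative_inner) (use ode[of t] in \<open>auto simp: has_vector_derivative_def v_def\<close>)
      also have "(\<lambda>h. y t \<bullet> (h *\<^sub>R v) + (h *\<^sub>R v) \<bullet> y t) = (*) (2 * (y t \<bullet> v))"
        by (simp add: fun_eq_iff inner_commute[of v])
      finally show ?thesis unfolding has_field_derivative_def v_def .
    qed
    have d2: "((\<lambda>t. (s\<^sup>2 + t\<^sup>2) powr \<kappa>) has_real_derivative (\<kappa> * (s\<^sup>2 + t\<^sup>2) powr (\<kappa> - 1) * (2 * t))) (at t)"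
      using pos[of t] by (auto intro!: derivative_eq_intros simp: powr_diff)
    have pw: "(s\<^sup>2 + t\<^sup>2) powr (\<kappa> - 1) = (s\<^sup>2 + t\<^sup>2) powr \<kappa> / (s\<^sup>2 + t\<^sup>2)"
      using pos[of t] by (simp add: powr_diff)
    show ?thesis
      by (rule DERIV_cong[OF DERIV_mult[OF d1 d2]])
         (unfold i pw, use pos[of t] in \<open>simp add: field_simps\<close>)
  qed
  have "?f t = ?f 0" using DERIV_isconst_all[of ?f t 0] D by blast
  then have "(norm (y t))\<^sup>2 * (s\<^sup>2 + t\<^sup>2) powr \<kappa> = (norm (y 0))\<^sup>2 * (s\<^sup>2) powr \<kappa>"
    by (simp add: dot_square_norm)
  then show ?thesis using pos[of t] s by (simp add: powr_divide field_simps)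
qed

text \<open>Integration by parts on the whole line: applied to a product that vanishes at both ends,
  it turns the product rule into a relation between Gaussian moments.\<close>

lemma integral_has_vector_derivative_eq_0:
  fixes F f :: "real \<Rightarrow> complex"
  assumes "\<And>x. (F has_vector_derivative f x) (at x)" "continuous_on UNIV f" "integrable lborel f"
    and "(F \<longlongrightarrow> 0) at_top" "(F \<longlongrightarrow> 0) at_bot"
  shows "(LINT x|lborel. f x) = 0"
proof -
  have "(LBINT x=-\<infinity>..\<infinity>. f x) = 0 - 0"
    using assms
    by (intro interval_integral_FTC_integrable[where F=F])
       (auto simp: continuous_on_eq_continuous_at set_integrable_def
          ereal_tendsto_simps)
  then show ?thesis by (simp add: interval_integral_to_infinity_eq interval_lebesgue_integral_def einterval_def set_lebesgue_integral_def)
qed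

lemma has_bochner_integral_gaussian:
  assumes "s > 0"
  shows "has_bochner_integral lborel (\<lambda>x::real. exp (- s * x\<^sup>2)) (sqrt (pi / s))"
proof -
  let ?\<sigma> = "1 / sqrt (2 * s)"
  have eq: "sqrt (pi / s) * normal_density 0 ?\<sigma> x = exp (- s * x\<^sup>2)" for x
    using assms by (simp add: normal_density_def field_simps real_sqrt_divide real_sqrt_mult power_mult_distrib)
  have "has_bochner_integral lborel (\<lambda>x. sqrt (pi / s) * normal_density 0 ?\<sigma> x) (sqrt (pi / s) * 1)"
    using assms by (intro has_bochner_integral_mult_right) (simp add: has_bochner_integral_iff)
  then show ?thesis unfolding eq by simp
qed

lemma integrable_gaussian_moment:
  assumes "s > 0"
  shows "integrable lborel (\<lambda>x::real. x ^ k * exp (- s * x\<^sup>2))"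
proof -
  let ?\<sigma> = "1 / sqrt (2 * s)"
  have eq: "sqrt (pi / s) * (normal_density 0 ?\<sigma> x * (x - 0) ^ k) = x ^ k * exp (- s * x\<^sup>2)" for x
    using assms by (simp add: normal_density_def field_simps real_sqrt_divide real_sqrt_mult power_mult_distrib)
  have "integrable lborel (\<lambda>x. sqrt (pi / s) * (normal_density 0 ?\<sigma> x * (x - 0) ^ k))"
    using assms by (intro integrable_mult_right integrable_normal_moment) simp
  then show ?thesis unfolding eq .
qed

text \<open>If \<open>f\<close> is not integrable, its Bochner integral is 0 by convention and the
  bound is trivial.\<close>

lemma norm_integral_le_nn_integral:
  fixes f :: "'b \<Rightarrow> complex"
  shows "ennreal (norm (LINT x|M. f x)) \<le> (\<integral>\<^sup>+x. ennreal (norm (f x)) \<partial>M)"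
  by (cases "integrable M f") (auto simp: not_integrable_integral_eq intro: integral_norm_bound_ennreal)

section \<open>Complex Gaussians\<close>

lemma integrable_complex_gaussian_moment:
  assumes "Re z > 0"
  shows "integrable lborel (\<lambda>y::real. complex_of_real (y ^ k) * exp (- z * complex_of_real (y\<^sup>2)))"
proof (rule Bochner_Integration.integrable_bound[OF integrable_gaussian_moment[OF assms, of k]])
  show "(\<lambda>y::real. complex_of_real (y ^ k) * exp (- z * complex_of_real (y\<^sup>2))) \<in> borel_measurable lborel"
    by measurable
qed (simp add: norm_mult norm_power abs_mult power_abs)

text \<open>The phase is grouped as \<open>x * (2 * pi * y)\<close> to match the shape
  \<open>cis (t * p u)\<close> in which integrals are differentiated under the integral
  sign.\<close>

definition gauss_ft :: "complex \<Rightarrow> real \<Rightarrow> complex" where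
  "gauss_ft z x = (LINT y|lborel. cis (x * (2 * pi * y)) * exp (- z * complex_of_real (y\<^sup>2)))"

lemma tendsto_power_mult_gaussian:
  fixes s :: real assumes "s > 0"
  shows "((\<lambda>x. x ^ k * exp (- s * x\<^sup>2)) \<longlongrightarrow> 0) at_top"
  using assms by real_asymp

lemma gaussian_vanishes_at_infinity:
  assumes "Re z > 0" "\<And>x::real. norm (F x) \<le> C * \<bar>x\<bar> ^ k * exp (- Re z * x\<^sup>2)"
  shows "(F \<longlongrightarrow> (0::complex)) at_top" "(F \<longlongrightarrow> 0) at_bot"
proof -
  have *: "((\<lambda>x. C * (x ^ k * exp (- Re z * x\<^sup>2))) \<longlongrightarrow> C * 0) at_top"
    by (intro tendsto_mult tendsto_const tendsto_power_mult_gaussian assms)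
  have 1: "((\<lambda>x. C * \<bar>x\<bar> ^ k * exp (- Re z * x\<^sup>2)) \<longlongrightarrow> 0) at_top"
    by (rule Lim_transform_eventually[OF *[simplified]])
       (use eventually_ge_at_top[of 0] in \<open>eventually_elim, auto\<close>)
  show "(F \<longlongrightarrow> 0) at_top"
    by (rule Lim_null_comparison[OF always_eventually 1]) (use assms(2) in blast)
  show "(F \<longlongrightarrow> 0) at_bot"
    unfolding filterlim_at_bot_mirror
    by (rule Lim_null_comparison[OF always_eventually 1])
       (use assms(2)[of "- x" for x] in simp)
qed

lemma gaussian_cis_has_vector_derivative:
  "((\<lambda>y. cis (b * y) * exp (- z * complex_of_real (y\<^sup>2))) has_vector_derivative
     (\<i> * complex_of_real b - 2 * z * complex_of_real y) * (cis (b * y) * exp (- z * complex_of_real (y\<^sup>2)))) (at y)"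
proof -
  have 1: "((\<lambda>y. cis (b * y)) has_vector_derivative (\<i> * complex_of_real b * cis (b * y))) (at y)"
    by (rule cis_has_vector_derivative) (auto intro!: derivative_eq_intros)
  have "((\<lambda>y. - z * complex_of_real (y\<^sup>2)) has_vector_derivative (- z * complex_of_real (2 * y))) (at y)"
    by (intro has_vector_derivative_mult_right has_vector_derivative_of_real) (auto intro!: derivative_eq_intros)
  from field_vector_diff_chain_at[OF this DERIV_exp]
  have 2: "((\<lambda>y. exp (- z * complex_of_real (y\<^sup>2))) has_vector_derivative (- z * complex_of_real (2 * y)) * exp (- z * complex_of_real (y\<^sup>2))) (at y)"
    by (simp add: o_def)
  show ?thesis
    by (rule has_vector_derivative_eq_rhs[OF has_vector_derivative_mult[OF 1 2]]) (simp add: algebra_simps)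
qed

text \<open>Differentiating in \<open>x\<close> brings down a factor \<open>y\<close>, and
  integration by parts trades it for a multiple of \<open>x / z\<close>. The transform therefore
  solves \<open>G' = - (2 pi^2 x / z) G\<close>. The value at 0 stays unevaluated because it is a
  branch of \<open>sqrt (pi / z)\<close>.\<close>

lemma gauss_ft_eq:
  assumes z: "Re z > 0"
  shows "gauss_ft z x = gauss_ft z 0 * exp (- complex_of_real (pi\<^sup>2 * x\<^sup>2) / z)"
proof -
  have z0: "z \<noteq> 0" using z by auto
  let ?h = "\<lambda>y::real. exp (- z * complex_of_real (y\<^sup>2))"
  have h: "integrable lborel ?h" using integrable_complex_gaussian_moment[OF z, of 0] by simp
  have yh: "integrable lborel (\<lambda>y. complex_of_real y * ?h y)" using integrable_complex_gaussian_moment[OF z, of 1] by simp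
  have D: "(gauss_ft z has_vector_derivative (- complex_of_real (2 * pi\<^sup>2 * x) / z * gauss_ft z x)) (at x)" for x
  proof -
    let ?c = "\<lambda>y. cis (2 * pi * x * y)"
    have int: "integrable lborel (\<lambda>y. ?c y * ?h y)"
      by (rule integrable_cis_mult[OF h]) simp
    have yint: "integrable lborel (\<lambda>y. complex_of_real y * (?c y * ?h y))"
      using integrable_cis_mult[OF yh, of "\<lambda>y. 2 * pi * x * y"] by (simp add: mult_ac)
    \<comment> \<open>The integrand is the derivative in \<open>y\<close> of the oscillating
      Gaussian; its vanishing integral expresses the first moment through the transform
      itself.\<close>
    have "(LINT y|lborel. (\<i> * complex_of_real (2 * pi * x) - 2 * z * complex_of_real y) * (?c y * ?h y)) = 0"
    proof (rule integral_has_vector_derivative_eq_0)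
      show "((\<lambda>y. ?c y * ?h y) has_vector_derivative (\<i> * complex_of_real (2 * pi * x) - 2 * z * complex_of_real y) * (?c y * ?h y)) (at y)" for y
        by (rule gaussian_cis_has_vector_derivative)
      show "continuous_on UNIV (\<lambda>y. (\<i> * complex_of_real (2 * pi * x) - 2 * z * complex_of_real y) * (?c y * ?h y))"
        by (intro continuous_intros)
      have "integrable lborel (\<lambda>y. \<i> * complex_of_real (2 * pi * x) * (?c y * ?h y) - 2 * z * (complex_of_real y * (?c y * ?h y)))"
        by (intro Bochner_Integration.integrable_diff integrable_mult_right int yint)
      then show "integrable lborel (\<lambda>y. (\<i> * complex_of_real (2 * pi * x) - 2 * z * complex_of_real y) * (?c y * ?h y))"
        by (simp add: algebra_simps)
      have *: "norm (?c y * ?h y) \<le> 1 * \<bar>y\<bar> ^ 0 * exp (- Re z * y\<^sup>2)" for y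
        by (simp add: norm_mult)
      show "((\<lambda>y. ?c y * ?h y) \<longlongrightarrow> 0) at_top" "((\<lambda>y. ?c y * ?h y) \<longlongrightarrow> 0) at_bot"
        using gaussian_vanishes_at_infinity[OF z *] by auto
    qed
    also have "(LINT y|lborel. (\<i> * complex_of_real (2 * pi * x) - 2 * z * complex_of_real y) * (?c y * ?h y))
      = (LINT y|lborel. \<i> * complex_of_real (2 * pi * x) * (?c y * ?h y) - 2 * z * (complex_of_real y * (?c y * ?h y)))"
      by (intro Bochner_Integration.integral_cong) (simp_all add: algebra_simps)
    also have "\<dots> = \<i> * complex_of_real (2 * pi * x) * (LINT y|lborel. ?c y * ?h y) - 2 * z * (LINT y|lborel. complex_of_real y * (?c y * ?h y))"
      by (subst Bochner_Integration.integral_diff[OF integrable_mult_right[OF int] integrable_mult_right[OF yint]])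
         (simp only: integral_mult_right_zero)
    finally have eq: "(LINT y|lborel. complex_of_real y * (?c y * ?h y)) = \<i> * complex_of_real (pi * x) / z * (LINT y|lborel. ?c y * ?h y)"
      using z0 by (simp add: field_simps)
    have "((\<lambda>x. gauss_ft z x) has_vector_derivative (LINT y|lborel. \<i> * complex_of_real (2 * pi * y) * (cis (x * (2 * pi * y)) * ?h y))) (at x)"
      unfolding gauss_ft_def
      by (rule has_vector_derivative_integral_cis[OF h]) (use integrable_mult_right[OF yh, of "complex_of_real (2 * pi)"] in \<open>simp_all add: mult_ac\<close>)
    also have "(LINT y|lborel. \<i> * complex_of_real (2 * pi * y) * (cis (x * (2 * pi * y)) * ?h y)) = (LINT y|lborel. 2 * pi * \<i> * (complex_of_real y * (?c y * ?h y)))"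
      by (intro Bochner_Integration.integral_cong) (simp_all add: mult_ac)
    also have "\<dots> = 2 * pi * \<i> * (LINT y|lborel. complex_of_real y * (?c y * ?h y))"
      by (rule integral_mult_right_zero)
    also have "\<dots> = - complex_of_real (2 * pi\<^sup>2 * x) / z * gauss_ft z x"
      unfolding eq by (simp add: gauss_ft_def mult_ac power2_eq_square)
    finally show ?thesis .
  qed
  \<comment> \<open>The integrating factor of the equation: its product with the transform is
    constant, hence equal to the value at 0.\<close>
  let ?e = "\<lambda>x. exp (complex_of_real (pi\<^sup>2 * x\<^sup>2) / z)"
  have De: "(?e has_vector_derivative complex_of_real (2 * pi\<^sup>2 * x) / z * ?e x) (at x)" for x
  proof -
    have "((\<lambda>x. complex_of_real (pi\<^sup>2 * x\<^sup>2) / z) has_vector_derivative (complex_of_real (2 * pi\<^sup>2 * x) / z)) (at x)"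
      by (intro has_vector_derivative_divide has_vector_derivative_of_real) (auto intro!: derivative_eq_intros)
    from field_vector_diff_chain_at[OF this DERIV_exp] show ?thesis by (simp add: o_def)
  qed
  have "((\<lambda>x. gauss_ft z x * ?e x) has_vector_derivative 0) (at x)" for x
    by (rule has_vector_derivative_eq_rhs[OF has_vector_derivative_mult[OF D De]]) (simp add: algebra_simps)
  then obtain c where c: "\<And>x. gauss_ft z x * ?e x = c"
    using has_vector_derivative_zero_constant[of UNIV "\<lambda>x. gauss_ft z x * ?e x"] by auto
  have "gauss_ft z x * ?e x = gauss_ft z 0" using c[of x] c[of 0] by simp
  then show ?thesis by (simp add: exp_minus field_simps)
qed

text \<open>Along the vertical line \<open>z = s + i t\<close> the derivative in \<open>t\<close>
  brings down \<open>- i y^2\<close>, and integration by parts gives that second moment as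
  \<open>1 / (2 z)\<close> times the integral. This is the power equation with exponent
  \<open>1/2\<close>; its initial value is the real Gaussian integral.\<close>

lemma norm_gauss_ft_0:
  assumes z: "Re z > 0"
  shows "(norm (gauss_ft z 0))\<^sup>2 = pi / norm z"
proof -
  define s where "s = Re z"
  have s: "s > 0" using z by (simp add: s_def)
  define g where "g = (\<lambda>t. gauss_ft (Complex s t) 0)"
  let ?h = "\<lambda>y. exp (- complex_of_real s * complex_of_real (y\<^sup>2))"
  have split: "exp (- Complex s t * complex_of_real (y\<^sup>2)) = cis (t * (- (y\<^sup>2))) * ?h y" for t y
    unfolding cis_conv_exp mult_exp_exp by (rule arg_cong[where f=exp]) (simp add: Complex_eq algebra_simps)
  have g_eq: "g = (\<lambda>t. LINT y|lborel. cis (t * (- (y\<^sup>2))) * ?h y)"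
    unfolding g_def gauss_ft_def split by simp
  have Re: "Re (Complex s t) > 0" for t using s by simp
  have h: "integrable lborel ?h" using integrable_complex_gaussian_moment[of "complex_of_real s" 0] s by simp
  have yh: "integrable lborel (\<lambda>y. complex_of_real (- (y\<^sup>2)) * ?h y)"
    using integrable_minus[OF integrable_complex_gaussian_moment[of "complex_of_real s" 2]] s by simp
  have D: "(g has_vector_derivative (- \<i> * complex_of_real (1/2) / Complex s t * g t)) (at t)" for t
  proof -
    let ?z = "Complex s t"
    have z0: "?z \<noteq> 0" using s by (auto simp: complex_eq_iff)
    let ?k = "\<lambda>y::real. exp (- ?z * complex_of_real (y\<^sup>2))"
    have k0: "integrable lborel ?k" using integrable_complex_gaussian_moment[OF Re, of 0] by simp
    have k2: "integrable lborel (\<lambda>y. complex_of_real (y\<^sup>2) * ?k y)" using integrable_complex_gaussian_moment[OF Re, of 2] by simp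
    \<comment> \<open>The primitive is \<open>y exp (- z y^2)\<close>: the extra factor
      \<open>y\<close> is what makes the second moment appear.\<close>
    have "(LINT y|lborel. ?k y - 2 * ?z * (complex_of_real (y\<^sup>2) * ?k y)) = 0"
    proof (rule integral_has_vector_derivative_eq_0[where F = "\<lambda>y. complex_of_real y * ?k y"])
      fix y :: real
      have 2: "(?k has_vector_derivative (- 2 * ?z * complex_of_real y) * ?k y) (at y)"
        using gaussian_cis_has_vector_derivative[of 0 ?z y] by simp
      have 1: "((\<lambda>y. complex_of_real y) has_vector_derivative 1) (at y)"
        using has_vector_derivative_of_real[of "\<lambda>y. y" 1 "at y"] by simp
      show "((\<lambda>y. complex_of_real y * ?k y) has_vector_derivative ?k y - 2 * ?z * (complex_of_real (y\<^sup>2) * ?k y)) (at y)"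
        by (rule has_vector_derivative_eq_rhs[OF has_vector_derivative_mult[OF 1 2]]) (simp add: algebra_simps power2_eq_square)
    next
      show "integrable lborel (\<lambda>y. ?k y - 2 * ?z * (complex_of_real (y\<^sup>2) * ?k y))"
        by (intro Bochner_Integration.integrable_diff integrable_mult_right k0 k2)
      have *: "norm (complex_of_real y * ?k y) \<le> 1 * \<bar>y\<bar> ^ 1 * exp (- Re ?z * y\<^sup>2)" for y
        by (simp add: norm_mult)
      show "((\<lambda>y. complex_of_real y * ?k y) \<longlongrightarrow> 0) at_top" "((\<lambda>y. complex_of_real y * ?k y) \<longlongrightarrow> 0) at_bot"
        using gaussian_vanishes_at_infinity[OF Re *] by auto
    qed (intro continuous_intros)
    then have "(LINT y|lborel. ?k y) - 2 * ?z * (LINT y|lborel. complex_of_real (y\<^sup>2) * ?k y) = 0"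
      by (subst (asm) Bochner_Integration.integral_diff[OF k0 integrable_mult_right[OF k2]])
         (simp only: integral_mult_right_zero)
    then have eq: "(LINT y|lborel. complex_of_real (y\<^sup>2) * ?k y) = 1 / (2 * ?z) * (LINT y|lborel. ?k y)"
      using z0 by (simp add: field_simps)
    have "(g has_vector_derivative (LINT y|lborel. \<i> * complex_of_real (- (y\<^sup>2)) * (cis (t * (- (y\<^sup>2))) * ?h y))) (at t)"
      unfolding g_eq by (rule has_vector_derivative_integral_cis[OF h _ yh]) simp
    also have "(LINT y|lborel. \<i> * complex_of_real (- (y\<^sup>2)) * (cis (t * (- (y\<^sup>2))) * ?h y)) = (LINT y|lborel. - \<i> * (complex_of_real (y\<^sup>2) * ?k y))"
      unfolding split by (intro Bochner_Integration.integral_cong) (simp_all add: mult_ac)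
    also have "\<dots> = - \<i> * (LINT y|lborel. complex_of_real (y\<^sup>2) * ?k y)"
      by (rule integral_mult_right_zero)
    also have "\<dots> = - \<i> * complex_of_real (1/2) / ?z * g t"
      unfolding eq by (simp add: g_def gauss_ft_def)
    finally show ?thesis .
  qed
  have "g 0 = complex_of_real (LINT y|lborel. exp (- s * y\<^sup>2))"
    unfolding g_eq by (simp flip: exp_of_real integral_complex_of_real)
  also have "\<dots> = complex_of_real (sqrt (pi / s))"
    using has_bochner_integral_gaussian[OF s] by (simp add: has_bochner_integral_iff)
  finally have g0: "(norm (g 0))\<^sup>2 = pi / s" using s by simp
  have "(norm (g (Im z)))\<^sup>2 = (norm (g 0))\<^sup>2 * (s\<^sup>2 / (s\<^sup>2 + (Im z)\<^sup>2)) powr (1/2)"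
    by (rule norm_solution_of_power_ode[OF s D])
  also have "\<dots> = pi / s * (s / norm z)"
    using s unfolding g0 by (simp add: powr_half_sqrt real_sqrt_divide cmod_def s_def)
  also have "\<dots> = pi / norm z" using s by simp
  finally show ?thesis by (simp add: g_def s_def)
qed

lemma gauss_ft_0_of_real:
  assumes s: "s > 0"
  shows "gauss_ft (complex_of_real s) 0 = complex_of_real (sqrt (pi / s))"
proof -
  have "gauss_ft (complex_of_real s) 0 = complex_of_real (LINT y|lborel. exp (- s * y\<^sup>2))"
    by (simp add: gauss_ft_def flip: exp_of_real integral_complex_of_real)
  then show ?thesis
    using has_bochner_integral_gaussian[OF s] by (simp add: has_bochner_integral_iff)
qed

section \<open>Gaussians on Euclidean spaces by tensor products\<close>

lemma lborel_integral_prod_Basis: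
  fixes h :: "'a::euclidean_space \<Rightarrow> real \<Rightarrow> complex"
  assumes "\<And>b. b \<in> Basis \<Longrightarrow> integrable lborel (h b)"
  shows "integrable lborel (\<lambda>x. \<Prod>b\<in>Basis. h b (x \<bullet> b))"
    and "(LINT x|lborel. (\<Prod>b\<in>Basis. h b (x \<bullet> b))) = (\<Prod>b\<in>Basis. LINT y|lborel. h b y)"
proof -
  interpret product_sigma_finite "\<lambda>_. lborel :: real measure" by standard
  have [measurable]: "\<And>b. b \<in> Basis \<Longrightarrow> h b \<in> borel_measurable borel"
    using assms by auto
  have eq: "(\<Prod>b\<in>Basis. h b ((\<Sum>i\<in>Basis. f i *\<^sub>R i) \<bullet> b)) = (\<Prod>b\<in>Basis. h b (f b))" for f
    by (intro prod.cong refl) (simp add: inner_sum_left inner_Basis if_distrib sum.delta cong: if_cong)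
  have m: "(\<lambda>x::'a. \<Prod>b\<in>Basis. h b (x \<bullet> b)) \<in> borel_measurable borel"
    by (intro borel_measurable_prod) (auto intro: measurable_compose[of "\<lambda>x. x \<bullet> b" for b])
  have mT: "(\<lambda>f. \<Sum>i\<in>Basis. f i *\<^sub>R i :: 'a) \<in> (\<Pi>\<^sub>M b\<in>Basis. lborel) \<rightarrow>\<^sub>M borel"
    by measurable
  \<comment> \<open>Lebesgue measure is the image of a product of one-dimensional measures under the
    coordinate map, so both claims reduce to product integrals.\<close>
  show "integrable lborel (\<lambda>x. \<Prod>b\<in>Basis. h b (x \<bullet> b))"
    by (subst lborel_eq, subst integrable_distr_eq[OF mT m], unfold eq)
       (intro product_integrable_prod assms finite_Basis)
  show "(LINT x|lborel. (\<Prod>b\<in>Basis. h b (x \<bullet> b))) = (\<Prod>b\<in>Basis. LINT y|lborel. h b y)"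
    by (subst lborel_eq, subst integral_distr[OF mT m], unfold eq)
       (intro product_integral_prod assms finite_Basis)
qed

lemma norm_square_eq_sum_Basis: "(norm (x::'a::euclidean_space))\<^sup>2 = (\<Sum>b\<in>Basis. (x \<bullet> b)\<^sup>2)"
  unfolding power2_norm_eq_inner by (subst euclidean_inner) (simp add: power2_eq_square)

lemma integrable_gaussian:
  fixes z :: complex assumes z: "Re z > 0"
  shows "integrable lborel (\<lambda>\<xi>::'a::euclidean_space. exp (- z * complex_of_real ((norm \<xi>)\<^sup>2)))"
proof -
  have eq: "exp (- z * complex_of_real ((norm \<xi>)\<^sup>2)) = (\<Prod>b\<in>Basis. exp (- z * complex_of_real ((\<xi> \<bullet> b)\<^sup>2)))" for \<xi> :: 'a
    unfolding norm_square_eq_sum_Basis of_real_sum sum_distrib_left by (simp add: exp_sum)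
  show ?thesis unfolding eq
    using integrable_complex_gaussian_moment[OF z, of 0] by (intro lborel_integral_prod_Basis) simp
qed

lemma integral_gaussian_cis:
  fixes z :: complex and x :: "'a::euclidean_space"
  assumes z: "Re z > 0"
  shows "(LINT \<xi>|lborel. cis (2 * pi * (x \<bullet> \<xi>)) * exp (- z * complex_of_real ((norm \<xi>)\<^sup>2)))
    = gauss_ft z 0 ^ DIM('a) * exp (- complex_of_real (pi\<^sup>2 * (norm x)\<^sup>2) / z)"
proof -
  let ?h = "\<lambda>b y. cis ((x \<bullet> b) * (2 * pi * y)) * exp (- z * complex_of_real (y\<^sup>2))"
  have cis_sum: "cis (\<Sum>b\<in>A. f b) = (\<Prod>b\<in>A. cis (f b))" if "finite A" for A and f :: "'a \<Rightarrow> real"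
    using that by (induction rule: finite_induct) (auto simp flip: cis_mult)
  have eq: "cis (2 * pi * (x \<bullet> \<xi>)) * exp (- z * complex_of_real ((norm \<xi>)\<^sup>2)) = (\<Prod>b\<in>Basis. ?h b (\<xi> \<bullet> b))" for \<xi> :: 'a
  proof -
    have "2 * pi * (x \<bullet> \<xi>) = (\<Sum>b\<in>Basis. (x \<bullet> b) * (2 * pi * (\<xi> \<bullet> b)))"
      by (subst euclidean_inner) (simp add: sum_distrib_left mult_ac)
    then show ?thesis
      unfolding norm_square_eq_sum_Basis of_real_sum sum_distrib_left
      by (simp add: exp_sum cis_sum prod.distrib)
  qed
  have int: "integrable lborel (?h b)" for b
    using integrable_complex_gaussian_moment[OF z, of 0] by (intro integrable_cis_mult) simp_all
  have "(LINT \<xi>|lborel. cis (2 * pi * (x \<bullet> \<xi>)) * exp (- z * complex_of_real ((norm \<xi>)\<^sup>2))) = (\<Prod>b\<in>Basis. gauss_ft z (x \<bullet> b))"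
    unfolding eq gauss_ft_def by (rule lborel_integral_prod_Basis[OF int])
  also have "\<dots> = (\<Prod>b\<in>Basis. gauss_ft z 0 * exp (- complex_of_real (pi\<^sup>2 * (x \<bullet> b)\<^sup>2) / z))"
    by (simp only: gauss_ft_eq[OF z, of "x \<bullet> b" for b])
  also have "\<dots> = gauss_ft z 0 ^ DIM('a) * exp (\<Sum>b\<in>Basis. - complex_of_real (pi\<^sup>2 * (x \<bullet> b)\<^sup>2) / z)"
    by (simp add: prod.distrib exp_sum)
  also have "(\<Sum>b\<in>Basis. - complex_of_real (pi\<^sup>2 * (x \<bullet> b)\<^sup>2) / z) = - complex_of_real (pi\<^sup>2 * (norm x)\<^sup>2) / z"
    unfolding norm_square_eq_sum_Basis by (simp add: sum_distrib_left sum_divide_distrib sum_negf)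
  finally show ?thesis .
qed

section \<open>The Gamma density and its Fourier inversion\<close>

text \<open>Supplies the hypothesis of Fubini wherever complex integrals are exchanged: each double
  integrand is dominated by a tensor product of integrable functions.\<close>

lemma integrable_pair_of_product_bound:
  fixes f :: "'b \<Rightarrow> complex" and g :: "'c \<Rightarrow> complex" and h :: "'b \<times> 'c \<Rightarrow> complex"
  assumes "sigma_finite_measure N" and [measurable]: "h \<in> borel_measurable (M \<Otimes>\<^sub>M N)"
    and f: "integrable M f" and g: "integrable N g"
    and le: "\<And>x y. norm (h (x, y)) \<le> norm (f x) * norm (g y)"
  shows "integrable (M \<Otimes>\<^sub>M N) h"
proof (rule integrableI_bounded)
  interpret sigma_finite_measure N by fact
  have [measurable]: "f \<in> borel_measurable M" "g \<in> borel_measurable N" using f g by auto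
  have "(\<integral>\<^sup>+p. ennreal (norm (h p)) \<partial>(M \<Otimes>\<^sub>M N)) = (\<integral>\<^sup>+x. \<integral>\<^sup>+y. ennreal (norm (h (x, y))) \<partial>N \<partial>M)"
    by (rule nn_integral_fst[symmetric]) measurable
  also have "\<dots> \<le> (\<integral>\<^sup>+x. \<integral>\<^sup>+y. ennreal (norm (f x)) * ennreal (norm (g y)) \<partial>N \<partial>M)"
    using le by (intro nn_integral_mono) (simp flip: ennreal_mult)
  also have "\<dots> = (\<integral>\<^sup>+x. ennreal (norm (f x)) \<partial>M) * (\<integral>\<^sup>+y. ennreal (norm (g y)) \<partial>N)"
    by (simp add: nn_integral_cmult nn_integral_multc)
  also have "\<dots> < \<infinity>"
    using f g by (simp add: integrable_iff_bounded ennreal_mult_less_top)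
  finally show "(\<integral>\<^sup>+p. ennreal (norm (h p)) \<partial>(M \<Otimes>\<^sub>M N)) < \<infinity>" .
qed fact

lemma integral_pair_product:
  fixes f :: "'b \<Rightarrow> complex" and g :: "'c \<Rightarrow> complex"
  assumes "sigma_finite_measure M" "sigma_finite_measure N" and f: "integrable M f" and g: "integrable N g"
  shows "(LINT p|(M \<Otimes>\<^sub>M N). f (fst p) * g (snd p)) = (LINT x|M. f x) * (LINT y|N. g y)"
proof -
  interpret pair_sigma_finite M N by (intro pair_sigma_finite.intro assms)
  have [measurable]: "f \<in> borel_measurable M" "g \<in> borel_measurable N" using f g by auto
  have "integrable (M \<Otimes>\<^sub>M N) (\<lambda>p. f (fst p) * g (snd p))"
    by (rule integrable_pair_of_product_bound[OF assms(2) _ f g]) (simp_all add: norm_mult)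
  from integral_fst'[OF this] show ?thesis by simp
qed

definition gamma_fun :: "real \<Rightarrow> real \<Rightarrow> real" where
  "gamma_fun a u = (if u > 0 then u powr a * exp (- u) else 0)"

text \<open>Classically this is \<open>Gamma (a + 1) / (1 + i t)^(a + 1)\<close>. Only its modulus,
  up to the constant at \<open>t = 0\<close>, and the inversion formula are established.\<close>

definition gamma_ft :: "real \<Rightarrow> real \<Rightarrow> complex" where
  "gamma_ft a t = (LINT u|lborel. cis (t * (- u)) * complex_of_real (gamma_fun a u))"

lemma gamma_fun_nonneg: "gamma_fun a u \<ge> 0"
  by (simp add: gamma_fun_def)

lemma borel_measurable_gamma_fun [measurable]: "gamma_fun a \<in> borel_measurable borel"
  unfolding gamma_fun_def by measurable

lemma integrable_gamma_fun:
  assumes "a > -1"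
  shows "integrable lborel (\<lambda>u. complex_of_real (gamma_fun a u))"
proof -
  have "(\<integral>\<^sup>+u. ennreal (gamma_fun a u) \<partial>lborel) \<le> (\<integral>\<^sup>+u. ennreal (indicator {0..} u * u powr (a + 1 - 1) / exp u) \<partial>lborel)"
    by (intro nn_integral_mono) (auto simp: gamma_fun_def exp_minus field_simps indicator_def)
  also have "\<dots> < \<infinity>"
  proof -
    have "a + 1 > 0" using assms by simp
    from Gamma_conv_nn_integral_real[OF this] show ?thesis by (metis ennreal_less_top infinity_ennreal_def)
  qed
  finally have "integrable lborel (gamma_fun a)"
    by (intro integrableI_nonneg) (simp_all add: gamma_fun_nonneg)
  then show ?thesis by simp
qed

lemma mult_gamma_fun: "u * gamma_fun a u = gamma_fun (a + 1) u"
  by (simp add: gamma_fun_def powr_add)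

text \<open>The derivative of \<open>u^(a + 1) exp (- (1 + i t) u)\<close> integrates to zero over
  the half-line, as the primitive vanishes at 0 and at infinity.\<close>

lemma gamma_ft_by_parts:
  assumes a: "a > 0"
  shows "complex_of_real (a + 1) * gamma_ft a t = Complex 1 t * gamma_ft (a + 1) t"
proof -
  let ?z = "Complex 1 t"
  let ?f = "\<lambda>u. complex_of_real (a + 1) * (cis (t * (- u)) * complex_of_real (gamma_fun a u))
      - ?z * (cis (t * (- u)) * complex_of_real (gamma_fun (a + 1) u))"
  let ?F = "\<lambda>u. cis (t * (- u)) * complex_of_real (u powr (a + 1) * exp (- u))"
  have int: "integrable lborel (\<lambda>u. cis (t * (- u)) * complex_of_real (gamma_fun b u))" if "b > -1" for b
    by (intro integrable_cis_mult integrable_gamma_fun that) simp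
  have fint: "integrable lborel ?f"
    using a by (intro Bochner_Integration.integrable_diff integrable_mult_right int) auto
  have nF: "norm (?F u) = u powr (a + 1) * exp (- u)" for u
    by (simp add: norm_mult)
  \<comment> \<open>On the open half-line the cut-off in \<open>gamma_fun\<close> is invisible and
    the primitive is differentiable; the values at the ends enter only as limits.\<close>
  have "(LBINT u=0..\<infinity>. ?f u) = 0 - 0"
  proof (rule interval_integral_FTC_integrable[where F = ?F])
    fix u :: real assume "0 < ereal u"
    then have u: "u > 0" by (simp add: zero_ereal_def)
    have 1: "((\<lambda>u. cis (t * (- u))) has_vector_derivative (\<i> * complex_of_real (- t) * cis (t * (- u)))) (at u)"
      by (rule cis_has_vector_derivative) (auto intro!: derivative_eq_intros)
    have 2: "((\<lambda>u. u powr (a + 1) * exp (- u)) has_real_derivative ((a + 1) * u powr a * exp (- u) - u powr (a + 1) * exp (- u))) (at u)"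
      by (rule derivative_eq_intros DERIV_fun_powr refl u | use u in \<open>simp add: powr_add\<close>)+
    show "(?F has_vector_derivative ?f u) (at u)"
      by (rule has_vector_derivative_eq_rhs[OF has_vector_derivative_mult[OF 1 has_vector_derivative_of_real[OF 2]]])
         (use u in \<open>simp add: gamma_fun_def Complex_eq algebra_simps\<close>)
    have "isCont (gamma_fun b) u" for b
    proof -
      have "isCont (\<lambda>u. u powr b * exp (- u)) u" using u by (intro continuous_intros) auto
      moreover have "eventually (\<lambda>v. v powr b * exp (- v) = gamma_fun b v) (nhds u)"
        using eventually_nhds_in_open[of "{0<..}" u] u by (auto elim!: eventually_mono simp: gamma_fun_def)
      ultimately show ?thesis by (simp add: isCont_cong)
    qed
    moreover have "isCont cis v" for v
      using continuous_on_cis[OF continuous_on_id, of UNIV] by (simp add: continuous_on_eq_continuous_at)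
    ultimately show "isCont ?f u"
      by (intro continuous_intros isCont_o2[of u "\<lambda>u. t * (- u)" cis]) auto
  next
    show "set_integrable lborel (einterval 0 \<infinity>) ?f"
      unfolding set_integrable_def by (rule integrable_mult_indicator[OF _ fint]) simp
    have "((\<lambda>u. u powr (a + 1) * exp (- u)) \<longlongrightarrow> 0) (at_right (0::real))"
      using a by real_asymp
    then show "((?F \<circ> real_of_ereal) \<longlongrightarrow> 0) (at_right 0)"
      unfolding ereal_tendsto_simps zero_ereal_def
      by (intro tendsto_norm_zero_cancel[of ?F]) (simp only: nF)
    have "((\<lambda>u. u powr (a + 1) * exp (- u)) \<longlongrightarrow> 0) at_top"
      by real_asymp
    then show "((?F \<circ> real_of_ereal) \<longlongrightarrow> 0) (at_left \<infinity>)"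
      unfolding ereal_tendsto_simps
      by (intro tendsto_norm_zero_cancel[of ?F]) (simp only: nF)
  qed simp
  also have "(LBINT u=0..\<infinity>. ?f u) = (LINT u|lborel. ?f u)"
    unfolding interval_lebesgue_integral_def set_lebesgue_integral_def
    by (auto intro!: Bochner_Integration.integral_cong simp: gamma_fun_def einterval_def zero_ereal_def indicator_def)
  also have "\<dots> = complex_of_real (a + 1) * gamma_ft a t - ?z * gamma_ft (a + 1) t"
  proof -
    have 1: "integrable lborel (\<lambda>u. cis (t * (- u)) * complex_of_real (gamma_fun a u))"
      and 2: "integrable lborel (\<lambda>u. cis (t * (- u)) * complex_of_real (gamma_fun (a + 1) u))"
      using int[of a] int[of "a + 1"] a by linarith+
    show ?thesis
      unfolding gamma_ft_def Bochner_Integration.integral_diff[OF integrable_mult_right[OF 1] integrable_mult_right[OF 2]]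
      by (simp only: integral_mult_right_zero)
  qed
  finally show ?thesis by simp
qed

text \<open>Differentiation in \<open>t\<close> brings down \<open>- i u\<close> and so raises the
  exponent by one; integration by parts lowers it again. The result is the power equation with
  exponent \<open>a + 1\<close> on the line \<open>1 + i t\<close>.\<close>

lemma norm_gamma_ft:
  assumes a: "a > 0"
  shows "(norm (gamma_ft a t))\<^sup>2 = (norm (gamma_ft a 0))\<^sup>2 * (1 / (1 + t\<^sup>2)) powr (a + 1)"
proof -
  have D: "(gamma_ft a has_vector_derivative (- \<i> * complex_of_real (a + 1) / Complex 1 t * gamma_ft a t)) (at t)" for t
  proof -
    have eq: "complex_of_real (- u) * complex_of_real (gamma_fun a u) = - complex_of_real (gamma_fun (a + 1) u)" for u
      by (simp flip: mult_gamma_fun)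
    have "(gamma_ft a has_vector_derivative (LINT u|lborel. \<i> * complex_of_real (- u) * (cis (t * (- u)) * complex_of_real (gamma_fun a u)))) (at t)"
      unfolding gamma_ft_def
      by (rule has_vector_derivative_integral_cis)
         (use a integrable_gamma_fun[of "a + 1"] in \<open>simp_all add: integrable_gamma_fun eq del: of_real_minus\<close>)
    also have "(LINT u|lborel. \<i> * complex_of_real (- u) * (cis (t * (- u)) * complex_of_real (gamma_fun a u)))
       = (LINT u|lborel. - \<i> * (cis (t * (- u)) * complex_of_real (gamma_fun (a + 1) u)))"
      by (intro Bochner_Integration.integral_cong) (simp_all flip: mult_gamma_fun)
    also have "\<dots> = - \<i> * gamma_ft (a + 1) t"
      unfolding gamma_ft_def by (rule integral_mult_right_zero)
    also have "gamma_ft (a + 1) t = complex_of_real (a + 1) * gamma_ft a t / Complex 1 t"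
      using gamma_ft_by_parts[OF a, of t] by (metis Complex_eq_0 nonzero_mult_div_cancel_left zero_neq_one)
    finally show ?thesis by (simp add: mult.assoc)
  qed
  show ?thesis
    using norm_solution_of_power_ode[OF _ D, of t] by simp
qed

text \<open>Gaussian damping in \<open>t\<close> makes Fubini applicable and turns the double
  integral into an average of \<open>f\<close> around \<open>u\<close> at scale \<open>e k\<close>.
  Letting \<open>e k\<close> tend to 0, boundedness and continuity of \<open>f\<close> give the
  limit at every point; the averaging kernel has mass \<open>2 pi\<close>.\<close>

lemma fourier_inversion_real:
  fixes f :: "real \<Rightarrow> complex"
  defines "F \<equiv> \<lambda>t. LINT v|lborel. cis (t * (- v)) * f v"
  assumes f: "integrable lborel f" and cont: "continuous_on UNIV f" and bd: "\<And>v. norm (f v) \<le> K"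
    and F: "integrable lborel F"
  shows "(LINT t|lborel. cis (t * u) * F t) = 2 * complex_of_real pi * f u"
proof -
  have [measurable]: "f \<in> borel_measurable borel" using f by auto
  have [measurable]: "F \<in> borel_measurable borel" using F by auto
  define e where "e = (\<lambda>k::nat. 1 / real (Suc k))"
  have e0: "e k > 0" for k by (simp add: e_def)
  have e_lim: "e \<longlonglongrightarrow> 0" unfolding e_def by (rule LIMSEQ_Suc[OF lim_1_over_n])
  \<comment> \<open>The transform of \<open>exp (- s t^2)\<close> at \<open>(u - v) / (2 pi)\<close>
    is a multiple of \<open>exp (- (u - v)^2 / (4 s))\<close>, so \<open>4 s = e^2\<close> makes the
    width exactly \<open>e k\<close>.\<close>
  define s where "s = (\<lambda>k. (e k)\<^sup>2 / 4)"
  have s0: "s k > 0" for k using e0[of k] by (simp add: s_def)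
  define I where "I = (\<lambda>k. LINT t|lborel. complex_of_real (exp (- s k * t\<^sup>2)) * (cis (t * u) * F t))"
  have "I \<longlonglongrightarrow> (LINT t|lborel. cis (t * u) * F t)"
    unfolding I_def
  proof (rule integral_dominated_convergence[where w = "\<lambda>t. norm (F t)"])
    show "AE t in lborel. (\<lambda>k. complex_of_real (exp (- s k * t\<^sup>2)) * (cis (t * u) * F t)) \<longlonglongrightarrow> cis (t * u) * F t"
    proof (rule AE_I2)
      fix t
      have "(\<lambda>k. complex_of_real (exp (- ((e k)\<^sup>2 / 4) * t\<^sup>2)) * (cis (t * u) * F t)) \<longlonglongrightarrow> complex_of_real (exp (- (0\<^sup>2 / 4) * t\<^sup>2)) * (cis (t * u) * F t)"
        by (intro tendsto_intros e_lim) auto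
      then show "(\<lambda>k. complex_of_real (exp (- s k * t\<^sup>2)) * (cis (t * u) * F t)) \<longlonglongrightarrow> cis (t * u) * F t"
        by (simp add: s_def)
    qed
    show "AE t in lborel. norm (complex_of_real (exp (- s k * t\<^sup>2)) * (cis (t * u) * F t)) \<le> norm (F t)" for k
      using s0[of k] by (intro AE_I2) (simp add: norm_mult mult_left_le_one_le)
  qed (use F in auto)
  moreover have "I \<longlonglongrightarrow> 2 * complex_of_real pi * f u"
  proof -
    have Ik: "I k = (LINT w|lborel. complex_of_real (2 * sqrt pi * exp (- w\<^sup>2)) * f (u + e k * w))" for k
    proof -
      let ?G = "\<lambda>t v. complex_of_real (exp (- s k * t\<^sup>2)) * (cis (t * (u - v)) * f v)"
      have gint: "integrable lborel (\<lambda>t. exp (- s k * t\<^sup>2))"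
        using has_bochner_integral_gaussian[OF s0] by (simp add: has_bochner_integral_iff)
      have "integrable (lborel \<Otimes>\<^sub>M lborel) (\<lambda>(t, v). ?G t v)"
      proof (rule integrable_pair_of_product_bound[where f = "\<lambda>t. complex_of_real (exp (- s k * t\<^sup>2))" and g = f])
        show "(\<lambda>(t, v). ?G t v) \<in> borel_measurable (lborel \<Otimes>\<^sub>M lborel)"
          by measurable
        show "integrable lborel (\<lambda>t. complex_of_real (exp (- s k * t\<^sup>2)))"
          using gint by (rule integrable_of_real)
      qed (simp_all only: prod.case norm_mult norm_cis mult_1 f order_refl lborel.sigma_finite_measure_axioms)
      note Fub = lborel_pair.Fubini_integral[OF this]
      have "I k = (LINT t|lborel. LINT v|lborel. ?G t v)"
        unfolding I_def
      proof (intro Bochner_Integration.integral_cong refl)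
        fix t
        have cs: "cis (t * (u - v)) = cis (t * u) * cis (t * (- v))" for v
          by (simp add: cis_mult right_diff_distrib)
        have "(LINT v|lborel. ?G t v) = (LINT v|lborel. (complex_of_real (exp (- s k * t\<^sup>2)) * cis (t * u)) * (cis (t * (- v)) * f v))"
          by (intro Bochner_Integration.integral_cong refl) (simp only: cs mult.assoc)
        also have "\<dots> = (complex_of_real (exp (- s k * t\<^sup>2)) * cis (t * u)) * F t"
          unfolding F_def by (rule integral_mult_right_zero)
        finally show "complex_of_real (exp (- s k * t\<^sup>2)) * (cis (t * u) * F t) = (LINT v|lborel. ?G t v)"
          by (metis mult.assoc)
      qed
      also have "\<dots> = (LINT v|lborel. LINT t|lborel. ?G t v)" by (rule Fub[symmetric])
      also have "\<dots> = (LINT v|lborel. gauss_ft (complex_of_real (s k)) ((u - v) / (2 * pi)) * f v)"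
      proof (intro Bochner_Integration.integral_cong refl)
        fix v
        have "(LINT t|lborel. ?G t v) = (LINT t|lborel. (cis ((u - v) / (2 * pi) * (2 * pi * t)) * exp (- complex_of_real (s k) * complex_of_real (t\<^sup>2))) * f v)"
        proof (intro Bochner_Integration.integral_cong refl)
          fix t
          have c: "(u - v) / (2 * pi) * (2 * pi * t) = t * (u - v)" by simp
          have x: "exp (- complex_of_real (s k) * complex_of_real (t\<^sup>2)) = complex_of_real (exp (- s k * t\<^sup>2))"
            by (simp flip: exp_of_real)
          show "?G t v = (cis ((u - v) / (2 * pi) * (2 * pi * t)) * exp (- complex_of_real (s k) * complex_of_real (t\<^sup>2))) * f v"
            unfolding c x by (simp only: mult_ac)
        qed
        also have "\<dots> = gauss_ft (complex_of_real (s k)) ((u - v) / (2 * pi)) * f v"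
          unfolding gauss_ft_def by (rule integral_mult_left_zero)
        finally show "(LINT t|lborel. ?G t v) = gauss_ft (complex_of_real (s k)) ((u - v) / (2 * pi)) * f v" .
      qed
      also have "\<dots> = (LINT v|lborel. complex_of_real (2 * sqrt pi / e k * exp (- ((u - v) / e k)\<^sup>2)) * f v)"
      proof (intro Bochner_Integration.integral_cong refl)
        fix v
        have sq: "sqrt (pi / s k) = 2 * sqrt pi / e k"
          using e0[of k] by (simp add: s_def real_sqrt_divide real_sqrt_mult)
        have ex: "- complex_of_real (pi\<^sup>2 * ((u - v) / (2 * pi))\<^sup>2) / complex_of_real (s k) = complex_of_real (- ((u - v) / e k)\<^sup>2)"
          using e0[of k] unfolding of_real_divide[symmetric] of_real_minus[symmetric]
          by (simp add: s_def power_divide power_mult_distrib)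
        show "gauss_ft (complex_of_real (s k)) ((u - v) / (2 * pi)) * f v = complex_of_real (2 * sqrt pi / e k * exp (- ((u - v) / e k)\<^sup>2)) * f v"
          using s0[of k] by (subst gauss_ft_eq, simp, unfold ex gauss_ft_0_of_real[OF s0] exp_of_real sq) simp
      qed
      \<comment> \<open>The substitution \<open>v = u + e k * w\<close> moves the dependence on
        \<open>k\<close> from the kernel into the argument of \<open>f\<close>.\<close>
      also have "\<dots> = \<bar>e k\<bar> *\<^sub>R (LINT w|lborel. complex_of_real (2 * sqrt pi / e k * exp (- ((u - (u + e k * w)) / e k)\<^sup>2)) * f (u + e k * w))"
        by (rule lborel_integral_real_affine) (use e0[of k] in simp)
      also have "\<dots> = (LINT w|lborel. \<bar>e k\<bar> *\<^sub>R (complex_of_real (2 * sqrt pi / e k * exp (- ((u - (u + e k * w)) / e k)\<^sup>2)) * f (u + e k * w)))"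
        by (rule integral_scaleR_right[symmetric])
      also have "\<dots> = (LINT w|lborel. complex_of_real (2 * sqrt pi * exp (- w\<^sup>2)) * f (u + e k * w))"
        using e0[of k] by (intro Bochner_Integration.integral_cong refl) (auto simp: scaleR_conv_of_real simp flip: exp_of_real)
      finally show ?thesis .
    qed
    have gint: "integrable lborel (\<lambda>w::real. exp (- w\<^sup>2))" "(LINT w|lborel. exp (- w\<^sup>2)) = sqrt pi"
      using has_bochner_integral_gaussian[of 1] by (auto simp: has_bochner_integral_iff)
    have "(\<lambda>k. LINT w|lborel. complex_of_real (2 * sqrt pi * exp (- w\<^sup>2)) * f (u + e k * w))
       \<longlonglongrightarrow> (LINT w|lborel. complex_of_real (2 * sqrt pi * exp (- w\<^sup>2)) * f u)"
    proof (rule integral_dominated_convergence[where w = "\<lambda>w. 2 * sqrt pi * K * exp (- w\<^sup>2)"])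
      show "integrable lborel (\<lambda>w. 2 * sqrt pi * K * exp (- w\<^sup>2))"
        by (intro integrable_mult_right gint)
      show "AE w in lborel. (\<lambda>k. complex_of_real (2 * sqrt pi * exp (- w\<^sup>2)) * f (u + e k * w)) \<longlonglongrightarrow> complex_of_real (2 * sqrt pi * exp (- w\<^sup>2)) * f u"
      proof (rule AE_I2)
        fix w
        have "isCont f (u + 0 * w)" using cont by (simp add: continuous_on_eq_continuous_at)
        then have "(\<lambda>k. f (u + e k * w)) \<longlonglongrightarrow> f (u + 0 * w)"
          by (rule isCont_tendsto_compose) (intro tendsto_intros e_lim)
        then show "(\<lambda>k. complex_of_real (2 * sqrt pi * exp (- w\<^sup>2)) * f (u + e k * w)) \<longlonglongrightarrow> complex_of_real (2 * sqrt pi * exp (- w\<^sup>2)) * f u"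
          by (intro tendsto_intros) simp
      qed
      show "AE w in lborel. norm (complex_of_real (2 * sqrt pi * exp (- w\<^sup>2)) * f (u + e k * w)) \<le> 2 * sqrt pi * K * exp (- w\<^sup>2)" for k
        using bd by (intro AE_I2) (simp add: norm_mult mult_ac mult_left_mono)
    qed auto
    also have "(LINT w|lborel. complex_of_real (2 * sqrt pi * exp (- w\<^sup>2)) * f u) = complex_of_real (LINT w|lborel. 2 * sqrt pi * exp (- w\<^sup>2)) * f u"
      by (simp only: integral_mult_left_zero integral_complex_of_real)
    also have "(LINT w|lborel. 2 * sqrt pi * exp (- w\<^sup>2)) = 2 * pi"
      by (simp add: gint)
    also have "complex_of_real (2 * pi) * f u = 2 * complex_of_real pi * f u"
      by simp
    finally show ?thesis unfolding Ik .
  qed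
  ultimately show ?thesis by (rule LIMSEQ_unique)
qed

section \<open>Plancherel inequality\<close>

text \<open>The \<open>T T\<^sup>*\<close> argument: expand the square and integrate in the parameter first.\<close>

lemma nn_integral_square_kernel_le:
  fixes \<kappa> :: "'b \<Rightarrow> 'c \<Rightarrow> complex" and \<omega> :: "'b \<Rightarrow> real" and h :: "'c \<Rightarrow> complex"
  assumes M: "sigma_finite_measure M" and N: "sigma_finite_measure N"
    and \<omega>: "integrable M \<omega>" "\<And>t. \<omega> t \<ge> 0"
    and h: "integrable N h"
    and \<kappa>[measurable]: "case_prod \<kappa> \<in> borel_measurable (M \<Otimes>\<^sub>M N)" and \<kappa>_le: "\<And>t y. norm (\<kappa> t y) \<le> 1"
  shows "(\<integral>\<^sup>+t. ennreal (\<omega> t * (norm (LINT y|N. \<kappa> t y * h y))\<^sup>2) \<partial>M)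
    \<le> (\<integral>\<^sup>+y. \<integral>\<^sup>+y'. ennreal (norm (h y) * norm (h y') *
          norm (LINT t|M. complex_of_real (\<omega> t) * (\<kappa> t y * cnj (\<kappa> t y')))) \<partial>N \<partial>N)"
proof -
  interpret M: sigma_finite_measure M by fact
  interpret N: sigma_finite_measure N by fact
  interpret NN: pair_sigma_finite N N by standard
  interpret MNN: pair_sigma_finite M "N \<Otimes>\<^sub>M N" by (intro pair_sigma_finite.intro M NN.P.sigma_finite_measure_axioms)
  have [measurable]: "\<omega> \<in> borel_measurable M" "h \<in> borel_measurable N" using \<omega> h by auto
  have [measurable]: "cnj \<in> borel_measurable borel"
    by (intro borel_measurable_continuous_onI continuous_intros)
  define A where "A = (\<lambda>t. LINT y|N. \<kappa> t y * h y)"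
  have [measurable]: "A \<in> borel_measurable M" unfolding A_def by measurable
  have kh: "integrable N (\<lambda>y. \<kappa> t y * h y)" if "t \<in> space M" for t
  proof (rule Bochner_Integration.integrable_bound[OF h])
    show "(\<lambda>y. \<kappa> t y * h y) \<in> borel_measurable N" using that by measurable
  qed (use \<kappa>_le in \<open>simp add: norm_mult mult_left_le_one_le\<close>)
  have ckh: "integrable N (\<lambda>y. cnj (\<kappa> t y * h y))" if "t \<in> space M" for t
    unfolding complex_integrable_cnj by (rule kh[OF that])
  let ?H = "\<lambda>t p. complex_of_real (\<omega> t) * ((\<kappa> t (fst p) * h (fst p)) * cnj (\<kappa> t (snd p) * h (snd p)))"
  have sq: "complex_of_real (\<omega> t * (norm (A t))\<^sup>2) = (LINT p|(N \<Otimes>\<^sub>M N). ?H t p)" if t: "t \<in> space M" for t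
  proof -
    have "complex_of_real (\<omega> t * (norm (A t))\<^sup>2) = complex_of_real (\<omega> t) * (A t * cnj (A t))"
      by (simp only: of_real_mult complex_norm_square)
    also have "cnj (A t) = (LINT y|N. cnj (\<kappa> t y * h y))"
      unfolding A_def by (rule Bochner_Integration.integral_cnj[symmetric])
    also have "A t * (LINT y|N. cnj (\<kappa> t y * h y)) = (LINT p|(N \<Otimes>\<^sub>M N). (\<kappa> t (fst p) * h (fst p)) * cnj (\<kappa> t (snd p) * h (snd p)))"
      unfolding A_def by (rule integral_pair_product[OF N N kh[OF t] ckh[OF t], symmetric])
    finally show ?thesis by (simp only: integral_mult_right_zero)
  qed
  have hh: "integrable (N \<Otimes>\<^sub>M N) (\<lambda>p. h (fst p) * h (snd p))"
    by (rule integrable_pair_of_product_bound[OF N _ h h]) (simp_all add: norm_mult)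
  have H: "integrable (M \<Otimes>\<^sub>M (N \<Otimes>\<^sub>M N)) (\<lambda>(t, p). ?H t p)"
  proof (rule integrable_pair_of_product_bound[OF NN.P.sigma_finite_measure_axioms _ integrable_of_real[OF \<omega>(1)] hh])
    show "(\<lambda>(t, p). ?H t p) \<in> borel_measurable (M \<Otimes>\<^sub>M (N \<Otimes>\<^sub>M N))" by measurable
    fix t :: 'b and p :: "'c \<times> 'c"
    have "norm (\<kappa> t (fst p)) * norm (\<kappa> t (snd p)) \<le> 1"
      using \<kappa>_le by (intro mult_le_one) auto
    then have "(norm (\<kappa> t (fst p)) * norm (\<kappa> t (snd p))) * (\<bar>\<omega> t\<bar> * (norm (h (fst p)) * norm (h (snd p))))
      \<le> 1 * (\<bar>\<omega> t\<bar> * (norm (h (fst p)) * norm (h (snd p))))"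
      by (intro mult_right_mono) auto
    then show "norm (case (t, p) of (t, p) \<Rightarrow> ?H t p) \<le> norm (complex_of_real (\<omega> t)) * norm (h (fst p) * h (snd p))"
      by (simp add: norm_mult mult_ac)
  qed
  have int: "integrable M (\<lambda>t. complex_of_real (\<omega> t * (norm (A t))\<^sup>2))"
    using MNN.integrable_fst[OF H] by (subst Bochner_Integration.integrable_cong[OF refl sq]) auto
  then have int': "integrable M (\<lambda>t. \<omega> t * (norm (A t))\<^sup>2)"
    by (simp only: complex_of_real_integrable_eq)
  have "(\<integral>\<^sup>+t. ennreal (\<omega> t * (norm (A t))\<^sup>2) \<partial>M) = ennreal (LINT t|M. \<omega> t * (norm (A t))\<^sup>2)"
    using \<omega>(2) by (intro nn_integral_eq_integral int') auto
  also have "(LINT t|M. \<omega> t * (norm (A t))\<^sup>2) \<le> norm (LINT t|M. complex_of_real (\<omega> t * (norm (A t))\<^sup>2))"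
    by (simp only: integral_complex_of_real norm_of_real abs_ge_self)
  also have "(LINT t|M. complex_of_real (\<omega> t * (norm (A t))\<^sup>2)) = (LINT t|M. LINT p|(N \<Otimes>\<^sub>M N). ?H t p)"
    by (intro Bochner_Integration.integral_cong refl sq)
  also have "\<dots> = (LINT p|(N \<Otimes>\<^sub>M N). LINT t|M. ?H t p)"
    by (rule MNN.Fubini_integral[OF H, symmetric])
  \<comment> \<open>Absolute values are taken only after the integration in \<open>t\<close>, so the
    cancellation in \<open>t\<close> survives inside the kernel.\<close>
  also have "ennreal (norm \<dots>) \<le> (\<integral>\<^sup>+p. ennreal (norm (LINT t|M. ?H t p)) \<partial>(N \<Otimes>\<^sub>M N))"
    by (rule integral_norm_bound_ennreal[OF MNN.integrable_snd[OF H]])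
  also have "\<dots> = (\<integral>\<^sup>+p. ennreal (norm (h (fst p)) * norm (h (snd p)) *
          norm (LINT t|M. complex_of_real (\<omega> t) * (\<kappa> t (fst p) * cnj (\<kappa> t (snd p))))) \<partial>(N \<Otimes>\<^sub>M N))"
  proof (intro nn_integral_cong arg_cong[where f = ennreal])
    fix p
    have "(LINT t|M. ?H t p) = (LINT t|M. (h (fst p) * cnj (h (snd p))) * (complex_of_real (\<omega> t) * (\<kappa> t (fst p) * cnj (\<kappa> t (snd p)))))"
      by (intro Bochner_Integration.integral_cong refl) (simp add: mult_ac)
    also have "\<dots> = (h (fst p) * cnj (h (snd p))) * (LINT t|M. complex_of_real (\<omega> t) * (\<kappa> t (fst p) * cnj (\<kappa> t (snd p))))"
      by (rule integral_mult_right_zero)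
    finally show "norm (LINT t|M. ?H t p) = norm (h (fst p)) * norm (h (snd p)) *
          norm (LINT t|M. complex_of_real (\<omega> t) * (\<kappa> t (fst p) * cnj (\<kappa> t (snd p))))"
      by (simp add: norm_mult)
  qed
  also have "\<dots> = (\<integral>\<^sup>+y. \<integral>\<^sup>+y'. ennreal (norm (h y) * norm (h y') *
          norm (LINT t|M. complex_of_real (\<omega> t) * (\<kappa> t y * cnj (\<kappa> t y')))) \<partial>N \<partial>N)"
  proof -
    have "(\<lambda>p. ennreal (norm (h (fst p)) * norm (h (snd p)) *
          norm (LINT t|M. complex_of_real (\<omega> t) * (\<kappa> t (fst p) * cnj (\<kappa> t (snd p)))))) \<in> borel_measurable (N \<Otimes>\<^sub>M N)"
      by measurable
    from N.nn_integral_fst[OF this] show ?thesis by simp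
  qed
  finally show ?thesis unfolding A_def by (simp add: ennreal_leI)
qed

lemma nn_integral_lborel_reflect:
  fixes f :: "'a::euclidean_space \<Rightarrow> ennreal"
  assumes [measurable]: "f \<in> borel_measurable borel"
  shows "(\<integral>\<^sup>+y. f (x - y) \<partial>lborel) = (\<integral>\<^sup>+y. f y \<partial>lborel)"
proof -
  have "(\<integral>\<^sup>+y. f y \<partial>lborel) = (\<integral>\<^sup>+y. f y \<partial>density (distr lborel borel (\<lambda>y::'a. x + (-1) *\<^sub>R y)) (\<lambda>_. ennreal (\<bar>- 1 :: real\<bar> ^ DIM('a))))"
    by (subst lborel_affine[of "-1" x]) simp_all
  then show ?thesis by (simp add: nn_integral_density nn_integral_distr)
qed

definition euclidean_ft :: "('a::euclidean_space \<Rightarrow> complex) \<Rightarrow> 'a \<Rightarrow> complex" where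
  "euclidean_ft h \<xi> = (LINT x|lborel. cis (- 2 * pi * (x \<bullet> \<xi>)) * h x)"

lemma borel_measurable_euclidean_ft [measurable]:
  fixes h :: "'a::euclidean_space \<Rightarrow> complex"
  assumes [measurable]: "h \<in> borel_measurable borel"
  shows "euclidean_ft h \<in> borel_measurable borel"
  unfolding euclidean_ft_def by measurable

lemma norm_euclidean_ft_le:
  assumes "integrable lborel h"
  shows "norm (euclidean_ft h \<xi>) \<le> (LINT x|lborel. norm (h x))"
  unfolding euclidean_ft_def
  by (rule order_trans[OF integral_norm_bound]) (simp add: norm_mult)

text \<open>The integrand is the transform of \<open>exp (- s |\<xi>|^2)\<close>, so mass one
  reflects the value of that Gaussian at the origin; the proof evaluates the integral
  directly.\<close>

lemma nn_integral_normalized_gaussian: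
  assumes s: "s > 0"
  shows "(\<integral>\<^sup>+x. ennreal (sqrt (pi / s) ^ DIM('a) * exp (- (pi\<^sup>2 / s) * (norm (x::'a::euclidean_space))\<^sup>2)) \<partial>lborel) = 1"
proof -
  let ?q = "pi\<^sup>2 / s"
  have q: "?q > 0" using s by simp
  have "complex_of_real (LINT x|lborel. exp (- ?q * (norm (x::'a))\<^sup>2)) = complex_of_real (sqrt (pi / ?q) ^ DIM('a))"
    using integral_gaussian_cis[of "complex_of_real ?q" "0::'a"] q
    by (simp only: gauss_ft_0_of_real[OF q])
       (simp flip: exp_of_real integral_complex_of_real)
  then have I: "(LINT x|lborel. exp (- ?q * (norm (x::'a))\<^sup>2)) = sqrt (pi / ?q) ^ DIM('a)"
    by (simp only: of_real_eq_iff)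
  have "integrable lborel (\<lambda>x::'a. complex_of_real (exp (- ?q * (norm x)\<^sup>2)))"
    using integrable_gaussian[of "complex_of_real ?q"] q by (simp flip: exp_of_real)
  then have int: "integrable lborel (\<lambda>x::'a. exp (- ?q * (norm x)\<^sup>2))"
    by (simp only: complex_of_real_integrable_eq)
  have "(\<integral>\<^sup>+x. ennreal (sqrt (pi / s) ^ DIM('a) * exp (- ?q * (norm (x::'a))\<^sup>2)) \<partial>lborel)
     = ennreal (LINT x|lborel. sqrt (pi / s) ^ DIM('a) * exp (- ?q * (norm (x::'a))\<^sup>2))"
    using s by (intro nn_integral_eq_integral integrable_mult_right int) (auto intro!: AE_I2)
  also have "(LINT x|lborel. sqrt (pi / s) ^ DIM('a) * exp (- ?q * (norm (x::'a))\<^sup>2)) = (sqrt (pi / s) * sqrt (pi / ?q)) ^ DIM('a)"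
    by (simp only: integral_mult_right_zero I power_mult_distrib)
  also have "sqrt (pi / s) * sqrt (pi / ?q) = 1"
    using s by (simp add: power2_eq_square flip: real_sqrt_mult)
  finally show ?thesis by simp
qed

text \<open>Expanding the square and integrating in \<open>\<xi>\<close> first leaves a positive
  convolution kernel of mass one. The Schur test bounds its quadratic form by the squared
  \<open>L^2\<close> norm with constant 1, for every \<open>s\<close>.\<close>

lemma euclidean_ft_gaussian_mean_square_le:
  fixes h :: "'a::euclidean_space \<Rightarrow> complex"
  assumes h: "integrable lborel h" and s: "s > 0"
  shows "(\<integral>\<^sup>+\<xi>. ennreal (exp (- s * (norm \<xi>)\<^sup>2) * (norm (euclidean_ft h \<xi>))\<^sup>2) \<partial>lborel) \<le> (\<integral>\<^sup>+x. ennreal ((norm (h x))\<^sup>2) \<partial>lborel)"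
proof -
  have [measurable]: "h \<in> borel_measurable borel" using h by auto
  define k where "k = (\<lambda>x::'a. sqrt (pi / s) ^ DIM('a) * exp (- (pi\<^sup>2 / s) * (norm x)\<^sup>2))"
  have [measurable]: "k \<in> borel_measurable borel" unfolding k_def by measurable
  have k0: "k x \<ge> 0" for x using s by (simp add: k_def)
  have kint: "(\<integral>\<^sup>+x. ennreal (k x) \<partial>lborel) = 1"
    unfolding k_def by (rule nn_integral_normalized_gaussian[OF s])
  have kint1: "(\<integral>\<^sup>+y. ennreal (k (x - y)) \<partial>lborel) = 1" for x
    using nn_integral_lborel_reflect[of "\<lambda>y. ennreal (k y)" x] kint by simp
  have ksym: "k (x - y) = k (y - x)" for x y by (simp add: k_def norm_minus_commute)
  have gint: "integrable lborel (\<lambda>\<xi>::'a. exp (- s * (norm \<xi>)\<^sup>2))"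
  proof -
    have "integrable lborel (\<lambda>x::'a. complex_of_real (exp (- s * (norm x)\<^sup>2)))"
      using integrable_gaussian[of "complex_of_real s"] s by (simp flip: exp_of_real)
    then show ?thesis by (simp only: complex_of_real_integrable_eq)
  qed
  \<comment> \<open>The two characters combine to a single one at \<open>y - x\<close>, so the
    integral is the transform of the Gaussian there.\<close>
  have ker: "norm (LINT \<xi>|lborel. complex_of_real (exp (- s * (norm \<xi>)\<^sup>2)) * (cis (- 2 * pi * (x \<bullet> \<xi>)) * cnj (cis (- 2 * pi * (y \<bullet> \<xi>))))) = k (x - y)" for x y :: 'a
  proof -
    have "(LINT \<xi>|lborel. complex_of_real (exp (- s * (norm \<xi>)\<^sup>2)) * (cis (- 2 * pi * (x \<bullet> \<xi>)) * cnj (cis (- 2 * pi * (y \<bullet> \<xi>)))))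
      = (LINT \<xi>|lborel. cis (2 * pi * ((y - x) \<bullet> \<xi>)) * exp (- complex_of_real s * complex_of_real ((norm \<xi>)\<^sup>2)))"
      by (intro Bochner_Integration.integral_cong refl)
         (simp add: cis_cnj cis_mult inner_diff_left right_diff_distrib mult.commute flip: exp_of_real)
    also have "\<dots> = complex_of_real (k (y - x))"
      using s by (subst integral_gaussian_cis) (simp_all add: gauss_ft_0_of_real k_def flip: exp_of_real)
    finally show ?thesis using k0 ksym by simp
  qed
  have "(\<integral>\<^sup>+\<xi>. ennreal (exp (- s * (norm \<xi>)\<^sup>2) * (norm (euclidean_ft h \<xi>))\<^sup>2) \<partial>lborel)
     \<le> (\<integral>\<^sup>+x. \<integral>\<^sup>+y. ennreal (norm (h x) * norm (h y) * k (x - y)) \<partial>lborel \<partial>lborel)"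
    unfolding ker[symmetric] euclidean_ft_def
    by (rule nn_integral_square_kernel_le[OF lborel.sigma_finite_measure_axioms lborel.sigma_finite_measure_axioms gint _ h])
       simp_all
  \<comment> \<open>Arithmetic-geometric mean splits the form into two equal halves; in each, one
    variable is integrated out against the kernel of mass one.\<close>
  also have "\<dots> \<le> (\<integral>\<^sup>+x. \<integral>\<^sup>+y. (ennreal ((norm (h x))\<^sup>2 / 2) * ennreal (k (x - y)) + ennreal ((norm (h y))\<^sup>2 / 2) * ennreal (k (x - y))) \<partial>lborel \<partial>lborel)"
  proof (intro nn_integral_mono)
    fix x y :: 'a
    have "norm (h x) * norm (h y) \<le> (norm (h x))\<^sup>2 / 2 + (norm (h y))\<^sup>2 / 2"
      using sum_squares_bound[of "norm (h x)" "norm (h y)"] by simp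
    from mult_right_mono[OF this k0[of "x - y"]]
    show "ennreal (norm (h x) * norm (h y) * k (x - y)) \<le> ennreal ((norm (h x))\<^sup>2 / 2) * ennreal (k (x - y)) + ennreal ((norm (h y))\<^sup>2 / 2) * ennreal (k (x - y))"
      using k0[of "x - y"] by (simp add: distrib_right flip: ennreal_mult ennreal_plus)
  qed
  also have "\<dots> = (\<integral>\<^sup>+x. \<integral>\<^sup>+y. ennreal ((norm (h x))\<^sup>2 / 2) * ennreal (k (x - y)) \<partial>lborel \<partial>lborel)
     + (\<integral>\<^sup>+x. \<integral>\<^sup>+y. ennreal ((norm (h y))\<^sup>2 / 2) * ennreal (k (x - y)) \<partial>lborel \<partial>lborel)"
    by (simp add: nn_integral_add)
  also have "(\<integral>\<^sup>+x. \<integral>\<^sup>+y. ennreal ((norm (h y))\<^sup>2 / 2) * ennreal (k (x - y)) \<partial>lborel \<partial>lborel)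
    = (\<integral>\<^sup>+y. \<integral>\<^sup>+x. ennreal ((norm (h y))\<^sup>2 / 2) * ennreal (k (y - x)) \<partial>lborel \<partial>lborel)"
    by (subst lborel_pair.Fubini') (simp_all add: ksym)
  also have "(\<integral>\<^sup>+x. \<integral>\<^sup>+y. ennreal ((norm (h x))\<^sup>2 / 2) * ennreal (k (x - y)) \<partial>lborel \<partial>lborel) = (\<integral>\<^sup>+x. ennreal ((norm (h x))\<^sup>2 / 2) \<partial>lborel)"
    by (simp add: nn_integral_cmult kint1)
  also have "\<dots> + \<dots> = (\<integral>\<^sup>+x. ennreal ((norm (h x))\<^sup>2) \<partial>lborel)"
    by (simp flip: nn_integral_add ennreal_plus)
  finally show ?thesis .
qed

text \<open>The damped bound is uniform in \<open>s\<close>; taking \<open>s = 1 / (k + 1)\<close>,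
  Fatou's lemma removes the damping.\<close>

lemma euclidean_ft_mean_square_le:
  fixes h :: "'a::euclidean_space \<Rightarrow> complex"
  assumes h: "integrable lborel h"
  shows "(\<integral>\<^sup>+\<xi>. ennreal ((norm (euclidean_ft h \<xi>))\<^sup>2) \<partial>lborel) \<le> (\<integral>\<^sup>+x. ennreal ((norm (h x))\<^sup>2) \<partial>lborel)"
proof -
  have [measurable]: "h \<in> borel_measurable borel" using h by auto
  let ?G = "\<lambda>k \<xi>::'a. exp (- (1 / real (Suc k)) * (norm \<xi>)\<^sup>2) * (norm (euclidean_ft h \<xi>))\<^sup>2"
  have lim: "(\<lambda>k. ennreal (?G k \<xi>)) \<longlonglongrightarrow> ennreal ((norm (euclidean_ft h \<xi>))\<^sup>2)" for \<xi>
  proof -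
    have "(\<lambda>k. ?G k \<xi>) \<longlonglongrightarrow> exp (- 0 * (norm \<xi>)\<^sup>2) * (norm (euclidean_ft h \<xi>))\<^sup>2"
      by (intro tendsto_intros LIMSEQ_Suc[OF lim_1_over_n])
    then show ?thesis by (intro tendsto_ennrealI) simp
  qed
  have "(\<integral>\<^sup>+\<xi>. ennreal ((norm (euclidean_ft h \<xi>))\<^sup>2) \<partial>lborel) = (\<integral>\<^sup>+\<xi>. liminf (\<lambda>k. ennreal (?G k \<xi>)) \<partial>lborel)"
    by (intro nn_integral_cong lim_imp_Liminf[OF _ lim, symmetric]) simp
  also have "\<dots> \<le> liminf (\<lambda>k. \<integral>\<^sup>+\<xi>. ennreal (?G k \<xi>) \<partial>lborel)"
    by (rule nn_integral_liminf) measurable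
  also have "\<dots> \<le> liminf (\<lambda>k::nat. \<integral>\<^sup>+x. ennreal ((norm (h x))\<^sup>2) \<partial>lborel)"
    by (intro Liminf_mono always_eventually allI euclidean_ft_gaussian_mean_square_le[OF h]) simp
  also have "\<dots> = (\<integral>\<^sup>+x. ennreal ((norm (h x))\<^sup>2) \<partial>lborel)"
    by (simp add: Liminf_const)
  finally show ?thesis .
qed

section \<open>Radial integration\<close>

text \<open>The derivative of the volume of the ball of radius \<open>sqrt \<rho>\<close>. The
  variable is the squared radius because Gaussian exponents and phases are linear in it.\<close>

definition radial_density :: "nat \<Rightarrow> real \<Rightarrow> real" where
  "radial_density n \<rho> = (if \<rho> > 0 then real n / 2 * unit_ball_vol (real n) * \<rho> powr (real n / 2 - 1) else 0)"

lemma radial_density_nonneg: "radial_density n \<rho> \<ge> 0"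
  by (simp add: radial_density_def)

lemma borel_measurable_radial_density [measurable]: "radial_density n \<in> borel_measurable borel"
  unfolding radial_density_def by measurable

text \<open>Both measures give a half-line \<open>{..x}\<close> the volume of the ball of radius
  \<open>sqrt x\<close>, and half-lines are an intersection-stable generator.\<close>

lemma distr_norm_square_lborel:
  "distr (lborel :: 'a::euclidean_space measure) borel (\<lambda>y. (norm y)\<^sup>2)
     = density lborel (\<lambda>\<rho>. ennreal (radial_density DIM('a) \<rho>))"
proof (rule measure_eqI_generator_eq[where E = "range (\<lambda>x. {..x})" and \<Omega> = UNIV and A = "\<lambda>i. {..real i}"])
  let ?n = "real DIM('a)"
  have em: "emeasure (distr (lborel :: 'a measure) borel (\<lambda>y. (norm y)\<^sup>2)) {..x}
    = (if x < 0 then 0 else ennreal (unit_ball_vol ?n * x powr (?n / 2)))" for x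
  proof -
    have eq: "(\<lambda>y::'a. (norm y)\<^sup>2) -` {..x} = (if x < 0 then {} else cball 0 (sqrt x))"
    proof -
      have "\<not> (norm y)\<^sup>2 \<le> x" if "x < 0" for y :: 'a
        using that zero_le_power2[of "norm y"] by linarith
      moreover have "(norm y)\<^sup>2 \<le> x \<longleftrightarrow> norm y \<le> sqrt x" if "\<not> x < 0" for y :: 'a
        using that real_le_rsqrt[of "norm y" x] sqrt_ge_absD[of "norm y" x] by auto
      ultimately show ?thesis by auto
    qed
    have "sqrt x ^ DIM('a) = x powr (?n / 2)" if "x \<ge> 0"
    proof (cases "x = 0")
      case False
      then show ?thesis using that
        by (simp add: powr_half_sqrt[symmetric] powr_powr flip: powr_realpow)
    qed (simp add: power_0_left)
    then show ?thesis by (simp add: emeasure_distr eq emeasure_cball)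
  qed
  show "emeasure (distr (lborel :: 'a measure) borel (\<lambda>y. (norm y)\<^sup>2)) X
    = emeasure (density lborel (\<lambda>\<rho>. ennreal (radial_density DIM('a) \<rho>))) X" if "X \<in> range (\<lambda>x. {..x})" for X
  proof -
    from that obtain x where X: "X = {..x}" by auto
    have D: "emeasure (density lborel (\<lambda>\<rho>. ennreal (radial_density DIM('a) \<rho>))) X
       = (\<integral>\<^sup>+\<rho>. ennreal (radial_density DIM('a) \<rho>) * indicator {..x} \<rho> \<partial>lborel)"
      by (simp add: emeasure_density X)
    show ?thesis
    proof (cases "x < 0")
      case True
      then have "(\<integral>\<^sup>+\<rho>. ennreal (radial_density DIM('a) \<rho>) * indicator {..x} \<rho> \<partial>lborel) = (\<integral>\<^sup>+\<rho>. 0 \<partial>(lborel :: real measure))"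
        by (intro nn_integral_cong) (auto simp: radial_density_def indicator_def)
      then show ?thesis unfolding D using True em by (simp add: X)
    next
      case False
      then have x: "x \<ge> 0" by simp
      have "((\<lambda>\<rho>. ?n / 2 * unit_ball_vol ?n * \<rho> powr (?n / 2 - 1)) has_integral
          (?n / 2 * unit_ball_vol ?n * (x powr (?n / 2 - 1 + 1) / (?n / 2 - 1 + 1)))) {0..x}"
        by (intro has_integral_mult_right has_integral_powr_from_0 x) (simp add: DIM_positive)
      from nn_integral_has_integral_lebesgue[OF _ this]
      have "(\<integral>\<^sup>+\<rho>. ennreal (indicator {0..x} \<rho> * (?n / 2 * unit_ball_vol ?n * \<rho> powr (?n / 2 - 1))) \<partial>lborel)
         = ennreal (unit_ball_vol ?n * x powr (?n / 2))"
        by (simp add: DIM_positive)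
      also have "(\<integral>\<^sup>+\<rho>. ennreal (indicator {0..x} \<rho> * (?n / 2 * unit_ball_vol ?n * \<rho> powr (?n / 2 - 1))) \<partial>lborel)
         = (\<integral>\<^sup>+\<rho>. ennreal (radial_density DIM('a) \<rho>) * indicator {..x} \<rho> \<partial>lborel)"
        by (intro nn_integral_cong) (auto simp: radial_density_def indicator_def)
      finally show ?thesis unfolding D using False em by (simp add: X)
    qed
  qed
  show "Int_stable (range (\<lambda>x::real. {..x}))"
    by (auto simp: Int_stable_def)
  show "(\<Union>i. {..real i}) = UNIV"
    using real_arch_simple by auto
  show "emeasure (distr (lborel :: 'a measure) borel (\<lambda>y. (norm y)\<^sup>2)) {..real i} \<noteq> \<infinity>" for i
    unfolding em by simp
qed (auto simp: borel_eq_atMost)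

lemma nn_integral_norm_square:
  assumes [measurable]: "F \<in> borel_measurable borel"
  shows "(\<integral>\<^sup>+y. F ((norm (y::'a::euclidean_space))\<^sup>2) \<partial>lborel)
    = (\<integral>\<^sup>+\<rho>. ennreal (radial_density DIM('a) \<rho>) * F \<rho> \<partial>lborel)"
proof -
  have "(\<integral>\<^sup>+y. F ((norm (y::'a))\<^sup>2) \<partial>lborel) = (\<integral>\<^sup>+\<rho>. F \<rho> \<partial>distr (lborel :: 'a measure) borel (\<lambda>y. (norm y)\<^sup>2))"
    by (simp add: nn_integral_distr)
  then show ?thesis by (simp add: distr_norm_square_lborel nn_integral_density)
qed

section \<open>One-dimensional power integrals and the majorant of the bilinear kernel\<close>

lemma nn_integral_one_plus_abs_powr:
  assumes q: "q > 1"
  shows "(\<integral>\<^sup>+x. ennreal ((1 + \<bar>x\<bar>) powr (- q)) \<partial>(lborel :: real measure)) < \<infinity>"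
proof -
  let ?h = "\<lambda>x::real. ennreal ((1 + \<bar>x\<bar>) powr (- q)) * indicator {0..} x"
  have "(\<integral>\<^sup>+x. ?h x \<partial>lborel) = (\<integral>\<^sup>+x. ennreal ((1 + x) powr (- q)) * indicator {0..} x \<partial>lborel)"
    by (intro nn_integral_cong) (auto simp: indicator_def)
  also have "\<dots> = ennreal (0 - (- ((1 + 0) powr (1 - q) / (q - 1))))"
  proof (rule nn_integral_FTC_atLeast)
    show "((\<lambda>x. - ((1 + x) powr (1 - q) / (q - 1))) \<longlongrightarrow> 0) at_top"
      using q by real_asymp
    show "((\<lambda>x. - ((1 + x) powr (1 - q) / (q - 1))) has_real_derivative (1 + x) powr (- q)) (at x)" if "0 \<le> x" for x
    proof -
      have "((\<lambda>x. (1 + x) powr (1 - q)) has_real_derivative (1 - q) * (1 + x) powr (1 - q - of_nat 1) * 1) (at x)"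
        using that by (intro DERIV_fun_powr) (auto intro!: derivative_eq_intros)
      moreover have "- ((1 - q) * (1 + x) powr (1 - q - of_nat 1) * 1 / (q - 1)) = (1 + x) powr (- q)"
        using q by (simp add: divide_simps) (simp add: algebra_simps)
      ultimately show ?thesis
        by (metis DERIV_minus DERIV_cdivide)
    qed
  qed auto
  finally have fin: "(\<integral>\<^sup>+x. ?h x \<partial>lborel) < \<infinity>" by simp
  have "(\<integral>\<^sup>+x. ennreal ((1 + \<bar>x\<bar>) powr (- q)) \<partial>(lborel :: real measure)) \<le> (\<integral>\<^sup>+x. ?h x + ?h (0 - x) \<partial>lborel)"
    by (intro nn_integral_mono) (auto simp: indicator_def)
  also have "\<dots> = (\<integral>\<^sup>+x. ?h x \<partial>lborel) + (\<integral>\<^sup>+x. ?h (0 - x) \<partial>lborel)"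
    by (intro nn_integral_add) measurable
  also have "(\<integral>\<^sup>+x. ?h (0 - x) \<partial>lborel) = (\<integral>\<^sup>+x. ?h x \<partial>lborel)"
    by (rule nn_integral_lborel_reflect) measurable
  finally show ?thesis using fin by (auto simp: ennreal_add_less_top intro: le_less_trans)
qed

lemma nn_integral_one_plus_square_powr:
  assumes p: "p > 1 / 2"
  shows "(\<integral>\<^sup>+x. ennreal ((1 + x\<^sup>2) powr (- p)) \<partial>(lborel :: real measure)) < \<infinity>"
proof -
  have "(1 + x\<^sup>2) powr (- p) \<le> 2 powr p * (1 + \<bar>x\<bar>) powr (- (2 * p))" for x :: real
  proof -
    have "(1 + \<bar>x\<bar>)\<^sup>2 \<le> 2 * (1 + x\<^sup>2)"
      using sum_squares_bound[of 1 "\<bar>x\<bar>"] by (simp add: power2_sum)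
    then have "(1 + \<bar>x\<bar>)\<^sup>2 / 2 \<le> 1 + x\<^sup>2" by simp
    then have "(1 + x\<^sup>2) powr (- p) \<le> ((1 + \<bar>x\<bar>)\<^sup>2 / 2) powr (- p)"
      using p by (intro powr_mono2') auto
    also have "\<dots> = 2 powr p * ((1 + \<bar>x\<bar>)\<^sup>2) powr (- p)"
      by (subst powr_divide) (simp_all add: powr_minus_divide)
    also have "(1 + \<bar>x\<bar>)\<^sup>2 = (1 + \<bar>x\<bar>) powr 2" by simp
    also have "\<dots> powr (- p) = (1 + \<bar>x\<bar>) powr (- (2 * p))" by (simp only: powr_powr) simp
    finally show ?thesis .
  qed
  then have "(\<integral>\<^sup>+x. ennreal ((1 + x\<^sup>2) powr (- p)) \<partial>(lborel :: real measure))
    \<le> (\<integral>\<^sup>+x. ennreal (2 powr p) * ennreal ((1 + \<bar>x\<bar>) powr (- (2 * p))) \<partial>(lborel :: real measure))"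
    by (intro nn_integral_mono) (simp flip: ennreal_mult)
  also have "\<dots> = ennreal (2 powr p) * (\<integral>\<^sup>+x. ennreal ((1 + \<bar>x\<bar>) powr (- (2 * p))) \<partial>(lborel :: real measure))"
    by (rule nn_integral_cmult) measurable
  also have "\<dots> < \<infinity>"
    using nn_integral_one_plus_abs_powr[of "2 * p"] p by (simp add: ennreal_mult_less_top)
  finally show ?thesis .
qed

text \<open>Both factors of \<open>radial_density\<close> are absorbed by powers of \<open>1 + a + b\<close>, which dominates both
  \<open>1 + a\<close> and \<open>1 + \<bar>a - b\<bar>\<close>; this leaves two separate one-dimensional integrals.\<close>

lemma nn_integral_kernel_bound_finite:
  assumes n: "DIM('a::euclidean_space) \<ge> 2" and m: "m > real DIM('a) - 1"
  shows "(\<integral>\<^sup>+y. \<integral>\<^sup>+y'. ennreal ((1 + ((norm (y::'a))\<^sup>2 + (norm (y'::'a))\<^sup>2)) powr (- m) / (1 + \<bar>(norm y)\<^sup>2 - (norm y')\<^sup>2\<bar>))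
     \<partial>lborel \<partial>lborel) < \<infinity>"
proof -
  let ?n = "real DIM('a)" and ?d = "radial_density DIM('a)"
  \<comment> \<open>The two densities cost \<open>s^(n - 2)\<close> with
    \<open>s = 1 + a + b\<close>, leaving
    \<open>s^(n - 2 - m) = s^(-(1 + \<mu>)) * s^(-\<mu>)\<close>. The first factor makes the
    integral in \<open>a\<close> converge; the second joins \<open>1 / (1 + |a - b|)\<close>, which
    alone would diverge logarithmically.\<close>
  define \<mu> where "\<mu> = (m - ?n + 1) / 2"
  have \<mu>: "\<mu> > 0" using m by (simp add: \<mu>_def)
  define V where "V = ?n / 2 * unit_ball_vol ?n"
  have V: "V \<ge> 0" by (simp add: V_def)
  let ?G = "\<lambda>a b::real. ennreal ((1 + (a + b)) powr (- m) / (1 + \<bar>a - b\<bar>))"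
  let ?j = "\<lambda>x::real. ennreal ((1 + \<bar>x\<bar>) powr (- (1 + \<mu>)))"
  have J: "(\<integral>\<^sup>+x. ?j x \<partial>lborel) < \<infinity>"
    using \<mu> by (intro nn_integral_one_plus_abs_powr) simp
  have bound: "ennreal (?d a) * (ennreal (?d b) * ?G a b) \<le> ennreal (V\<^sup>2) * (?j a * ?j (a - b))" for a b
  proof (cases "a > 0 \<and> b > 0")
    case True
    define s where "s = 1 + (a + b)"
    have s: "s > 0" using True by (simp add: s_def)
    \<comment> \<open>Here \<open>n \<ge> 2\<close> is essential: the exponent
      \<open>n / 2 - 1\<close> must be nonnegative for the power to be monotone.\<close>
    have le1: "a powr (?n / 2 - 1) \<le> s powr (?n / 2 - 1)"
      using True n by (intro powr_mono2) (auto simp: s_def)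
    have le2: "b powr (?n / 2 - 1) \<le> s powr (?n / 2 - 1)"
      using True n by (intro powr_mono2) (auto simp: s_def)
    have le3: "s powr (- (1 + \<mu>)) \<le> (1 + \<bar>a\<bar>) powr (- (1 + \<mu>))"
      using True \<mu> by (intro powr_mono2') (auto simp: s_def)
    have le4: "s powr (- \<mu>) \<le> (1 + \<bar>a - b\<bar>) powr (- \<mu>)"
      using True \<mu> by (intro powr_mono2') (auto simp: s_def)
    have "?d a * (?d b * (s powr (- m) / (1 + \<bar>a - b\<bar>)))
      = V\<^sup>2 * (a powr (?n / 2 - 1) * b powr (?n / 2 - 1)) * (s powr (- m) / (1 + \<bar>a - b\<bar>))"
      using True by (simp add: radial_density_def V_def power2_eq_square)
    also have "\<dots> \<le> V\<^sup>2 * (s powr (?n / 2 - 1) * s powr (?n / 2 - 1)) * (s powr (- m) / (1 + \<bar>a - b\<bar>))"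
      by (intro mult_right_mono mult_left_mono mult_mono le1 le2) auto
    also have "\<dots> = V\<^sup>2 * (s powr (- (1 + \<mu>)) * s powr (- \<mu>) / (1 + \<bar>a - b\<bar>))"
    proof -
      have "s powr (?n / 2 - 1) * s powr (?n / 2 - 1) * s powr (- m) = s powr (- (1 + \<mu>)) * s powr (- \<mu>)"
        unfolding powr_add[symmetric] by (rule arg_cong[where f = "(powr) s"]) (simp add: \<mu>_def field_simps)
      then show ?thesis by simp
    qed
    also have "\<dots> \<le> V\<^sup>2 * ((1 + \<bar>a\<bar>) powr (- (1 + \<mu>)) * (1 + \<bar>a - b\<bar>) powr (- \<mu>) / (1 + \<bar>a - b\<bar>))"
      by (intro mult_left_mono divide_right_mono mult_mono le3 le4) auto
    also have "\<dots> = V\<^sup>2 * ((1 + \<bar>a\<bar>) powr (- (1 + \<mu>)) * (1 + \<bar>a - b\<bar>) powr (- (1 + \<mu>)))"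
    proof -
      have "(1 + \<bar>a - b\<bar>) powr (- \<mu>) / (1 + \<bar>a - b\<bar>) = (1 + \<bar>a - b\<bar>) powr (- \<mu>) / (1 + \<bar>a - b\<bar>) powr 1"
        by simp
      also have "\<dots> = (1 + \<bar>a - b\<bar>) powr (- (1 + \<mu>))"
        unfolding powr_diff[symmetric] by (rule arg_cong[where f = "(powr) (1 + \<bar>a - b\<bar>)"]) simp
      finally show ?thesis by (metis times_divide_eq_right)
    qed
    finally have "?d a * (?d b * (s powr (- m) / (1 + \<bar>a - b\<bar>)))
      \<le> V\<^sup>2 * ((1 + \<bar>a\<bar>) powr (- (1 + \<mu>)) * (1 + \<bar>a - b\<bar>) powr (- (1 + \<mu>)))" .
    from ennreal_leI[OF this] show ?thesis
      unfolding s_def by (simp only: ennreal_mult radial_density_nonneg mult_nonneg_nonneg divide_nonneg_nonneg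
        powr_ge_zero zero_le_power2 add_nonneg_nonneg abs_ge_zero zero_le_one)
  qed (auto simp: radial_density_def)
  have "(\<integral>\<^sup>+y. \<integral>\<^sup>+y'. ?G ((norm (y::'a))\<^sup>2) ((norm (y'::'a))\<^sup>2) \<partial>lborel \<partial>lborel)
     = (\<integral>\<^sup>+y. (\<integral>\<^sup>+b. ennreal (?d b) * ?G ((norm (y::'a))\<^sup>2) b \<partial>lborel) \<partial>lborel)"
    by (intro nn_integral_cong nn_integral_norm_square) measurable
  also have "\<dots> = (\<integral>\<^sup>+a. ennreal (?d a) * (\<integral>\<^sup>+b. ennreal (?d b) * ?G a b \<partial>lborel) \<partial>lborel)"
    by (rule nn_integral_norm_square[where F = "\<lambda>a. \<integral>\<^sup>+b. ennreal (?d b) * ?G a b \<partial>lborel"]) measurable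
  also have "\<dots> = (\<integral>\<^sup>+a. \<integral>\<^sup>+b. ennreal (?d a) * (ennreal (?d b) * ?G a b) \<partial>lborel \<partial>lborel)"
    by (intro nn_integral_cong nn_integral_cmult[symmetric]) measurable
  also have "\<dots> \<le> (\<integral>\<^sup>+a. \<integral>\<^sup>+b. ennreal (V\<^sup>2) * (?j a * ?j (a - b)) \<partial>lborel \<partial>lborel)"
    by (intro nn_integral_mono bound)
  also have "\<dots> = (\<integral>\<^sup>+a. (ennreal (V\<^sup>2) * ?j a) * (\<integral>\<^sup>+b. ?j (a - b) \<partial>lborel) \<partial>lborel)"
    unfolding mult.assoc[symmetric] by (intro nn_integral_cong nn_integral_cmult) measurable
  also have "\<dots> = (\<integral>\<^sup>+a. (ennreal (V\<^sup>2) * ?j a) * (\<integral>\<^sup>+b. ?j b \<partial>lborel) \<partial>lborel)"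
    by (intro nn_integral_cong arg_cong2[where f = "(*)"] refl nn_integral_lborel_reflect) measurable
  also have "\<dots> = ennreal (V\<^sup>2) * (\<integral>\<^sup>+a. ?j a \<partial>lborel) * (\<integral>\<^sup>+b. ?j b \<partial>lborel)"
    by (simp add: nn_integral_cmult nn_integral_multc)
  also have "\<dots> < \<infinity>"
    using J by (simp add: ennreal_mult_less_top)
  finally show ?thesis .
qed

section \<open>The oscillatory kernel\<close>

text \<open>A first-derivative test. The amplitude is already a multiple \<open>N\<close> of the
  phase derivative, so one integration by parts needs no division; the boundary terms and the
  variation of \<open>N\<close> remain, the latter controlled by a monotone majorant
  \<open>D\<close>.\<close>

lemma oscillatory_integral_bound:
  fixes N \<psi> D :: "real \<Rightarrow> real"
  assumes ab: "a \<le> b"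
    and N: "\<And>t. t \<in> {a..b} \<Longrightarrow> (N has_real_derivative N' t) (at t within {a..b})" and N': "continuous_on {a..b} N'"
    and \<psi>: "\<And>t. t \<in> {a..b} \<Longrightarrow> (\<psi> has_real_derivative \<psi>' t) (at t within {a..b})" and \<psi>': "continuous_on {a..b} \<psi>'"
    and D: "\<And>t. t \<in> {a..b} \<Longrightarrow> (D has_real_derivative D' t) (at t within {a..b})" and le: "\<And>t. t \<in> {a..b} \<Longrightarrow> \<bar>N' t\<bar> \<le> D' t"
  shows "\<bar>c\<bar> * norm (integral {a..b} (\<lambda>t. complex_of_real (N t * \<psi>' t) * cis (c * \<psi> t))) \<le> \<bar>N a\<bar> + \<bar>N b\<bar> + (D b - D a)"
proof -
  let ?f = "\<lambda>t. complex_of_real (N t * \<psi>' t) * cis (c * \<psi> t)"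
  let ?g = "\<lambda>t. complex_of_real (N' t) * cis (c * \<psi> t)"
  have cN: "continuous_on {a..b} N" by (rule DERIV_continuous_on[OF N])
  have c\<psi>: "continuous_on {a..b} \<psi>" by (rule DERIV_continuous_on[OF \<psi>])
  have f: "?f integrable_on {a..b}"
    by (intro integrable_continuous_real continuous_intros cN c\<psi> \<psi>')
  have g: "?g integrable_on {a..b}"
    by (intro integrable_continuous_real continuous_intros N' c\<psi>)
  \<comment> \<open>The product rule for \<open>N * cis (c * \<psi>)\<close>: the oscillating
    integral appears with the factor \<open>c\<close>, which is the gain.\<close>
  have "((\<lambda>t. ?g t + \<i> * complex_of_real c * ?f t) has_integral
      complex_of_real (N b) * cis (c * \<psi> b) - complex_of_real (N a) * cis (c * \<psi> a)) {a..b}"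
  proof (rule fundamental_theorem_of_calculus[OF ab])
    fix t assume t: "t \<in> {a..b}"
    have 1: "((\<lambda>t. cis (c * \<psi> t)) has_vector_derivative (\<i> * complex_of_real (c * \<psi>' t) * cis (c * \<psi> t))) (at t within {a..b})"
      by (intro cis_has_vector_derivative DERIV_cmult \<psi> t)
    show "((\<lambda>t. complex_of_real (N t) * cis (c * \<psi> t)) has_vector_derivative ?g t + \<i> * complex_of_real c * ?f t) (at t within {a..b})"
      by (rule has_vector_derivative_eq_rhs[OF has_vector_derivative_mult[OF has_vector_derivative_of_real[OF N[OF t]] 1]])
         (simp add: algebra_simps)
  qed
  then have eq: "integral {a..b} ?g + \<i> * complex_of_real c * integral {a..b} ?f
     = complex_of_real (N b) * cis (c * \<psi> b) - complex_of_real (N a) * cis (c * \<psi> a)"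
    using f g by (subst (asm) has_integral_iff, elim conjE, subst (asm) integral_add) (auto intro: integrable_on_mult_right)
  have Dint: "(D' has_integral (D b - D a)) {a..b}"
    by (rule fundamental_theorem_of_calculus[OF ab]) (use D in \<open>simp add: has_real_derivative_iff_has_vector_derivative\<close>)
  have "norm (integral {a..b} ?g) \<le> integral {a..b} D'"
    using Dint le by (intro integral_norm_bound_integral g) (auto simp: norm_mult)
  then have gle: "norm (integral {a..b} ?g) \<le> D b - D a"
    using Dint by (simp add: integral_unique)
  have "\<bar>c\<bar> * norm (integral {a..b} ?f) = norm (\<i> * complex_of_real c * integral {a..b} ?f)"
    by (simp add: norm_mult)
  also have "\<i> * complex_of_real c * integral {a..b} ?f
     = complex_of_real (N b) * cis (c * \<psi> b) - complex_of_real (N a) * cis (c * \<psi> a) - integral {a..b} ?g"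
    using eq by (simp add: algebra_simps)
  also have "norm \<dots> \<le> norm (complex_of_real (N b) * cis (c * \<psi> b)) + norm (complex_of_real (N a) * cis (c * \<psi> a)) + norm (integral {a..b} ?g)"
    by (intro order_trans[OF norm_triangle_ineq4] add_right_mono norm_triangle_ineq4)
  also have "\<dots> \<le> \<bar>N b\<bar> + \<bar>N a\<bar> + (D b - D a)"
    using gle by (simp add: norm_mult)
  finally show ?thesis by simp
qed

text \<open>Exponential decay in \<open>A / w\<close> is exchanged for a power of
  \<open>1 + A\<close>, at the price of \<open>w^m\<close>. The second estimate covers the factor
  that appears when the Gaussian is differentiated in \<open>w\<close>.\<close>

lemma damping_bound:
  fixes m :: real assumes m: "m \<ge> 0"
  obtains C where "C \<ge> 0"
    "\<And>A w. A \<ge> 0 \<Longrightarrow> w \<ge> 1 \<Longrightarrow> exp (- pi\<^sup>2 * A / w) \<le> C * ((1 + A) powr (- m) * w powr m)"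
    "\<And>A w. A \<ge> 0 \<Longrightarrow> w \<ge> 1 \<Longrightarrow> pi\<^sup>2 * A / w * exp (- pi\<^sup>2 * A / w) \<le> C * ((1 + A) powr (- m) * w powr m)"
proof -
  \<comment> \<open>One power beyond \<open>m\<close> absorbs the prefactor \<open>1 + x\<close>,
    which serves both estimates. The constant \<open>k^k\<close> comes from
    \<open>1 + x \<le> k exp (x / k)\<close> raised to the power \<open>k\<close>.\<close>
  define k where "k = m + 1"
  have k: "k \<ge> 1" using m by (simp add: k_def)
  define C where "C = pi\<^sup>2 * k powr k"
  have kk: "k powr k \<ge> 0" by simp
  have pi1: "pi\<^sup>2 \<ge> 1" using pi_gt3 by (intro one_le_power) simp
  have main: "(1 + x) * exp (- x) \<le> k powr k * (1 + x) powr (- m)" if x: "x \<ge> 0" for x :: real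
  proof -
    have "1 + x \<le> k * (1 + x / k)" using k x by (simp add: field_simps)
    also have "\<dots> \<le> k * exp (x / k)" using k exp_ge_add_one_self[of "x / k"] by (intro mult_left_mono) auto
    finally have "(1 + x) powr k \<le> (k * exp (x / k)) powr k"
      using x k by (intro powr_mono2) auto
    also have "\<dots> = k powr k * exp x"
      using k by (simp add: powr_mult exp_powr_real)
    finally have "(1 + x) powr k * exp (- x) \<le> k powr k"
      by (simp add: exp_minus field_simps)
    then have "(1 + x) powr (- m) * ((1 + x) powr k * exp (- x)) \<le> (1 + x) powr (- m) * k powr k"
      by (rule mult_left_mono) simp
    moreover have "(1 + x) powr (- m) * (1 + x) powr k = 1 + x"
      using x by (simp add: k_def flip: powr_add)
    ultimately show ?thesis by (metis mult.assoc mult.commute)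
  qed
  have w: "(1 + A / w) powr (- m) \<le> (1 + A) powr (- m) * w powr m" if "A \<ge> 0" "w \<ge> 1" for A w
  proof -
    have "(1 + A) / w \<le> 1 + A / w" using that by (simp add: field_simps)
    then have "(1 + A / w) powr (- m) \<le> ((1 + A) / w) powr (- m)"
      using that m by (intro powr_mono2') auto
    also have "\<dots> = (1 + A) powr (- m) * w powr m"
      using that by (subst powr_divide) (auto simp: powr_minus_divide)
    finally show ?thesis .
  qed
  have e: "exp (- pi\<^sup>2 * A / w) \<le> exp (- (A / w))" if "A \<ge> 0" "w \<ge> 1" for A w
    using that pi1 mult_right_mono[OF pi1, of "A / w"] by simp
  show ?thesis
  proof (rule that[of C])
    show "C \<ge> 0" by (simp add: C_def)
    fix A w :: real assume A: "A \<ge> 0" "w \<ge> 1"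
    have Aw: "A / w \<ge> 0" using A by simp
    have *: "(1 + A / w) * exp (- (A / w)) \<le> k powr k * ((1 + A) powr (- m) * w powr m)"
      using main[OF Aw] w[OF A] kk by (meson mult_left_mono order_trans)
    have q: "k powr k * ((1 + A) powr (- m) * w powr m) \<ge> 0" by simp
    have "exp (- pi\<^sup>2 * A / w) \<le> (1 + A / w) * exp (- (A / w))"
    proof (rule order_trans[OF e[OF A]])
      show "exp (- (A / w)) \<le> (1 + A / w) * exp (- (A / w))"
        using mult_right_mono[of 1 "1 + A / w" "exp (- (A / w))"] Aw by simp
    qed
    also have "\<dots> \<le> 1 * (k powr k * ((1 + A) powr (- m) * w powr m))" using * by simp
    also have "\<dots> \<le> pi\<^sup>2 * (k powr k * ((1 + A) powr (- m) * w powr m))"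
      by (intro mult_right_mono pi1 q)
    finally show "exp (- pi\<^sup>2 * A / w) \<le> C * ((1 + A) powr (- m) * w powr m)"
      by (simp only: C_def mult.assoc)
    have "A / w * exp (- pi\<^sup>2 * A / w) \<le> (1 + A / w) * exp (- (A / w))"
      using Aw e[OF A] by (intro mult_mono) auto
    from order_trans[OF this *] have "pi\<^sup>2 * (A / w * exp (- pi\<^sup>2 * A / w)) \<le> pi\<^sup>2 * (k powr k * ((1 + A) powr (- m) * w powr m))"
      by (intro mult_left_mono) auto
    then show "pi\<^sup>2 * A / w * exp (- pi\<^sup>2 * A / w) \<le> C * ((1 + A) powr (- m) * w powr m)"
      by (simp only: C_def mult.assoc times_divide_eq_left times_divide_eq_right)
  qed
qed

definition osc_weight :: "real \<Rightarrow> real \<Rightarrow> real" where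
  "osc_weight r t = (1 + t\<^sup>2) powr (- r) * ((t\<^sup>2 - 1) / (1 + t\<^sup>2)\<^sup>2)"

text \<open>The weight is, up to sign, a function of \<open>1 + t\<^sup>2\<close> times the derivative of the phase
  \<open>t / (1 + t\<^sup>2)\<close>, which has no critical point for \<open>t \<ge> 2\<close>.\<close>

lemma osc_kernel_bound:
  fixes m r :: real assumes m: "m \<ge> 0" and mr: "m < r"
  obtains C where "C \<ge> 0"
    "\<And>A c R. A \<ge> 0 \<Longrightarrow> R \<ge> 2 \<Longrightarrow>
       (1 + \<bar>c\<bar>) * norm (integral {2..R} (\<lambda>t. complex_of_real (osc_weight r t * exp (- pi\<^sup>2 * A / (1 + t\<^sup>2))) * cis (c * (t / (1 + t\<^sup>2)))))
        \<le> C * (1 + A) powr (- m)"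
proof -
  obtain C where C: "C \<ge> 0"
    "\<And>A w. A \<ge> 0 \<Longrightarrow> w \<ge> 1 \<Longrightarrow> exp (- pi\<^sup>2 * A / w) \<le> C * ((1 + A) powr (- m) * w powr m)"
    "\<And>A w. A \<ge> 0 \<Longrightarrow> w \<ge> 1 \<Longrightarrow> pi\<^sup>2 * A / w * exp (- pi\<^sup>2 * A / w) \<le> C * ((1 + A) powr (- m) * w powr m)"
    using damping_bound[OF m] by blast
  \<comment> \<open>The 3 collects the trivial bound and two boundary terms; the fraction is the
    total variation of the majorant, finite because \<open>m < r\<close>.\<close>
  define K where "K = C * (3 + (r + 1) / (r - m))"
  have r: "r > 0" using m mr by simp
  show ?thesis
  proof (rule that[of K])
    show "K \<ge> 0" using C(1) m mr by (simp add: K_def)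
    fix A c R :: real assume A: "A \<ge> 0" and R: "R \<ge> 2"
    define w where "w = (\<lambda>t::real. 1 + t\<^sup>2)"
    have w1: "w t \<ge> 1" for t by (simp add: w_def)
    have w0: "w t > 0" for t using w1[of t] by linarith
    have wn0: "w t \<noteq> 0" for t using w0[of t] by simp
    have dw: "(w has_real_derivative 2 * t) (at t)" for t
      unfolding w_def by (auto intro!: derivative_eq_intros)
    have cw: "continuous_on S w" for S unfolding w_def by (intro continuous_intros)
    define X where "X = C * (1 + A) powr (- m)"
    have X0: "X \<ge> 0" using C(1) by (simp add: X_def)
    define e where "e = (\<lambda>t. exp (- pi\<^sup>2 * A / w t))"
    have e0: "e t \<ge> 0" for t by (simp add: e_def)
    have e1: "e t \<le> X * w t powr m" for t
      using C(2)[OF A w1] by (simp add: e_def X_def mult.assoc)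
    have e2: "pi\<^sup>2 * A / w t * e t \<le> X * w t powr m" for t
      using C(3)[OF A w1] by (simp add: e_def X_def mult.assoc)
    \<comment> \<open>The amplitude left after splitting off the phase derivative
      \<open>\<psi>'\<close> from the weight.\<close>
    define N where "N = (\<lambda>t. w t powr (- r) * e t)"
    define N' where "N' = (\<lambda>t. w t powr (- r - 1) * (- r * e t + pi\<^sup>2 * A / w t * e t) * (2 * t))"
    define \<psi> where "\<psi> = (\<lambda>t::real. - (t / w t))"
    define \<psi>' where "\<psi>' = (\<lambda>t::real. (t\<^sup>2 - 1) / (w t)\<^sup>2)"
    \<comment> \<open>Differentiating the power and the Gaussian in \<open>N\<close> costs
      \<open>r\<close> and 1 times \<open>X * w^m\<close>, whence \<open>r + 1\<close>.
      \<open>D\<close> is the primitive of this majorant and stays bounded because \<open>w\<close>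
      occurs with the negative exponent \<open>m - r\<close>.\<close>
    define D where "D = (\<lambda>t. - ((r + 1) * X / (r - m)) * w t powr (m - r))"
    define D' where "D' = (\<lambda>t. (r + 1) * X * w t powr (m - r - 1) * (2 * t))"
    have dpow: "((\<lambda>t. w t powr q) has_real_derivative (q * w t powr (q - 1) * (2 * t))) (at t)" for q t
      using DERIV_fun_powr[OF dw w0, of q t] by simp
    have dN: "(N has_real_derivative N' t) (at t)" for t
    proof -
      have "((\<lambda>t. - pi\<^sup>2 * A / w t) has_real_derivative (pi\<^sup>2 * A / w t / w t * (2 * t))) (at t)"
        by (rule DERIV_cong[OF DERIV_divide[OF DERIV_const dw wn0]]) (simp add: divide_simps)
      from DERIV_chain2[OF DERIV_exp this]
      have 2: "(e has_real_derivative (e t * (pi\<^sup>2 * A / w t / w t * (2 * t)))) (at t)"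
        unfolding e_def .
      have p: "w t powr (- r) = w t powr (- r - 1) * w t"
        using w0[of t] by (simp add: powr_diff)
      show ?thesis unfolding N_def
        by (rule DERIV_cong[OF DERIV_mult[OF dpow 2]])
           (unfold N'_def p, use wn0[of t] in \<open>simp add: field_simps\<close>)
    qed
    have d\<psi>: "(\<psi> has_real_derivative \<psi>' t) (at t)" for t
    proof -
      have q: "1 * w t - t * (2 * t) = - (t\<^sup>2 - 1)" by (simp add: w_def power2_eq_square)
      show ?thesis
        unfolding \<psi>_def \<psi>'_def
        by (rule DERIV_cong[OF DERIV_minus[OF DERIV_divide[OF DERIV_ident dw wn0]]])
           (simp only: q minus_divide_left minus_minus power2_eq_square[of "w t"])
    qed
    have dD: "(D has_real_derivative D' t) (at t)" for t
    proof -
      have q: "- (Y / (r - m)) * (m - r) = Y" for Y :: real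
        using mr by (simp only: minus_mult_commute minus_diff_eq) simp
      show ?thesis
        unfolding D_def D'_def
        by (rule DERIV_cong[OF DERIV_cmult[OF dpow]]) (simp only: mult.assoc[symmetric] q)
    qed
    have ce: "continuous_on S e" for S unfolding e_def
      by (intro continuous_intros cw) (use wn0 in auto)
    have cN': "continuous_on S N'" for S unfolding N'_def
      by (intro continuous_intros cw ce) (use wn0 in auto)
    have c\<psi>': "continuous_on S \<psi>'" for S unfolding \<psi>'_def
      by (intro continuous_intros cw) (use wn0 in auto)
    have le: "\<bar>N' t\<bar> \<le> D' t" if "t \<in> {2..R}" for t
    proof -
      have t: "t \<ge> 0" using that by simp
      have q: "pi\<^sup>2 * A / w t * e t \<ge> 0" using A w0[of t] e0[of t] by simp
      have re0: "r * e t \<ge> 0" using r e0[of t] by simp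
      have re: "r * e t \<le> r * (X * w t powr m)" using e1[of t] r by (intro mult_left_mono) auto
      have "\<bar>- r * e t + pi\<^sup>2 * A / w t * e t\<bar> \<le> (r + 1) * (X * w t powr m)"
        using re e2[of t] q re0 by (simp only: distrib_right mult_1 abs_le_iff) linarith
      then have "w t powr (- r - 1) * \<bar>- r * e t + pi\<^sup>2 * A / w t * e t\<bar> * (2 * t) \<le> w t powr (- r - 1) * ((r + 1) * (X * w t powr m)) * (2 * t)"
        using t by (intro mult_left_mono mult_right_mono) auto
      also have "\<dots> = (r + 1) * X * (w t powr (- r - 1) * w t powr m) * (2 * t)" by simp
      also have "w t powr (- r - 1) * w t powr m = w t powr (m - r - 1)"
        unfolding powr_add[symmetric] by (rule arg_cong[where f = "(powr) (w t)"]) simp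
      finally show ?thesis using t by (simp add: N'_def D'_def abs_mult)
    qed
    have N_le: "\<bar>N t\<bar> \<le> X" for t
    proof -
      have "\<bar>N t\<bar> = w t powr (- r) * e t" using e0[of t] by (simp add: N_def)
      also have "\<dots> \<le> w t powr (- r) * (X * w t powr m)" by (intro mult_left_mono e1) simp
      also have "\<dots> = X * w t powr (m - r)"
        by (simp add: powr_diff powr_minus divide_inverse)
      also have "\<dots> \<le> X * w t powr 0"
        using mr w1 X0 by (intro mult_left_mono powr_mono) auto
      finally show ?thesis using w0[of t] by simp
    qed
    \<comment> \<open>The frequency is \<open>- c\<close> because \<open>\<psi>\<close> is the
      negative of the phase, chosen so that its derivative is nonnegative for
      \<open>t \<ge> 2\<close>.\<close>
    let ?f = "\<lambda>t. complex_of_real (N t * \<psi>' t) * cis (- c * \<psi> t)"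
    have 1: "\<bar>- c\<bar> * norm (integral {2..R} ?f) \<le> \<bar>N 2\<bar> + \<bar>N R\<bar> + (D R - D 2)"
      by (rule oscillatory_integral_bound[OF R _ cN' _ c\<psi>' _ le])
         (intro DERIV_subset[OF dN] DERIV_subset[OF d\<psi>] DERIV_subset[OF dD] subset_UNIV)+
    have "D R - D 2 \<le> (r + 1) / (r - m) * X"
    proof -
      have q: "(r + 1) * X / (r - m) \<ge> 0" using r X0 mr by simp
      have "D R = - ((r + 1) * X / (r - m) * w R powr (m - r))" by (simp add: D_def)
      then have "D R \<le> 0" using mult_nonneg_nonneg[OF q, of "w R powr (m - r)"] by simp
      moreover have "w 2 powr (m - r) \<le> w 2 powr 0" using mr w1 by (intro powr_mono) auto
      then have "(r + 1) * X / (r - m) * w 2 powr (m - r) \<le> (r + 1) * X / (r - m) * 1"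
        using w0[of 2] by (intro mult_left_mono q) simp
      ultimately show ?thesis by (simp add: D_def)
    qed
    with 1 N_le[of 2] N_le[of R] have 2: "\<bar>c\<bar> * norm (integral {2..R} ?f) \<le> X + X + (r + 1) / (r - m) * X"
      by simp
    have I\<psi>: "(\<psi>' has_integral (\<psi> R - \<psi> 2)) {2..R}"
      by (rule fundamental_theorem_of_calculus[OF R])
         (use d\<psi> in \<open>simp add: has_real_derivative_iff_has_vector_derivative has_vector_derivative_at_within\<close>)
    have cN: "continuous_on S N" for S
      unfolding N_def by (intro continuous_intros cw ce) (use wn0 in auto)
    have c\<psi>: "continuous_on S \<psi>" for S
      unfolding \<psi>_def by (intro continuous_intros cw) (use wn0 in auto)
    \<comment> \<open>For small \<open>c\<close> oscillation gives nothing; instead \<open>N\<close>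
      is at most \<open>X\<close> and the increasing function \<open>\<psi>\<close> varies by less
      than 1 on the whole range.\<close>
    have "norm (integral {2..R} ?f) \<le> integral {2..R} (\<lambda>t. X * \<psi>' t)"
    proof (rule integral_norm_bound_integral)
      show "?f integrable_on {2..R}"
        by (intro integrable_continuous_real continuous_intros cN c\<psi> c\<psi>')
      show "(\<lambda>t. X * \<psi>' t) integrable_on {2..R}"
        using I\<psi> by (intro integrable_on_mult_right) auto
      fix t assume t: "t \<in> {2..R}"
      then have "1 \<le> t\<^sup>2" by (intro one_le_power) auto
      then have "\<psi>' t \<ge> 0" by (simp add: \<psi>'_def)
      then show "norm (?f t) \<le> X * \<psi>' t"
        using N_le[of t] by (simp add: norm_mult abs_mult mult_right_mono)
    qed
    also have "\<dots> = X * (\<psi> R - \<psi> 2)"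
      using has_integral_mult_right[OF I\<psi>, of X] by (rule integral_unique)
    also have "\<dots> \<le> X * 1"
    proof (intro mult_left_mono X0)
      have "\<psi> R \<le> 0" using R w0[of R] by (simp add: \<psi>_def)
      then show "\<psi> R - \<psi> 2 \<le> 1" by (simp add: \<psi>_def w_def)
    qed
    finally have 3: "norm (integral {2..R} ?f) \<le> X" by simp
    have "(1 + \<bar>c\<bar>) * norm (integral {2..R} ?f) \<le> X + (X + X + (r + 1) / (r - m) * X)"
      using 2 3 by (simp add: distrib_right)
    also have "\<dots> = K * (1 + A) powr (- m)"
      by (simp add: K_def X_def algebra_simps)
    also have "?f = (\<lambda>t. complex_of_real (osc_weight r t * exp (- pi\<^sup>2 * A / (1 + t\<^sup>2))) * cis (c * (t / (1 + t\<^sup>2))))"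
    proof
      fix t
      have "N t * \<psi>' t = osc_weight r t * exp (- pi\<^sup>2 * A / (1 + t\<^sup>2))"
        by (simp add: N_def e_def \<psi>'_def osc_weight_def w_def mult_ac)
      moreover have "- c * \<psi> t = c * (t / (1 + t\<^sup>2))" by (simp add: \<psi>_def w_def)
      ultimately show "?f t = complex_of_real (osc_weight r t * exp (- pi\<^sup>2 * A / (1 + t\<^sup>2))) * cis (c * (t / (1 + t\<^sup>2)))"
        by (simp only:)
    qed
    finally show "(1 + \<bar>c\<bar>) * norm (integral {2..R} (\<lambda>t. complex_of_real (osc_weight r t * exp (- pi\<^sup>2 * A / (1 + t\<^sup>2))) * cis (c * (t / (1 + t\<^sup>2)))))
        \<le> K * (1 + A) powr (- m)" .
  qed
qed

section \<open>Complex-time heat extensions\<close>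

text \<open>The semigroup \<open>exp (z Laplacian / (4 pi^2))\<close> at complex time
  \<open>z\<close>, written on the frequency side.\<close>

definition gauss_smooth :: "complex \<Rightarrow> ('a::euclidean_space \<Rightarrow> complex) \<Rightarrow> 'a \<Rightarrow> complex" where
  "gauss_smooth z h x =
     (LINT \<xi>|lborel. cis (2 * pi * (x \<bullet> \<xi>)) * (exp (- z * complex_of_real ((norm \<xi>)\<^sup>2)) * euclidean_ft h \<xi>))"

lemma norm_exp_gaussian: "norm (exp (- z * complex_of_real ((norm \<xi>)\<^sup>2))) = exp (- Re z * (norm \<xi>)\<^sup>2)"
  by simp

lemma integrable_gaussian_euclidean_ft:
  fixes h :: "'a::euclidean_space \<Rightarrow> complex"
  assumes z: "Re z > 0" and h: "integrable lborel h"
  shows "integrable lborel (\<lambda>\<xi>. exp (- z * complex_of_real ((norm \<xi>)\<^sup>2)) * euclidean_ft h \<xi>)"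
proof (rule Bochner_Integration.integrable_bound)
  have [measurable]: "h \<in> borel_measurable borel" using h by auto
  let ?K = "LINT x|lborel. norm (h x)"
  show "integrable lborel (\<lambda>\<xi>::'a. exp (- z * complex_of_real ((norm \<xi>)\<^sup>2)) * complex_of_real ?K)"
    by (intro integrable_mult_left integrable_gaussian z)
  show "(\<lambda>\<xi>. exp (- z * complex_of_real ((norm \<xi>)\<^sup>2)) * euclidean_ft h \<xi>) \<in> borel_measurable lborel"
    by measurable
  have "?K \<ge> 0" by simp
  then show "AE \<xi> in lborel. norm (exp (- z * complex_of_real ((norm \<xi>)\<^sup>2)) * euclidean_ft h \<xi>)
      \<le> norm (exp (- z * complex_of_real ((norm \<xi>)\<^sup>2)) * complex_of_real ?K)"
    using norm_euclidean_ft_le[OF h] by (intro AE_I2) (simp add: norm_mult mult_left_mono)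
qed

text \<open>The inverse transform is a reflected forward transform, so the Plancherel inequality
  applies on both sides of a multiplier of modulus at most 1.\<close>

lemma gauss_smooth_mean_square_le:
  fixes h :: "'a::euclidean_space \<Rightarrow> complex"
  assumes z: "Re z > 0" and h: "integrable lborel h"
  shows "(\<integral>\<^sup>+x. ennreal ((norm (gauss_smooth z h x))\<^sup>2) \<partial>lborel) \<le> (\<integral>\<^sup>+x. ennreal ((norm (h x))\<^sup>2) \<partial>lborel)"
proof -
  have [measurable]: "h \<in> borel_measurable borel" using h by auto
  let ?k = "\<lambda>\<xi>. exp (- z * complex_of_real ((norm \<xi>)\<^sup>2)) * euclidean_ft h \<xi>"
  have eq: "gauss_smooth z h x = euclidean_ft ?k (0 - x)" for x
    unfolding gauss_smooth_def euclidean_ft_def[of ?k] by (simp add: inner_commute)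
  have "(\<integral>\<^sup>+x. ennreal ((norm (gauss_smooth z h x))\<^sup>2) \<partial>lborel) = (\<integral>\<^sup>+x. ennreal ((norm (euclidean_ft ?k x))\<^sup>2) \<partial>lborel)"
    unfolding eq by (rule nn_integral_lborel_reflect) measurable
  also have "\<dots> \<le> (\<integral>\<^sup>+\<xi>. ennreal ((norm (?k \<xi>))\<^sup>2) \<partial>lborel)"
    by (intro euclidean_ft_mean_square_le integrable_gaussian_euclidean_ft z h)
  also have "\<dots> \<le> (\<integral>\<^sup>+\<xi>. ennreal ((norm (euclidean_ft h \<xi>))\<^sup>2) \<partial>lborel)"
  proof (intro nn_integral_mono ennreal_leI power_mono)
    fix \<xi> :: 'a
    have "norm (exp (- z * complex_of_real ((norm \<xi>)\<^sup>2))) \<le> 1"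
      unfolding norm_exp_gaussian using z by simp
    then show "norm (?k \<xi>) \<le> norm (euclidean_ft h \<xi>)"
      by (simp only: norm_mult mult_left_le_one_le norm_ge_zero)
  qed simp
  also have "\<dots> \<le> (\<integral>\<^sup>+x. ennreal ((norm (h x))\<^sup>2) \<partial>lborel)"
    by (rule euclidean_ft_mean_square_le[OF h])
  finally show ?thesis .
qed

text \<open>On the space side the function enters as a factor of an explicit kernel, so an essential
  bound on it can be used.\<close>

lemma gauss_smooth_eq_convolution:
  fixes h :: "'a::euclidean_space \<Rightarrow> complex"
  assumes z: "Re z > 0" and h: "integrable lborel h"
  shows "gauss_smooth z h x = gauss_ft z 0 ^ DIM('a) * (LINT y|lborel. exp (- complex_of_real (pi\<^sup>2 * (norm (x - y))\<^sup>2) / z) * h y)"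
proof -
  have [measurable]: "h \<in> borel_measurable borel" using h by auto
  let ?e = "\<lambda>\<xi>::'a. exp (- z * complex_of_real ((norm \<xi>)\<^sup>2))"
  let ?G = "\<lambda>\<xi> y. cis (2 * pi * ((x - y) \<bullet> \<xi>)) * (?e \<xi> * h y)"
  have G: "integrable (lborel \<Otimes>\<^sub>M lborel) (\<lambda>(\<xi>, y). ?G \<xi> y)"
  proof (rule integrable_pair_of_product_bound[OF lborel.sigma_finite_measure_axioms _ integrable_gaussian[OF z] h])
    show "(\<lambda>(\<xi>, y). ?G \<xi> y) \<in> borel_measurable (lborel \<Otimes>\<^sub>M lborel)" by measurable
  qed (simp add: norm_mult)
  have "gauss_smooth z h x = (LINT \<xi>|lborel. LINT y|lborel. ?G \<xi> y)"
    unfolding gauss_smooth_def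
  proof (intro Bochner_Integration.integral_cong refl)
    fix \<xi> :: 'a
    have cs: "cis (2 * pi * ((x - y) \<bullet> \<xi>)) = cis (2 * pi * (x \<bullet> \<xi>)) * cis (- 2 * pi * (y \<bullet> \<xi>))" for y
      by (simp add: cis_mult inner_diff_left right_diff_distrib)
    have "(LINT y|lborel. ?G \<xi> y) = (LINT y|lborel. (cis (2 * pi * (x \<bullet> \<xi>)) * ?e \<xi>) * (cis (- 2 * pi * (y \<bullet> \<xi>)) * h y))"
      by (intro Bochner_Integration.integral_cong refl) (unfold cs, simp only: mult_ac)
    also have "\<dots> = (cis (2 * pi * (x \<bullet> \<xi>)) * ?e \<xi>) * euclidean_ft h \<xi>"
      unfolding euclidean_ft_def by (rule integral_mult_right_zero)
    finally show "cis (2 * pi * (x \<bullet> \<xi>)) * (?e \<xi> * euclidean_ft h \<xi>) = (LINT y|lborel. ?G \<xi> y)"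
      by (metis mult.assoc)
  qed
  also have "\<dots> = (LINT y|lborel. LINT \<xi>|lborel. ?G \<xi> y)"
    by (rule lborel_pair.Fubini_integral[OF G, symmetric])
  also have "\<dots> = (LINT y|lborel. gauss_ft z 0 ^ DIM('a) * (exp (- complex_of_real (pi\<^sup>2 * (norm (x - y))\<^sup>2) / z) * h y))"
  proof (intro Bochner_Integration.integral_cong refl)
    fix y
    have "(LINT \<xi>|lborel. ?G \<xi> y) = (LINT \<xi>|lborel. (cis (2 * pi * ((x - y) \<bullet> \<xi>)) * ?e \<xi>) * h y)"
      by (intro Bochner_Integration.integral_cong refl) (simp only: mult.assoc)
    also have "\<dots> = (LINT \<xi>|lborel. cis (2 * pi * ((x - y) \<bullet> \<xi>)) * ?e \<xi>) * h y"
      by (rule integral_mult_left_zero)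
    also have "\<dots> = gauss_ft z 0 ^ DIM('a) * exp (- complex_of_real (pi\<^sup>2 * (norm (x - y))\<^sup>2) / z) * h y"
      by (simp only: integral_gaussian_cis[OF z])
    finally show "(LINT \<xi>|lborel. ?G \<xi> y) = gauss_ft z 0 ^ DIM('a) * (exp (- complex_of_real (pi\<^sup>2 * (norm (x - y))\<^sup>2) / z) * h y)"
      by (simp only: mult.assoc)
  qed
  finally show ?thesis by (simp only: integral_mult_right_zero)
qed

lemma Re_inverse_Complex_1: "Re (- complex_of_real a / Complex 1 t) = - a / (1 + t\<^sup>2)"
  by (simp add: Re_divide power2_eq_square)

text \<open>As \<open>1 / (1 + i t) = (1 - i t) / (1 + t^2)\<close>, real parts add up under
  conjugation to the damping in \<open>a + b\<close>, while imaginary parts subtract to the phase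
  with frequency proportional to \<open>a - b\<close>.\<close>

lemma exp_Complex_1_mult_cnj:
  "exp (- complex_of_real (pi\<^sup>2 * a) / Complex 1 t) * cnj (exp (- complex_of_real (pi\<^sup>2 * b) / Complex 1 t))
    = complex_of_real (exp (- pi\<^sup>2 * (a + b) / (1 + t\<^sup>2))) * cis (pi\<^sup>2 * (a - b) * (t / (1 + t\<^sup>2)))"
proof -
  have "- complex_of_real (pi\<^sup>2 * a) / Complex 1 t + cnj (- complex_of_real (pi\<^sup>2 * b) / Complex 1 t)
     = Complex (- pi\<^sup>2 * (a + b) / (1 + t\<^sup>2)) (pi\<^sup>2 * (a - b) * (t / (1 + t\<^sup>2)))"
    by (simp add: complex_eq_iff Re_divide Im_divide power2_eq_square[of t])
       (simp add: algebra_simps add_divide_distrib diff_divide_distrib)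
  then show ?thesis
    by (simp only: exp_cnj mult_exp_exp) (simp add: exp_eq_polar)
qed

lemma norm_gauss_ft_Complex_1:
  "(norm (gauss_ft (Complex 1 t) 0 ^ n))\<^sup>2 = pi ^ n * (1 + t\<^sup>2) powr (- (real n / 2))"
proof -
  have "(norm (gauss_ft (Complex 1 t) 0))\<^sup>2 = pi / sqrt (1 + t\<^sup>2)"
    using norm_gauss_ft_0[of "Complex 1 t"] by (simp add: cmod_def)
  also have "\<dots> = pi * (1 + t\<^sup>2) powr (- (1 / 2))"
    unfolding powr_minus_divide by (simp add: powr_half_sqrt)
  finally have "(norm (gauss_ft (Complex 1 t) 0 ^ n))\<^sup>2 = (pi * (1 + t\<^sup>2) powr (- (1 / 2))) ^ n"
    by (metis norm_power power_mult mult.commute)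
  moreover have "((1 + t\<^sup>2) powr (- (1 / 2))) ^ n = (1 + t\<^sup>2) powr (- (real n / 2))"
    using powr_realpow[of "(1 + t\<^sup>2) powr (- (1 / 2))" n] by (simp add: powr_powr add_nonneg_eq_0_iff)
  ultimately show ?thesis by (simp add: power_mult_distrib)
qed

text \<open>The decisive estimate. The squared prefactor of the heat kernel contributes another
  \<open>(1 + t^2)^(-n/2)\<close>, so the kernel square is integrated against
  \<open>(1 + t^2)^(-(n + \<theta>))\<close>. The resulting majorant depends on \<open>x - y\<close>
  and \<open>x - y'\<close> only, which makes the bound uniform in \<open>x\<close>.\<close>

lemma gauss_smooth_square_function:
  assumes n: "DIM('a::euclidean_space) \<ge> 2" and \<theta>: "\<theta> > 0"
  obtains C :: ennreal where "C < \<infinity>"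
    "\<And>(g :: 'a \<Rightarrow> complex) M x. integrable lborel g \<Longrightarrow> AE y in lborel. norm (g y) \<le> M \<Longrightarrow>
      (\<integral>\<^sup>+t. ennreal ((1 + t\<^sup>2) powr (- (real DIM('a) / 2 + \<theta>)) * (norm (gauss_smooth (Complex 1 t) g x))\<^sup>2) \<partial>lborel)
        \<le> C * ennreal (M\<^sup>2)"
proof -
  let ?n = "real DIM('a)"
  \<comment> \<open>The oscillatory weight decays like \<open>(1 + t^2)^(-r - 1)\<close>, which must
    match \<open>-(n + \<theta>)\<close>.\<close>
  define r where "r = ?n + \<theta> - 1"
  \<comment> \<open>The midpoint between \<open>n - 1\<close>, above which the kernel majorant is
    integrable, and \<open>r\<close>, below which the oscillatory bound holds.\<close>
  define m where "m = ?n - 1 + \<theta> / 2"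
  have mr: "m \<ge> 0" "m < r" "m > ?n - 1" using n \<theta> by (auto simp: m_def r_def)
  obtain K where K: "K \<ge> 0" "\<And>A c R. A \<ge> 0 \<Longrightarrow> R \<ge> 2 \<Longrightarrow>
       (1 + \<bar>c\<bar>) * norm (integral {2..R} (\<lambda>t. complex_of_real (osc_weight r t * exp (- pi\<^sup>2 * A / (1 + t\<^sup>2))) * cis (c * (t / (1 + t\<^sup>2)))))
        \<le> K * (1 + A) powr (- m)"
    using osc_kernel_bound[OF mr(1,2)] by blast
  let ?I = "\<integral>\<^sup>+y. \<integral>\<^sup>+y'. ennreal ((1 + ((norm (y::'a))\<^sup>2 + (norm (y'::'a))\<^sup>2)) powr (- m) / (1 + \<bar>(norm y)\<^sup>2 - (norm y')\<^sup>2\<bar>)) \<partial>lborel \<partial>lborel"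
  have I: "?I < \<infinity>" by (rule nn_integral_kernel_bound_finite[OF n mr(3)])
  \<comment> \<open>The 5 is the maximum of \<open>1 + t^2\<close> on \<open>[-2, 2]\<close>, hence
    the slowest Gaussian decay there.\<close>
  let ?g5 = "\<integral>\<^sup>+y. ennreal (exp (- (pi\<^sup>2 / 5) * (norm (y::'a))\<^sup>2)) \<partial>lborel"
  have g5: "?g5 < \<infinity>"
  proof -
    have "integrable lborel (\<lambda>y::'a. exp (- complex_of_real (pi\<^sup>2 / 5) * complex_of_real ((norm y)\<^sup>2)))"
      by (rule integrable_gaussian) simp
    then show ?thesis by (simp add: integrable_iff_bounded)
  qed
  define Q where "Q = (\<lambda>(g :: 'a \<Rightarrow> complex) x t. LINT y|lborel. exp (- complex_of_real (pi\<^sup>2 * (norm (x - y))\<^sup>2) / Complex 1 t) * g y)"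
  have small: "ennreal ((norm (Q g x t))\<^sup>2) \<le> ?g5\<^sup>2 * ennreal (M\<^sup>2)"
    if g: "integrable lborel g" and gM: "AE y in lborel. norm (g y) \<le> M" and t: "t \<in> {-2..2}" for g x M t
  proof -
    have [measurable]: "g \<in> borel_measurable borel" using g by auto
    have t4: "1 + t\<^sup>2 \<le> 5" using t abs_le_square_iff[of t 2] by auto
    have "ennreal (norm (Q g x t)) \<le> (\<integral>\<^sup>+y. ennreal (norm (exp (- complex_of_real (pi\<^sup>2 * (norm (x - y))\<^sup>2) / Complex 1 t) * g y)) \<partial>lborel)"
      unfolding Q_def by (rule norm_integral_le_nn_integral)
    also have "\<dots> \<le> (\<integral>\<^sup>+y. ennreal (exp (- (pi\<^sup>2 / 5) * (norm (x - y))\<^sup>2)) * ennreal M \<partial>lborel)"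
    proof (rule nn_integral_mono_AE, use gM in eventually_elim)
      fix y assume M: "norm (g y) \<le> M"
      have M0: "M \<ge> 0" using M norm_ge_zero order_trans by blast
      have "pi\<^sup>2 * (norm (x - y))\<^sup>2 / 5 \<le> pi\<^sup>2 * (norm (x - y))\<^sup>2 / (1 + t\<^sup>2)"
        by (intro divide_left_mono t4) (auto simp: add_pos_nonneg)
      then have "norm (exp (- complex_of_real (pi\<^sup>2 * (norm (x - y))\<^sup>2) / Complex 1 t)) \<le> exp (- (pi\<^sup>2 / 5) * (norm (x - y))\<^sup>2)"
        unfolding norm_exp_eq_Re Re_inverse_Complex_1 by simp
      then have "norm (exp (- complex_of_real (pi\<^sup>2 * (norm (x - y))\<^sup>2) / Complex 1 t)) * norm (g y) \<le> exp (- (pi\<^sup>2 / 5) * (norm (x - y))\<^sup>2) * M"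
        by (intro mult_mono M) auto
      from ennreal_leI[OF this]
      show "ennreal (norm (exp (- complex_of_real (pi\<^sup>2 * (norm (x - y))\<^sup>2) / Complex 1 t) * g y)) \<le> ennreal (exp (- (pi\<^sup>2 / 5) * (norm (x - y))\<^sup>2)) * ennreal M"
        using M0 by (simp only: norm_mult ennreal_mult exp_ge_zero)
    qed
    also have "\<dots> = (\<integral>\<^sup>+y. ennreal (exp (- (pi\<^sup>2 / 5) * (norm (x - y))\<^sup>2)) \<partial>lborel) * ennreal M"
      by (rule nn_integral_multc) measurable
    also have "(\<integral>\<^sup>+y. ennreal (exp (- (pi\<^sup>2 / 5) * (norm (x - y))\<^sup>2)) \<partial>lborel) = ?g5"
      by (rule nn_integral_lborel_reflect[where f = "\<lambda>y. ennreal (exp (- (pi\<^sup>2 / 5) * (norm y)\<^sup>2))"]) measurable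
    finally have "(ennreal (norm (Q g x t)))\<^sup>2 \<le> (?g5 * ennreal M)\<^sup>2"
      by (rule power_mono) simp
    \<comment> \<open>For negative \<open>M\<close> the conversion \<open>ennreal M\<close> is 0, so
      this is an inequality and not an equation.\<close>
    moreover have "(ennreal M)\<^sup>2 \<le> ennreal (M\<^sup>2)"
      by (cases "M \<ge> 0") (simp_all add: ennreal_power ennreal_neg)
    ultimately show ?thesis
      by (simp add: ennreal_power power_mult_distrib) (meson mult_left_mono order_trans zero_le)
  qed
  \<comment> \<open>The sign \<open>\<sigma>\<close> covers both half-lines: it leaves
    \<open>t^2\<close> alone and only flips the frequency. Truncation at \<open>R\<close> keeps the
    weight continuous on a compact interval, and the bound does not depend on
    \<open>R\<close>.\<close>
  have large: "(\<integral>\<^sup>+t. ennreal (indicator {2..R} t * osc_weight r t * (norm (Q g x (\<sigma> * t)))\<^sup>2) \<partial>lborel) \<le> ennreal K * ?I * ennreal (M\<^sup>2)"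
    if g: "integrable lborel g" and gM: "AE y in lborel. norm (g y) \<le> M" and \<sigma>: "\<bar>\<sigma>\<bar> = 1" and R: "R \<ge> 2" for g x M \<sigma> R
  proof -
    have [measurable]: "g \<in> borel_measurable borel" using g by auto
    define \<omega> where "\<omega> = (\<lambda>t. indicator {2..R} t * osc_weight r t)"
    define \<kappa> where "\<kappa> = (\<lambda>t y. exp (- complex_of_real (pi\<^sup>2 * (norm (x - y))\<^sup>2) / Complex 1 (\<sigma> * t)))"
    have Q_\<kappa>: "Q g x (\<sigma> * t) = (LINT y|lborel. \<kappa> t y * g y)" for t
      by (simp only: Q_def \<kappa>_def)
    have cw: "continuous_on {2..R} (osc_weight r)"
      unfolding osc_weight_def by (intro continuous_intros) (auto simp: add_nonneg_eq_0_iff)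
    have \<omega>: "integrable lborel \<omega>"
      using borel_integrable_atLeastAtMost'[OF cw] by (simp add: \<omega>_def set_integrable_def)
    have \<omega>0: "\<omega> t \<ge> 0" for t
      by (auto simp: \<omega>_def osc_weight_def indicator_def intro!: mult_nonneg_nonneg divide_nonneg_nonneg one_le_power)
    have ker: "norm (LINT t|lborel. complex_of_real (\<omega> t) * (\<kappa> t y * cnj (\<kappa> t y')))
       \<le> K * ((1 + ((norm (x - y))\<^sup>2 + (norm (x - y'))\<^sup>2)) powr (- m) / (1 + \<bar>(norm (x - y))\<^sup>2 - (norm (x - y'))\<^sup>2\<bar>))" for y y'
    proof -
      define a where "a = (norm (x - y))\<^sup>2"
      define b where "b = (norm (x - y'))\<^sup>2"
      let ?c = "\<sigma> * pi\<^sup>2 * (a - b)"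
      let ?f = "\<lambda>t. complex_of_real (osc_weight r t * exp (- pi\<^sup>2 * (a + b) / (1 + t\<^sup>2))) * cis (?c * (t / (1 + t\<^sup>2)))"
      have \<sigma>2: "(\<sigma> * t)\<^sup>2 = t\<^sup>2" for t
      proof -
        have "\<sigma>\<^sup>2 = 1" using \<sigma> power2_abs[of \<sigma>] by simp
        then show ?thesis by (simp add: power_mult_distrib)
      qed
      have "(LINT t|lborel. complex_of_real (\<omega> t) * (\<kappa> t y * cnj (\<kappa> t y'))) = (LINT t:{2..R}|lborel. ?f t)"
        unfolding set_lebesgue_integral_def
      proof (intro Bochner_Integration.integral_cong refl)
        fix t
        have "\<kappa> t y * cnj (\<kappa> t y') = complex_of_real (exp (- pi\<^sup>2 * (a + b) / (1 + t\<^sup>2))) * cis (pi\<^sup>2 * (a - b) * (\<sigma> * t / (1 + t\<^sup>2)))"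
          unfolding \<kappa>_def a_def[symmetric] b_def[symmetric] exp_Complex_1_mult_cnj \<sigma>2 ..
        moreover have "pi\<^sup>2 * (a - b) * (\<sigma> * t / (1 + t\<^sup>2)) = ?c * (t / (1 + t\<^sup>2))" by simp
        ultimately have e: "\<kappa> t y * cnj (\<kappa> t y') = complex_of_real (exp (- pi\<^sup>2 * (a + b) / (1 + t\<^sup>2))) * cis (?c * (t / (1 + t\<^sup>2)))"
          by (simp only:)
        show "complex_of_real (\<omega> t) * (\<kappa> t y * cnj (\<kappa> t y')) = indicat_real {2..R} t *\<^sub>R ?f t"
          unfolding e by (simp add: \<omega>_def scaleR_conv_of_real mult.assoc)
      qed
      also have "\<dots> = integral {2..R} ?f"
      proof (rule set_borel_integral_eq_integral(2), rule borel_integrable_atLeastAtMost')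
        show "continuous_on {2..R} ?f"
          by (intro continuous_intros cw) (auto simp: add_nonneg_eq_0_iff)
      qed
      finally have "(1 + \<bar>?c\<bar>) * norm (LINT t|lborel. complex_of_real (\<omega> t) * (\<kappa> t y * cnj (\<kappa> t y'))) \<le> K * (1 + (a + b)) powr (- m)"
        using K(2)[of "a + b" R ?c] R by (simp only: a_def b_def add_nonneg_nonneg zero_le_power2)
      moreover have "1 + \<bar>a - b\<bar> \<le> 1 + \<bar>?c\<bar>"
      proof -
        have "1 \<le> pi\<^sup>2" using pi_gt3 by (intro one_le_power) simp
        from mult_right_mono[OF this, of "\<bar>a - b\<bar>"] show ?thesis using \<sigma> by (simp add: abs_mult)
      qed
      ultimately have "(1 + \<bar>a - b\<bar>) * norm (LINT t|lborel. complex_of_real (\<omega> t) * (\<kappa> t y * cnj (\<kappa> t y'))) \<le> K * (1 + (a + b)) powr (- m)"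
        by (meson mult_right_mono norm_ge_zero order_trans)
      then show ?thesis
        unfolding a_def[symmetric] b_def[symmetric] by (simp add: pos_le_divide_eq mult.commute)
    qed
    let ?k = "\<lambda>y y'. ennreal ((1 + ((norm y)\<^sup>2 + (norm y')\<^sup>2)) powr (- m) / (1 + \<bar>(norm (y::'a))\<^sup>2 - (norm (y'::'a))\<^sup>2\<bar>))"
    have "(\<integral>\<^sup>+t. ennreal (\<omega> t * (norm (Q g x (\<sigma> * t)))\<^sup>2) \<partial>lborel)
      \<le> (\<integral>\<^sup>+y. \<integral>\<^sup>+y'. ennreal (norm (g y) * norm (g y') * norm (LINT t|lborel. complex_of_real (\<omega> t) * (\<kappa> t y * cnj (\<kappa> t y')))) \<partial>lborel \<partial>lborel)"
      unfolding Q_\<kappa>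
    proof (rule nn_integral_square_kernel_le[OF lborel.sigma_finite_measure_axioms lborel.sigma_finite_measure_axioms \<omega> \<omega>0 g])
      show "case_prod \<kappa> \<in> borel_measurable (lborel \<Otimes>\<^sub>M lborel)"
        unfolding \<kappa>_def Complex_eq by measurable
      show "norm (\<kappa> t y) \<le> 1" for t y
        unfolding \<kappa>_def norm_exp_eq_Re Re_inverse_Complex_1 by (simp add: add_nonneg_nonneg)
    qed
    also have "\<dots> \<le> (\<integral>\<^sup>+y. \<integral>\<^sup>+y'. ennreal (M\<^sup>2 * K) * ?k (x - y) (x - y') \<partial>lborel \<partial>lborel)"
    proof (rule nn_integral_mono_AE, use gM in eventually_elim, rule nn_integral_mono_AE, use gM in eventually_elim)
      fix y y' assume M: "norm (g y') \<le> M" "norm (g y) \<le> M"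
      have M0: "M \<ge> 0" using M norm_ge_zero order_trans by blast
      have "norm (g y) * norm (g y') * norm (LINT t|lborel. complex_of_real (\<omega> t) * (\<kappa> t y * cnj (\<kappa> t y')))
        \<le> M * M * (K * ((1 + ((norm (x - y))\<^sup>2 + (norm (x - y'))\<^sup>2)) powr (- m) / (1 + \<bar>(norm (x - y))\<^sup>2 - (norm (x - y'))\<^sup>2\<bar>)))"
        by (intro mult_mono M ker) (auto simp: M0)
      from ennreal_leI[OF this]
      show "ennreal (norm (g y) * norm (g y') * norm (LINT t|lborel. complex_of_real (\<omega> t) * (\<kappa> t y * cnj (\<kappa> t y')))) \<le> ennreal (M\<^sup>2 * K) * ?k (x - y) (x - y')"
        using K(1) M0 by (subst ennreal_mult[symmetric]) (simp_all add: power2_eq_square mult.assoc)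
    qed
    also have "\<dots> = (\<integral>\<^sup>+y. \<integral>\<^sup>+y'. ennreal (M\<^sup>2 * K) * ?k (x - y) y' \<partial>lborel \<partial>lborel)"
      by (intro nn_integral_cong nn_integral_lborel_reflect) measurable
    also have "\<dots> = (\<integral>\<^sup>+y. \<integral>\<^sup>+y'. ennreal (M\<^sup>2 * K) * ?k y y' \<partial>lborel \<partial>lborel)"
      by (rule nn_integral_lborel_reflect[where f = "\<lambda>y. \<integral>\<^sup>+y'. ennreal (M\<^sup>2 * K) * ?k y y' \<partial>lborel"]) measurable
    also have "\<dots> = ennreal (M\<^sup>2 * K) * ?I"
      by (simp add: nn_integral_cmult)
    also have "\<dots> = ennreal K * ?I * ennreal (M\<^sup>2)"
      using K(1) by (simp add: ennreal_mult mult_ac)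
    finally show ?thesis by (simp add: \<omega>_def)
  qed
  \<comment> \<open>The bounds are uniform in the truncation, so Fatou's lemma gives the full
    half-line.\<close>
  have tail: "(\<integral>\<^sup>+t. ennreal (indicator {2..} t * osc_weight r t * (norm (Q g x (\<sigma> * t)))\<^sup>2) \<partial>lborel) \<le> ennreal K * ?I * ennreal (M\<^sup>2)"
    if g: "integrable lborel g" and gM: "AE y in lborel. norm (g y) \<le> M" and \<sigma>: "\<bar>\<sigma>\<bar> = 1" for g x M \<sigma>
  proof -
    have [measurable]: "g \<in> borel_measurable borel" using g by auto
    have [measurable]: "osc_weight r \<in> borel_measurable borel" unfolding osc_weight_def by measurable
    have [measurable]: "Q g x \<in> borel_measurable borel" unfolding Q_def Complex_eq by measurable
    let ?h = "\<lambda>k t. ennreal (indicator {2..2 + real k} t * osc_weight r t * (norm (Q g x (\<sigma> * t)))\<^sup>2)"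
    let ?h' = "\<lambda>t. ennreal (indicator {2..} t * osc_weight r t * (norm (Q g x (\<sigma> * t)))\<^sup>2)"
    have lim: "(\<lambda>k. ?h k t) \<longlonglongrightarrow> ?h' t" for t
    proof (rule tendsto_eventually, rule eventually_sequentiallyI[of "nat \<lceil>t\<rceil>"])
      fix k assume "nat \<lceil>t\<rceil> \<le> k"
      then have "t \<le> 2 + real k" by linarith
      then show "?h k t = ?h' t" by (simp add: indicator_def)
    qed
    have "(\<integral>\<^sup>+t. ?h' t \<partial>lborel) = (\<integral>\<^sup>+t. liminf (\<lambda>k. ?h k t) \<partial>lborel)"
      by (intro nn_integral_cong lim_imp_Liminf[OF _ lim, symmetric]) simp
    also have "\<dots> \<le> liminf (\<lambda>k. \<integral>\<^sup>+t. ?h k t \<partial>lborel)"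
      by (rule nn_integral_liminf) measurable
    also have "\<dots> \<le> liminf (\<lambda>k::nat. ennreal K * ?I * ennreal (M\<^sup>2))"
      by (intro Liminf_mono always_eventually allI large g gM \<sigma>) simp
    also have "\<dots> = ennreal K * ?I * ennreal (M\<^sup>2)"
      by (simp add: Liminf_const)
    finally show ?thesis .
  qed
  \<comment> \<open>The factor \<open>pi^n\<close> comes from the heat prefactor, 4 is the length of
    \<open>[-2, 2]\<close>, and the two equal summands are the two tails.\<close>
  let ?C = "ennreal (pi ^ DIM('a)) * (4 * ?g5\<^sup>2 + ennreal (5 / 3) * (ennreal K * ?I + ennreal K * ?I))"
  show ?thesis
  proof (rule that[of ?C])
    show "?C < \<infinity>"
      using I g5 by (simp add: ennreal_mult_less_top power_less_top_ennreal)
    fix g :: "'a \<Rightarrow> complex" and M x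
    assume g: "integrable lborel g" and gM: "AE y in lborel. norm (g y) \<le> M"
    have [measurable]: "g \<in> borel_measurable borel" using g by auto
    have [measurable]: "osc_weight r \<in> borel_measurable borel" unfolding osc_weight_def by measurable
    have [measurable]: "Q g x \<in> borel_measurable borel" unfolding Q_def Complex_eq by measurable
    let ?P = "ennreal (pi ^ DIM('a))" and ?q = "\<lambda>t. (norm (Q g x t))\<^sup>2"
    let ?T = "\<lambda>\<sigma> t. ennreal (indicator {2..} t * osc_weight r t * ?q (\<sigma> * t))"
    have F: "(1 + t\<^sup>2) powr (- (?n / 2 + \<theta>)) * (norm (gauss_smooth (Complex 1 t) g x))\<^sup>2
      = pi ^ DIM('a) * ((1 + t\<^sup>2) powr (- (?n + \<theta>)) * ?q t)" for t
    proof -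
      have "gauss_smooth (Complex 1 t) g x = gauss_ft (Complex 1 t) 0 ^ DIM('a) * Q g x t"
        unfolding Q_def by (rule gauss_smooth_eq_convolution[OF _ g]) simp
      then have "(norm (gauss_smooth (Complex 1 t) g x))\<^sup>2 = (norm (gauss_ft (Complex 1 t) 0 ^ DIM('a)))\<^sup>2 * ?q t"
        by (simp only: norm_mult power_mult_distrib)
      then have e: "(norm (gauss_smooth (Complex 1 t) g x))\<^sup>2 = pi ^ DIM('a) * (1 + t\<^sup>2) powr (- (?n / 2)) * ?q t"
        by (simp only: norm_gauss_ft_Complex_1)
      have "(1 + t\<^sup>2) powr (- (?n / 2 + \<theta>)) * (1 + t\<^sup>2) powr (- (?n / 2)) = (1 + t\<^sup>2) powr (- (?n + \<theta>))"
        unfolding powr_add[symmetric] by (rule arg_cong[where f = "(powr) (1 + t\<^sup>2)"]) simp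
      moreover have "a * (p * b * q) = p * ((a * b) * q)" for a b p q :: real
        by (simp only: mult_ac)
      ultimately show ?thesis unfolding e by (simp only:)
    qed
    \<comment> \<open>The factor \<open>5 / 3\<close> is the largest value of
      \<open>(1 + t^2) / (t^2 - 1)\<close> for \<open>|t| \<ge> 2\<close>, attained at
      \<open>|t| = 2\<close>.\<close>
    have osc: "(1 + t\<^sup>2) powr (- (?n + \<theta>)) \<le> 5 / 3 * osc_weight r t" if t: "\<bar>t\<bar> \<ge> 2" for t
    proof -
      have w: "1 + t\<^sup>2 > 0" by (simp add: add_pos_nonneg)
      have t4: "t\<^sup>2 \<ge> 4" using t abs_le_square_iff[of 2 t] by simp
      have "(1 + t\<^sup>2) powr (- (?n + \<theta>)) = (1 + t\<^sup>2) powr (- r - 1)"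
        by (rule arg_cong[where f = "(powr) (1 + t\<^sup>2)"]) (simp add: r_def)
      also have "\<dots> = (1 + t\<^sup>2) powr (- r) * (1 / (1 + t\<^sup>2))"
        using w by (simp add: powr_diff)
      also have "\<dots> \<le> (1 + t\<^sup>2) powr (- r) * (5 / 3 * ((t\<^sup>2 - 1) / (1 + t\<^sup>2)\<^sup>2))"
      proof (rule mult_left_mono)
        have "1 * (1 + t\<^sup>2) \<le> 5 / 3 * (t\<^sup>2 - 1)" using t4 by simp
        then have "1 * (1 + t\<^sup>2) / (1 + t\<^sup>2)\<^sup>2 \<le> 5 / 3 * (t\<^sup>2 - 1) / (1 + t\<^sup>2)\<^sup>2"
          by (rule divide_right_mono) simp
        then show "1 / (1 + t\<^sup>2) \<le> 5 / 3 * ((t\<^sup>2 - 1) / (1 + t\<^sup>2)\<^sup>2)"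
          using w by (simp add: power2_eq_square[of "1 + t\<^sup>2"])
      qed simp
      finally show ?thesis by (simp only: osc_weight_def mult.left_commute[of "5 / 3"])
    qed
    \<comment> \<open>Evaluating the tail with sign \<open>-1\<close> at \<open>0 - t\<close> gives
      the part \<open>t \<le> -2\<close>, since the weight is even.\<close>
    have pw: "ennreal ((1 + t\<^sup>2) powr (- (?n + \<theta>)) * ?q t)
      \<le> ?g5\<^sup>2 * ennreal (M\<^sup>2) * indicator {-2..2} t + ennreal (5 / 3) * (?T 1 t + ?T (-1) (0 - t))" for t
    proof (cases "t \<in> {-2..2}")
      case True
      have "(1 + t\<^sup>2) powr (- (?n + \<theta>)) \<le> (1 + t\<^sup>2) powr 0"
        using \<theta> by (intro powr_mono) auto
      also have "\<dots> = 1" using add_pos_nonneg[of 1 "t\<^sup>2"] by simp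
      finally have "(1 + t\<^sup>2) powr (- (?n + \<theta>)) * ?q t \<le> ?q t"
        by (intro mult_left_le_one_le) auto
      then have "ennreal ((1 + t\<^sup>2) powr (- (?n + \<theta>)) * ?q t) \<le> ennreal (?q t)"
        by (rule ennreal_leI)
      also have "\<dots> \<le> ?g5\<^sup>2 * ennreal (M\<^sup>2)" by (rule small[OF g gM True])
      finally show ?thesis using True by (simp add: add_increasing2)
    next
      case False
      have o: "osc_weight r (- t) = osc_weight r t" by (simp add: osc_weight_def)
      have "(1 + t\<^sup>2) powr (- (?n + \<theta>)) * ?q t \<le> 5 / 3 * osc_weight r t * ?q t"
        using False by (intro mult_right_mono osc) auto
      then have "ennreal ((1 + t\<^sup>2) powr (- (?n + \<theta>)) * ?q t) \<le> ennreal (5 / 3 * osc_weight r t * ?q t)"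
        by (rule ennreal_leI)
      also have "\<dots> = ennreal (5 / 3) * ennreal (osc_weight r t * ?q t)"
        by (subst mult.assoc, subst ennreal_mult') simp_all
      also have "ennreal (osc_weight r t * ?q t) \<le> ?T 1 t + ?T (-1) (0 - t)"
        using False o by (auto simp: indicator_def)
      finally show ?thesis using False by (simp add: mult_left_mono)
    qed
    have "(\<integral>\<^sup>+t. ennreal ((1 + t\<^sup>2) powr (- (?n / 2 + \<theta>)) * (norm (gauss_smooth (Complex 1 t) g x))\<^sup>2) \<partial>lborel)
      = (\<integral>\<^sup>+t. ?P * ennreal ((1 + t\<^sup>2) powr (- (?n + \<theta>)) * ?q t) \<partial>lborel)"
      unfolding F by (simp add: ennreal_mult)
    also have "\<dots> \<le> (\<integral>\<^sup>+t. ?P * (?g5\<^sup>2 * ennreal (M\<^sup>2) * indicator {-2..2} t + ennreal (5 / 3) * (?T 1 t + ?T (-1) (0 - t))) \<partial>lborel)"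
      by (intro nn_integral_mono mult_left_mono pw) simp
    also have "\<dots> = ?P * ((\<integral>\<^sup>+t. ?g5\<^sup>2 * ennreal (M\<^sup>2) * indicator {-2..2} t \<partial>(lborel :: real measure))
        + ennreal (5 / 3) * ((\<integral>\<^sup>+t. ?T 1 t \<partial>lborel) + (\<integral>\<^sup>+t. ?T (-1) (0 - t) \<partial>lborel)))"
    proof -
      have m1: "(\<lambda>t. ?g5\<^sup>2 * ennreal (M\<^sup>2) * indicator {-2..2} t) \<in> borel_measurable (lborel :: real measure)"
        and m2: "(\<lambda>t. ?T 1 t) \<in> borel_measurable lborel" and m3: "(\<lambda>t. ?T (-1) (0 - t)) \<in> borel_measurable lborel"
        by measurable
      have m4: "(\<lambda>t. ?T 1 t + ?T (-1) (0 - t)) \<in> borel_measurable lborel"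
        by (intro borel_measurable_add m2 m3)
      have m5: "(\<lambda>t. ennreal (5 / 3) * (?T 1 t + ?T (-1) (0 - t))) \<in> borel_measurable lborel"
        by measurable
      show ?thesis
        unfolding nn_integral_cmult[OF borel_measurable_add[OF m1 m5]] nn_integral_add[OF m1 m5]
          nn_integral_cmult[OF m4] nn_integral_add[OF m2 m3] ..
    qed
    also have "(\<integral>\<^sup>+t. ?T (-1) (0 - t) \<partial>lborel) = (\<integral>\<^sup>+t. ?T (-1) t \<partial>lborel)"
      by (rule nn_integral_lborel_reflect) measurable
    also have "(\<integral>\<^sup>+t. ?g5\<^sup>2 * ennreal (M\<^sup>2) * indicator {-2..2} t \<partial>(lborel :: real measure)) = ?g5\<^sup>2 * ennreal (M\<^sup>2) * 4"
      by (subst nn_integral_cmult_indicator) simp_all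
    also have "?P * (?g5\<^sup>2 * ennreal (M\<^sup>2) * 4 + ennreal (5 / 3) * ((\<integral>\<^sup>+t. ?T 1 t \<partial>lborel) + (\<integral>\<^sup>+t. ?T (-1) t \<partial>lborel)))
      \<le> ?P * (?g5\<^sup>2 * ennreal (M\<^sup>2) * 4 + ennreal (5 / 3) * (ennreal K * ?I * ennreal (M\<^sup>2) + ennreal K * ?I * ennreal (M\<^sup>2)))"
      by (intro mult_left_mono add_mono order_refl tail[OF g gM]) simp_all
    also have "\<dots> = ?C * ennreal (M\<^sup>2)"
    proof -
      have "p * (g * m * 4 + f * (k * m + k * m)) = p * (4 * g + f * (k + k)) * m" for p g m f k :: ennreal
        by (simp add: distrib_left distrib_right mult_ac)
      then show ?thesis .
    qed
    finally show "(\<integral>\<^sup>+t. ennreal ((1 + t\<^sup>2) powr (- (?n / 2 + \<theta>)) * (norm (gauss_smooth (Complex 1 t) g x))\<^sup>2) \<partial>lborel) \<le> ?C * ennreal (M\<^sup>2)" .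
  qed
qed

section \<open>Subordination of the bilinear multiplier\<close>

lemma fourier_eq_euclidean_ft: "fourier f = euclidean_ft f"
  by (simp add: fun_eq_iff fourier_def euclidean_ft_def cis_conv_exp mult_ac)

lemma gamma_fun_eq: "complex_of_real (gamma_fun a u) = complex_of_real (max u 0 powr a * exp (- u))"
  by (simp add: gamma_fun_def max_def)

lemma continuous_gamma_fun:
  assumes "a > 0" shows "continuous_on UNIV (\<lambda>u. complex_of_real (gamma_fun a u))"
  unfolding gamma_fun_eq using assms
  by (intro continuous_intros continuous_on_powr') (auto simp: max_def)

text \<open>The bound is the maximum \<open>a^a exp (-a)\<close>, attained at \<open>u = a\<close>;
  it follows from the tangent inequality for the logarithm at 1.\<close>

lemma gamma_fun_le:
  assumes a: "a > 0" shows "gamma_fun a u \<le> exp (a * ln a - a)"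
proof (cases "u > 0")
  case True
  have "a * ln (u / a) \<le> a * (u / a - 1)"
    using True a by (intro mult_left_mono ln_le_minus_one) auto
  then have "a * ln u - u \<le> a * ln a - a"
    using True a by (simp add: ln_div algebra_simps)
  then show ?thesis
    using True by (simp add: gamma_fun_def powr_def flip: exp_diff exp_minus exp_add)
qed (simp add: gamma_fun_def)

lemma norm_gamma_ft_eq:
  assumes "a > 0"
  shows "norm (gamma_ft a t) = norm (gamma_ft a 0) * (1 + t\<^sup>2) powr (- ((a + 1) / 2))"
proof (rule power2_eq_imp_eq)
  have w: "1 + t\<^sup>2 > 0" by (simp add: add_pos_nonneg)
  have "((1 + t\<^sup>2) powr (- ((a + 1) / 2)))\<^sup>2 = (1 + t\<^sup>2) powr (- (a + 1))"
    by (simp add: power2_eq_square flip: powr_add)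
  also have "\<dots> = (1 / (1 + t\<^sup>2)) powr (a + 1)"
    using w by (simp add: powr_divide powr_minus_divide del: minus_add_distrib)
  finally show "(norm (gamma_ft a t))\<^sup>2 = (norm (gamma_ft a 0) * (1 + t\<^sup>2) powr (- ((a + 1) / 2)))\<^sup>2"
    using norm_gamma_ft[OF assms, of t] by (simp only: power_mult_distrib)
qed auto

lemma borel_measurable_gamma_ft [measurable]: "gamma_ft a \<in> borel_measurable borel"
  unfolding gamma_ft_def by measurable

text \<open>The modulus decays like \<open>|t|^(-(a + 1))\<close>, which is integrable at infinity
  precisely for \<open>a > 0\<close>.\<close>

lemma integrable_gamma_ft:
  assumes a: "a > 0" shows "integrable lborel (gamma_ft a)"
proof (rule integrableI_bounded)
  have "(\<integral>\<^sup>+t. ennreal (norm (gamma_ft a t)) \<partial>lborel)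
    = ennreal (norm (gamma_ft a 0)) * (\<integral>\<^sup>+t. ennreal ((1 + t\<^sup>2) powr (- ((a + 1) / 2))) \<partial>lborel)"
  proof -
    have "(\<integral>\<^sup>+t. ennreal (norm (gamma_ft a t)) \<partial>lborel)
      = (\<integral>\<^sup>+t. ennreal (norm (gamma_ft a 0)) * ennreal ((1 + t\<^sup>2) powr (- ((a + 1) / 2))) \<partial>lborel)"
      by (intro nn_integral_cong) (subst norm_gamma_ft_eq[OF a], simp add: ennreal_mult)
    also have "\<dots> = ennreal (norm (gamma_ft a 0)) * (\<integral>\<^sup>+t. ennreal ((1 + t\<^sup>2) powr (- ((a + 1) / 2))) \<partial>lborel)"
      by (rule nn_integral_cmult) measurable
    finally show ?thesis .
  qed
  also have "\<dots> < \<infinity>"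
    using a nn_integral_one_plus_square_powr[of "(a + 1) / 2"] by (simp add: ennreal_mult_less_top)
  finally show "(\<integral>\<^sup>+t. ennreal (norm (gamma_ft a t)) \<partial>lborel) < \<infinity>" .
qed simp

lemma gamma_ft_inversion:
  assumes a: "a > 0"
  shows "(LINT t|lborel. cis (t * u) * gamma_ft a t) = 2 * complex_of_real pi * complex_of_real (gamma_fun a u)"
  unfolding gamma_ft_def
proof (rule fourier_inversion_real)
  show "norm (complex_of_real (gamma_fun a v)) \<le> exp (a * ln a - a)" for v
    using gamma_fun_le[OF a, of v] gamma_fun_nonneg[of a v] by simp
  show "integrable lborel (\<lambda>t. LINT v|lborel. cis (t * - v) * complex_of_real (gamma_fun a v))"
    using integrable_gamma_ft[OF a] unfolding gamma_ft_def .
  show "continuous_on UNIV (\<lambda>u. complex_of_real (gamma_fun a u))"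
    by (rule continuous_gamma_fun[OF a])
  show "integrable lborel (\<lambda>u. complex_of_real (gamma_fun a u))"
    using a by (intro integrable_gamma_fun) simp
qed

lemma bilinear_bochner_riesz_eq:
  fixes f g :: "real ^ 'n::finite \<Rightarrow> complex"
  assumes \<delta>: "\<delta> > 0" and f: "integrable lborel f" and g: "integrable lborel g"
  shows "bilinear_bochner_riesz \<delta> f g x = complex_of_real (1 / (2 * pi)) *
    (LINT t|lborel. (gamma_ft \<delta> t * exp (Complex 1 t)) * (gauss_smooth (Complex 1 t) f x * gauss_smooth (Complex 1 t) g x))"
proof -
  have [measurable]: "f \<in> borel_measurable borel" "g \<in> borel_measurable borel" using f g by auto
  let ?k = "\<lambda>h t \<xi>. cis (2 * pi * (x \<bullet> \<xi>)) * (exp (- Complex 1 t * complex_of_real ((norm \<xi>)\<^sup>2)) * euclidean_ft h \<xi>)"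
  \<comment> \<open>The modulus of \<open>exp (- z |\<xi>|^2)\<close> depends only on the real part
    of \<open>z\<close>, so the Gaussian at \<open>z = 1\<close> gives a majorant uniform in
    \<open>t\<close> for Fubini.\<close>
  let ?m = "\<lambda>h \<xi>. exp (- complex_of_real 1 * complex_of_real ((norm \<xi>)\<^sup>2)) * euclidean_ft h \<xi>"
  let ?w = "\<lambda>t. gamma_ft \<delta> t * exp (Complex 1 t)"
  let ?H = "\<lambda>t p. ?w t * (?k f t (fst p) * ?k g t (snd p))"
  let ?v = "\<lambda>p::(real ^ 'n) \<times> (real ^ 'n). 1 - (norm (fst p))\<^sup>2 - (norm (snd p))\<^sup>2"
  have k: "integrable lborel (?k h t)" if "integrable lborel h" for h t
    by (intro integrable_cis_mult integrable_gaussian_euclidean_ft that) simp_all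
  have k0: "integrable lborel (?m h)" if "integrable lborel h" for h
    by (intro integrable_gaussian_euclidean_ft that) simp
  have lbl: "sigma_finite_measure (lborel \<Otimes>\<^sub>M lborel :: ((real ^ 'n) \<times> (real ^ 'n)) measure)"
    unfolding lborel_prod by (rule lborel.sigma_finite_measure_axioms)
  interpret L: pair_sigma_finite "lborel :: real measure" "lborel \<Otimes>\<^sub>M lborel :: ((real ^ 'n) \<times> (real ^ 'n)) measure"
    by (intro pair_sigma_finite.intro lborel.sigma_finite_measure_axioms lbl)
  have kk: "integrable (lborel \<Otimes>\<^sub>M lborel) (\<lambda>p. ?m f (fst p) * ?m g (snd p))"
    by (rule integrable_pair_of_product_bound[OF lborel.sigma_finite_measure_axioms _ k0[OF f] k0[OF g]])
       (measurable, simp add: norm_mult)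
  have H: "integrable (lborel \<Otimes>\<^sub>M (lborel \<Otimes>\<^sub>M lborel)) (\<lambda>(t, p). ?H t p)"
  proof (rule integrable_pair_of_product_bound[OF lbl _ _ kk, where f = "\<lambda>t. gamma_ft \<delta> t * complex_of_real (exp 1)"])
    show "(\<lambda>(t, p). ?H t p) \<in> borel_measurable (lborel \<Otimes>\<^sub>M (lborel \<Otimes>\<^sub>M lborel))"
      unfolding Complex_eq by measurable
    show "integrable lborel (\<lambda>t. gamma_ft \<delta> t * complex_of_real (exp 1))"
      by (intro integrable_mult_left integrable_gamma_ft \<delta>)
  qed (simp add: norm_mult)
  have "bilinear_bochner_riesz \<delta> f g x = (LINT p|(lborel \<Otimes>\<^sub>M lborel). LINT t|lborel. complex_of_real (1 / (2 * pi)) * ?H t p)"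
    unfolding bilinear_bochner_riesz_def set_lebesgue_integral_def
  proof (intro Bochner_Integration.integral_cong refl)
    fix p :: "(real ^ 'n) \<times> (real ^ 'n)"
    obtain \<xi> \<eta> where p: "p = (\<xi>, \<eta>)" by (cases p)
    define E where "E = fourier f \<xi> * fourier g \<eta> * exp (2 * complex_of_real pi * \<i> * complex_of_real (x \<bullet> (\<xi> + \<eta>)))"
    have e: "exp (2 * complex_of_real pi * \<i> * complex_of_real (x \<bullet> (\<xi> + \<eta>))) = cis (2 * pi * (x \<bullet> \<xi>)) * cis (2 * pi * (x \<bullet> \<eta>))"
      unfolding cis_conv_exp mult_exp_exp by (rule arg_cong[where f = exp]) (simp add: inner_add_right algebra_simps)
    \<comment> \<open>The factor \<open>exp u\<close> undoes the exponential of the Gamma density.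
      On the boundary sphere both sides vanish because \<open>0 powr \<delta> = 0\<close>; outside,
      both cut-offs vanish.\<close>
    have "indicat_real {(\<xi>, \<eta>). (norm \<xi>)\<^sup>2 + (norm \<eta>)\<^sup>2 \<le> 1} p * (1 - (norm \<xi>)\<^sup>2 - (norm \<eta>)\<^sup>2) powr \<delta> = exp (?v p) * gamma_fun \<delta> (?v p)"
    proof -
      have "exp u * gamma_fun \<delta> u = (if u > 0 then u powr \<delta> else 0)" for u
        by (simp add: gamma_fun_def exp_minus)
      then show ?thesis by (auto simp: p indicator_def)
    qed
    then have "indicat_real {(\<xi>, \<eta>). (norm \<xi>)\<^sup>2 + (norm \<eta>)\<^sup>2 \<le> 1} p *\<^sub>R
        (case p of (\<xi>, \<eta>) \<Rightarrow> complex_of_real ((1 - (norm \<xi>)\<^sup>2 - (norm \<eta>)\<^sup>2) powr \<delta>) * fourier f \<xi> * fourier g \<eta> * exp (2 * complex_of_real pi * \<i> * complex_of_real (x \<bullet> (\<xi> + \<eta>))))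
      = complex_of_real (exp (?v p) * gamma_fun \<delta> (?v p)) * E"
      unfolding p by (simp add: E_def scaleR_conv_of_real mult.assoc[symmetric] flip: of_real_mult)
    also have "\<dots> = complex_of_real (exp (?v p)) * (complex_of_real (1 / (2 * pi)) * (LINT t|lborel. cis (t * ?v p) * gamma_ft \<delta> t)) * E"
      unfolding gamma_ft_inversion[OF \<delta>] by simp
    also have "\<dots> = (complex_of_real (exp (?v p)) * complex_of_real (1 / (2 * pi)) * E) * (LINT t|lborel. cis (t * ?v p) * gamma_ft \<delta> t)"
      by (simp only: mult_ac)
    also have "\<dots> = (LINT t|lborel. (complex_of_real (exp (?v p)) * complex_of_real (1 / (2 * pi)) * E) * (cis (t * ?v p) * gamma_ft \<delta> t))"
      by (rule integral_mult_right_zero[symmetric])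
    also have "\<dots> = (LINT t|lborel. complex_of_real (1 / (2 * pi)) * ?H t p)"
    proof (intro Bochner_Integration.integral_cong refl)
      fix t
      have "complex_of_real (exp (?v p)) * cis (t * ?v p) = exp (Complex 1 t) * exp (- Complex 1 t * complex_of_real ((norm \<xi>)\<^sup>2)) * exp (- Complex 1 t * complex_of_real ((norm \<eta>)\<^sup>2))"
        unfolding cis_conv_exp exp_of_real[symmetric] mult_exp_exp
        by (rule arg_cong[where f = exp]) (simp add: p Complex_eq algebra_simps)
      then have "(complex_of_real (exp (?v p)) * cis (t * ?v p)) * (complex_of_real (1 / (2 * pi)) * E * gamma_ft \<delta> t)
        = (exp (Complex 1 t) * exp (- Complex 1 t * complex_of_real ((norm \<xi>)\<^sup>2)) * exp (- Complex 1 t * complex_of_real ((norm \<eta>)\<^sup>2))) * (complex_of_real (1 / (2 * pi)) * E * gamma_ft \<delta> t)"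
        by (rule arg_cong)
      then show "(complex_of_real (exp (?v p)) * complex_of_real (1 / (2 * pi)) * E) * (cis (t * ?v p) * gamma_ft \<delta> t) = complex_of_real (1 / (2 * pi)) * ?H t p"
        unfolding E_def e fourier_eq_euclidean_ft p fst_conv snd_conv by (simp only: mult_ac)
    qed
    finally show "indicat_real {(\<xi>, \<eta>). (norm \<xi>)\<^sup>2 + (norm \<eta>)\<^sup>2 \<le> 1} p *\<^sub>R
        (case p of (\<xi>, \<eta>) \<Rightarrow> complex_of_real ((1 - (norm \<xi>)\<^sup>2 - (norm \<eta>)\<^sup>2) powr \<delta>) * fourier f \<xi> * fourier g \<eta> * exp (2 * complex_of_real pi * \<i> * complex_of_real (x \<bullet> (\<xi> + \<eta>))))
      = (LINT t|lborel. complex_of_real (1 / (2 * pi)) * ?H t p)" .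
  qed
  also have "\<dots> = complex_of_real (1 / (2 * pi)) * (LINT p|(lborel \<Otimes>\<^sub>M lborel). LINT t|lborel. ?H t p)"
    by (simp only: integral_mult_right_zero)
  also have "(LINT p|(lborel \<Otimes>\<^sub>M lborel). LINT t|lborel. ?H t p) = (LINT t|lborel. LINT p|(lborel \<Otimes>\<^sub>M lborel). ?H t p)"
    by (rule L.Fubini_integral[OF H])
  also have "\<dots> = (LINT t|lborel. ?w t * (gauss_smooth (Complex 1 t) f x * gauss_smooth (Complex 1 t) g x))"
  proof (intro Bochner_Integration.integral_cong refl)
    fix t
    have "(LINT p|(lborel \<Otimes>\<^sub>M lborel). ?H t p) = ?w t * (LINT p|(lborel \<Otimes>\<^sub>M lborel). ?k f t (fst p) * ?k g t (snd p))"
      by (rule integral_mult_right_zero)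
    also have "(LINT p|(lborel \<Otimes>\<^sub>M lborel). ?k f t (fst p) * ?k g t (snd p)) = gauss_smooth (Complex 1 t) f x * gauss_smooth (Complex 1 t) g x"
      unfolding gauss_smooth_def
      by (rule integral_pair_product[OF lborel.sigma_finite_measure_axioms lborel.sigma_finite_measure_axioms k[OF f] k[OF g]])
    finally show "(LINT p|(lborel \<Otimes>\<^sub>M lborel). ?H t p) = ?w t * (gauss_smooth (Complex 1 t) f x * gauss_smooth (Complex 1 t) g x)" .
  qed
  finally show ?thesis .
qed

section \<open>The boundedness theorem\<close>

text \<open>After Cauchy-Schwarz the square function of \<open>g\<close> is bounded uniformly in
  \<open>x\<close>, so it leaves the integral in \<open>x\<close>. What remains is a quadratic
  expression in \<open>f\<close>, where Tonelli allows the \<open>L^2\<close> contraction to be used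
  for each \<open>t\<close>.\<close>

lemma bilinear_bochner_riesz_L2_bound:
  assumes n: "CARD('n::finite) \<ge> 2" and \<delta>: "\<delta> > (real CARD('n) - 1) / 2"
  obtains C :: ennreal where "C < \<infinity>"
    "\<And>(f :: real ^ 'n \<Rightarrow> complex) g M. integrable lborel f \<Longrightarrow> integrable lborel g \<Longrightarrow> AE y in lborel. norm (g y) \<le> M \<Longrightarrow>
      (\<integral>\<^sup>+x. ennreal ((norm (bilinear_bochner_riesz \<delta> f g x))\<^sup>2) \<partial>lborel)
        \<le> C * ennreal (M\<^sup>2) * (\<integral>\<^sup>+x. ennreal ((norm (f x))\<^sup>2) \<partial>lborel)"
proof -
  let ?n = "real CARD('n)"
  \<comment> \<open>Half of the excess of \<open>\<delta>\<close> over \<open>(n - 1) / 2\<close>: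
    it is shared equally by the two weights, so that
    \<open>(1/2 + \<theta>) + (n/2 + \<theta>) = \<delta> + 1\<close>.\<close>
  define \<theta> where "\<theta> = (\<delta> + 1 / 2 - ?n / 2) / 2"
  have \<theta>: "\<theta> > 0" using \<delta> by (simp add: \<theta>_def field_simps)
  have \<delta>0: "\<delta> > 0" using \<delta> n by simp
  define a where "a = 1 / 2 + \<theta>"
  define b where "b = ?n / 2 + \<theta>"
  have ab: "a + b = \<delta> + 1" by (simp add: a_def b_def \<theta>_def field_simps)
  have n': "DIM(real ^ 'n) \<ge> 2" using n by simp
  obtain D :: ennreal where D: "D < \<infinity>"
    "\<And>(g :: real ^ 'n \<Rightarrow> complex) M x. integrable lborel g \<Longrightarrow> AE y in lborel. norm (g y) \<le> M \<Longrightarrow>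
      (\<integral>\<^sup>+t. ennreal ((1 + t\<^sup>2) powr (- b) * (norm (gauss_smooth (Complex 1 t) g x))\<^sup>2) \<partial>lborel) \<le> D * ennreal (M\<^sup>2)"
    using gauss_smooth_square_function[OF n' \<theta>] unfolding b_def by (simp; blast)
  let ?W = "\<integral>\<^sup>+t. ennreal ((1 + t\<^sup>2) powr (- a)) \<partial>(lborel :: real measure)"
  have W: "?W < \<infinity>" using \<theta> by (intro nn_integral_one_plus_square_powr) (simp add: a_def)
  define J where "J = norm (gamma_ft \<delta> 0)"
  have J0: "J \<ge> 0" by (simp add: J_def)
  show ?thesis
  proof (rule that[of "ennreal (J\<^sup>2) * ?W * D"])
    show "ennreal (J\<^sup>2) * ?W * D < \<infinity>" using W D(1) by (simp add: ennreal_mult_less_top)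
    fix f g :: "real ^ 'n \<Rightarrow> complex" and M
    assume f: "integrable lborel f" and g: "integrable lborel g" and gM: "AE y in lborel. norm (g y) \<le> M"
    have [measurable]: "f \<in> borel_measurable borel" "g \<in> borel_measurable borel" using f g by auto
    have [measurable]: "(\<lambda>t. Complex 1 t) \<in> borel_measurable borel"
      unfolding Complex_eq by measurable
    have gs_measurable: "(\<lambda>(t, x). gauss_smooth (Complex 1 t) h x) \<in> borel_measurable (lborel \<Otimes>\<^sub>M lborel)"
      if [measurable]: "h \<in> borel_measurable borel" for h :: "real ^ 'n \<Rightarrow> complex"
      unfolding gauss_smooth_def Complex_eq by measurable
    note [measurable] = gs_measurable[of f] gs_measurable[of g]
    have gs_measurable1: "(\<lambda>t. gauss_smooth (Complex 1 t) h x) \<in> borel_measurable borel"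
      if [measurable]: "h \<in> borel_measurable borel" for h :: "real ^ 'n \<Rightarrow> complex" and x
      unfolding gauss_smooth_def Complex_eq by measurable
    note [measurable] = gs_measurable1[of f] gs_measurable1[of g]
    let ?F = "\<lambda>t x. norm (gauss_smooth (Complex 1 t) f x)" and ?G = "\<lambda>t x. norm (gauss_smooth (Complex 1 t) g x)"
    let ?w = "\<lambda>q t. (1 + t\<^sup>2 :: real) powr (- (q / 2))"
    have wsq: "(?w q t)\<^sup>2 = (1 + t\<^sup>2) powr (- q)" for q t
      by (simp add: power2_eq_square flip: powr_add)
    have pointwise: "ennreal ((norm (bilinear_bochner_riesz \<delta> f g x))\<^sup>2)
       \<le> ennreal (J\<^sup>2) * (\<integral>\<^sup>+t. ennreal ((1 + t\<^sup>2) powr (- a) * (?F t x)\<^sup>2) \<partial>lborel) * (D * ennreal (M\<^sup>2))" for x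
    proof -
      let ?u = "\<lambda>t. ennreal (?w a t * ?F t x)" and ?v = "\<lambda>t. ennreal (?w b t * ?G t x)"
      have "norm (bilinear_bochner_riesz \<delta> f g x) = 1 / (2 * pi) *
          norm (LINT t|lborel. (gamma_ft \<delta> t * exp (Complex 1 t)) * (gauss_smooth (Complex 1 t) f x * gauss_smooth (Complex 1 t) g x))"
        unfolding bilinear_bochner_riesz_eq[OF \<delta>0 f g] norm_mult[of "complex_of_real (1 / (2 * pi))"] norm_of_real by simp
      then have "ennreal (norm (bilinear_bochner_riesz \<delta> f g x)) = ennreal (1 / (2 * pi)) *
          ennreal (norm (LINT t|lborel. (gamma_ft \<delta> t * exp (Complex 1 t)) * (gauss_smooth (Complex 1 t) f x * gauss_smooth (Complex 1 t) g x)))"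
        by (simp only: ennreal_mult'[of "1 / (2 * pi)", OF divide_nonneg_nonneg] pi_ge_zero mult_nonneg_nonneg zero_le_one zero_le_numeral)
      also have "\<dots> \<le> ennreal (1 / (2 * pi)) *
          (\<integral>\<^sup>+t. ennreal (norm ((gamma_ft \<delta> t * exp (Complex 1 t)) * (gauss_smooth (Complex 1 t) f x * gauss_smooth (Complex 1 t) g x))) \<partial>lborel)"
        by (intro mult_left_mono norm_integral_le_nn_integral) simp
      also have "\<dots> = (\<integral>\<^sup>+t. ennreal (1 / (2 * pi)) * ennreal (norm ((gamma_ft \<delta> t * exp (Complex 1 t)) * (gauss_smooth (Complex 1 t) f x * gauss_smooth (Complex 1 t) g x))) \<partial>lborel)"
        by (rule nn_integral_cmult[symmetric]) measurable
      also have "\<dots> \<le> (\<integral>\<^sup>+t. ennreal J * (?u t * ?v t) \<partial>lborel)"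
      proof (intro nn_integral_mono)
        fix t
        \<comment> \<open>The factor \<open>exp 1\<close> is the modulus of
          \<open>exp (1 + i t)\<close>; together with the inversion constant
          \<open>1 / (2 pi)\<close> it is at most 1.\<close>
        have e: "1 / (2 * pi) * exp 1 \<le> (1 :: real)"
          using exp_le pi_gt3 by (simp add: field_simps)
        have w: "(1 + t\<^sup>2) powr (- ((\<delta> + 1) / 2)) = ?w a t * ?w b t"
          unfolding powr_add[symmetric] ab[symmetric] by (rule arg_cong[where f = "(powr) (1 + t\<^sup>2)"]) (simp add: field_simps)
        have "1 / (2 * pi) * norm ((gamma_ft \<delta> t * exp (Complex 1 t)) * (gauss_smooth (Complex 1 t) f x * gauss_smooth (Complex 1 t) g x))
          = (1 / (2 * pi) * exp 1) * (J * (?w a t * ?w b t) * (?F t x * ?G t x))"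
        proof -
          have J: "norm (gamma_ft \<delta> t) = J * (?w a t * ?w b t)"
            unfolding J_def w[symmetric] by (rule norm_gamma_ft_eq[OF \<delta>0])
          show ?thesis unfolding norm_mult J by simp
        qed
        also have "\<dots> \<le> 1 * (J * (?w a t * ?w b t) * (?F t x * ?G t x))"
          using J0 by (intro mult_right_mono e) auto
        also have "\<dots> = J * ((?w a t * ?F t x) * (?w b t * ?G t x))" by simp
        finally have le: "1 / (2 * pi) * norm ((gamma_ft \<delta> t * exp (Complex 1 t)) * (gauss_smooth (Complex 1 t) f x * gauss_smooth (Complex 1 t) g x))
          \<le> J * ((?w a t * ?F t x) * (?w b t * ?G t x))" .
        have "ennreal (1 / (2 * pi)) * ennreal (norm ((gamma_ft \<delta> t * exp (Complex 1 t)) * (gauss_smooth (Complex 1 t) f x * gauss_smooth (Complex 1 t) g x)))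
          = ennreal (1 / (2 * pi) * norm ((gamma_ft \<delta> t * exp (Complex 1 t)) * (gauss_smooth (Complex 1 t) f x * gauss_smooth (Complex 1 t) g x)))"
          by (rule ennreal_mult'[symmetric]) simp
        also have "\<dots> \<le> ennreal (J * ((?w a t * ?F t x) * (?w b t * ?G t x)))"
          by (rule ennreal_leI[OF le])
        also have "\<dots> = ennreal J * (?u t * ?v t)"
          using J0 by (simp add: ennreal_mult)
        finally show "ennreal (1 / (2 * pi)) * ennreal (norm ((gamma_ft \<delta> t * exp (Complex 1 t)) * (gauss_smooth (Complex 1 t) f x * gauss_smooth (Complex 1 t) g x)))
          \<le> ennreal J * (?u t * ?v t)"
          .
      qed
      also have "\<dots> = ennreal J * (\<integral>\<^sup>+t. ?u t * ?v t \<partial>lborel)"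
        by (rule nn_integral_cmult) measurable
      finally have "(ennreal (norm (bilinear_bochner_riesz \<delta> f g x)))\<^sup>2 \<le> (ennreal J * (\<integral>\<^sup>+t. ?u t * ?v t \<partial>lborel))\<^sup>2"
        by (rule power_mono) simp
      also have "\<dots> = ennreal (J\<^sup>2) * (\<integral>\<^sup>+t. ?u t * ?v t \<partial>lborel)\<^sup>2"
        using J0 by (simp add: power_mult_distrib ennreal_power)
      also have "\<dots> \<le> ennreal (J\<^sup>2) * ((\<integral>\<^sup>+t. (?u t)\<^sup>2 \<partial>lborel) * (\<integral>\<^sup>+t. (?v t)\<^sup>2 \<partial>lborel))"
        by (intro mult_left_mono Cauchy_Schwarz_nn_integral) simp_all
      also have "(\<integral>\<^sup>+t. (?u t)\<^sup>2 \<partial>lborel) = (\<integral>\<^sup>+t. ennreal ((1 + t\<^sup>2) powr (- a) * (?F t x)\<^sup>2) \<partial>lborel)"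
        by (intro nn_integral_cong) (simp only: ennreal_power mult_nonneg_nonneg norm_ge_zero powr_ge_zero power_mult_distrib wsq)
      also have "(\<integral>\<^sup>+t. (?v t)\<^sup>2 \<partial>lborel) = (\<integral>\<^sup>+t. ennreal ((1 + t\<^sup>2) powr (- b) * (?G t x)\<^sup>2) \<partial>lborel)"
        by (intro nn_integral_cong) (simp only: ennreal_power mult_nonneg_nonneg norm_ge_zero powr_ge_zero power_mult_distrib wsq)
      also have "ennreal (J\<^sup>2) * ((\<integral>\<^sup>+t. ennreal ((1 + t\<^sup>2) powr (- a) * (?F t x)\<^sup>2) \<partial>lborel) * (\<integral>\<^sup>+t. ennreal ((1 + t\<^sup>2) powr (- b) * (?G t x)\<^sup>2) \<partial>lborel))
         \<le> ennreal (J\<^sup>2) * ((\<integral>\<^sup>+t. ennreal ((1 + t\<^sup>2) powr (- a) * (?F t x)\<^sup>2) \<partial>lborel) * (D * ennreal (M\<^sup>2)))"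
        by (intro mult_left_mono D(2) g gM) simp_all
      finally show ?thesis by (simp add: ennreal_power mult.assoc)
    qed
    \<comment> \<open>With the order exchanged, the inner integral is bounded independently of
      \<open>t\<close>, and the weight is integrable because \<open>a > 1 / 2\<close>.\<close>
    have "(\<integral>\<^sup>+x. (\<integral>\<^sup>+t. ennreal ((1 + t\<^sup>2) powr (- a) * (?F t x)\<^sup>2) \<partial>lborel) \<partial>lborel)
      = (\<integral>\<^sup>+t. (\<integral>\<^sup>+x. ennreal ((1 + t\<^sup>2) powr (- a) * (?F t x)\<^sup>2) \<partial>lborel) \<partial>lborel)"
      by (rule lborel_pair.Fubini'[where f = "\<lambda>t x. ennreal ((1 + t\<^sup>2) powr (- a) * (?F t x)\<^sup>2)"]) measurable
    also have "\<dots> \<le> (\<integral>\<^sup>+t. ennreal ((1 + t\<^sup>2) powr (- a)) * (\<integral>\<^sup>+x. ennreal ((norm (f x))\<^sup>2) \<partial>lborel) \<partial>lborel)"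
    proof (intro nn_integral_mono)
      fix t
      have [measurable]: "gauss_smooth (Complex 1 t) f \<in> borel_measurable borel"
        unfolding gauss_smooth_def by measurable
      have "(\<integral>\<^sup>+x. ennreal ((1 + t\<^sup>2) powr (- a) * (?F t x)\<^sup>2) \<partial>lborel) = ennreal ((1 + t\<^sup>2) powr (- a)) * (\<integral>\<^sup>+x. ennreal ((?F t x)\<^sup>2) \<partial>lborel)"
        by (simp add: ennreal_mult nn_integral_cmult)
      also have "\<dots> \<le> ennreal ((1 + t\<^sup>2) powr (- a)) * (\<integral>\<^sup>+x. ennreal ((norm (f x))\<^sup>2) \<partial>lborel)"
        by (intro mult_left_mono gauss_smooth_mean_square_le f) simp_all
      finally show "(\<integral>\<^sup>+x. ennreal ((1 + t\<^sup>2) powr (- a) * (?F t x)\<^sup>2) \<partial>lborel) \<le> ennreal ((1 + t\<^sup>2) powr (- a)) * (\<integral>\<^sup>+x. ennreal ((norm (f x))\<^sup>2) \<partial>lborel)" .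
    qed
    also have "\<dots> = ?W * (\<integral>\<^sup>+x. ennreal ((norm (f x))\<^sup>2) \<partial>lborel)"
      by (rule nn_integral_multc) measurable
    finally have X: "(\<integral>\<^sup>+x. (\<integral>\<^sup>+t. ennreal ((1 + t\<^sup>2) powr (- a) * (?F t x)\<^sup>2) \<partial>lborel) \<partial>lborel)
      \<le> ?W * (\<integral>\<^sup>+x. ennreal ((norm (f x))\<^sup>2) \<partial>lborel)" .
    have "(\<integral>\<^sup>+x. ennreal ((norm (bilinear_bochner_riesz \<delta> f g x))\<^sup>2) \<partial>lborel)
      \<le> (\<integral>\<^sup>+x. ennreal (J\<^sup>2) * (\<integral>\<^sup>+t. ennreal ((1 + t\<^sup>2) powr (- a) * (?F t x)\<^sup>2) \<partial>lborel) * (D * ennreal (M\<^sup>2)) \<partial>lborel)"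
      by (intro nn_integral_mono pointwise)
    also have "\<dots> = ennreal (J\<^sup>2) * (\<integral>\<^sup>+x. (\<integral>\<^sup>+t. ennreal ((1 + t\<^sup>2) powr (- a) * (?F t x)\<^sup>2) \<partial>lborel) \<partial>lborel) * (D * ennreal (M\<^sup>2))"
      by (subst nn_integral_multc, measurable, subst nn_integral_cmult, measurable)
    also have "\<dots> \<le> ennreal (J\<^sup>2) * (?W * (\<integral>\<^sup>+x. ennreal ((norm (f x))\<^sup>2) \<partial>lborel)) * (D * ennreal (M\<^sup>2))"
      by (intro mult_right_mono mult_left_mono X) simp_all
    finally show "(\<integral>\<^sup>+x. ennreal ((norm (bilinear_bochner_riesz \<delta> f g x))\<^sup>2) \<partial>lborel)
        \<le> ennreal (J\<^sup>2) * ?W * D * ennreal (M\<^sup>2) * (\<integral>\<^sup>+x. ennreal ((norm (f x))\<^sup>2) \<partial>lborel)"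
      by (simp only: mult_ac)
  qed
qed

section \<open>Schwartz functions and the passage to operator norms\<close>

lemma schwartz_continuous:
  assumes "schwartz f" shows "continuous_on UNIV f"
proof -
  have "iter_partial_deriv [] f differentiable_on UNIV"
    using assms unfolding schwartz_def smooth_def by blast
  then show ?thesis
    by (simp add: iter_partial_deriv_def differentiable_imp_continuous_on)
qed

lemma schwartz_monomial_bound:
  assumes "schwartz f"
  shows "\<exists>B. \<forall>x. (\<Prod>i\<in>UNIV. \<bar>x $ i\<bar> ^ \<alpha> i) * norm (f x) \<le> B"
proof -
  have "bounded (range (\<lambda>x. (\<Prod>i\<in>UNIV. (x $ i) ^ \<alpha> i) *\<^sub>R iter_partial_deriv [] f x))"
    using assms unfolding schwartz_def by blast
  then obtain B where "\<And>x. norm ((\<Prod>i\<in>UNIV. (x $ i) ^ \<alpha> i) *\<^sub>R f x) \<le> B"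
    unfolding bounded_iff iter_partial_deriv_def by auto
  then show ?thesis by (intro exI[of _ B]) (simp add: abs_prod power_abs)
qed

lemma schwartz_bounded:
  assumes "schwartz f" shows "\<exists>B. \<forall>x. norm (f x) \<le> B"
  using schwartz_monomial_bound[OF assms, of "\<lambda>_. 0"] by auto

text \<open>Expanding the product of the \<open>1 + x_i^2\<close> over subsets of coordinates gives
  finitely many squared monomials, each bounded against \<open>f\<close>. Hence \<open>f\<close> is
  dominated by a tensor product of the integrable functions \<open>1 / (1 + y^2)\<close>.\<close>

lemma integrable_schwartz:
  fixes f :: "real ^ 'n::finite \<Rightarrow> complex"
  assumes f: "schwartz f"
  shows "integrable lborel f"
proof -
  \<comment> \<open>One bounding constant is chosen for each set \<open>X\<close> of coordinates, so
    that the constants can be summed.\<close>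
  define B where "B X = (SOME B. \<forall>x. (\<Prod>i\<in>X. (x $ i)\<^sup>2) * norm (f x) \<le> B)" for X
  have B: "(\<Prod>i\<in>X. (x $ i)\<^sup>2) * norm (f x) \<le> B X" for X and x :: "real ^ 'n"
  proof -
    have eq: "(\<Prod>i\<in>X. (x $ i)\<^sup>2) = (\<Prod>i\<in>UNIV. \<bar>x $ i\<bar> ^ (if i \<in> X then 2 else 0))" for x :: "real ^ 'n"
      by (rule prod.mono_neutral_cong_left) auto
    have "\<exists>K. \<forall>x. (\<Prod>i\<in>X. (x $ i)\<^sup>2) * norm (f x) \<le> K"
      unfolding eq by (rule schwartz_monomial_bound[OF f])
    from someI_ex[OF this] show ?thesis unfolding B_def by blast
  qed
  define K where "K = (\<Sum>X\<in>Pow (UNIV :: 'n set). B X)"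
  have bound: "(\<Prod>i\<in>UNIV. 1 + (x $ i)\<^sup>2) * norm (f x) \<le> K" for x
  proof -
    have "(\<Prod>i\<in>UNIV. 1 + (x $ i)\<^sup>2) = (\<Sum>X\<in>Pow UNIV. (\<Prod>i\<in>X. (x $ i)\<^sup>2))"
      using prod_add[of "UNIV :: 'n set" "\<lambda>i. (x $ i)\<^sup>2" "\<lambda>_. 1"] by (simp add: add.commute)
    then show ?thesis
      unfolding K_def using B by (simp add: sum_distrib_right sum_mono)
  qed
  let ?h = "\<lambda>x :: real ^ 'n. \<Prod>b\<in>Basis. complex_of_real (1 / (1 + (x \<bullet> b)\<^sup>2))"
  have "integrable lborel (\<lambda>y::real. 1 / (1 + y\<^sup>2))"
  proof (rule integrableI_nonneg)
    have "(\<integral>\<^sup>+y. ennreal (1 / (1 + y\<^sup>2)) \<partial>(lborel :: real measure)) = (\<integral>\<^sup>+y. ennreal ((1 + y\<^sup>2) powr (- 1)) \<partial>(lborel :: real measure))"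
      by (intro nn_integral_cong) (simp add: powr_minus_divide add_nonneg_nonneg)
    also have "\<dots> < \<infinity>" by (rule nn_integral_one_plus_square_powr) simp
    finally show "(\<integral>\<^sup>+y. ennreal (1 / (1 + y\<^sup>2)) \<partial>(lborel :: real measure)) < \<infinity>" .
  qed auto
  then have h: "integrable lborel ?h"
    by (intro lborel_integral_prod_Basis integrable_of_real)
  have h_eq: "norm (?h x) = 1 / (\<Prod>i\<in>UNIV. 1 + (x $ i)\<^sup>2)" for x
  proof -
    have bas: "Basis = range (\<lambda>i::'n. axis i (1::real))" by (auto simp: Basis_vec_def)
    have inj: "inj (\<lambda>i::'n. axis i (1::real))" by (auto simp: inj_def axis_eq_axis)
    have "?h x = (\<Prod>i\<in>UNIV. complex_of_real (1 / (1 + (x $ i)\<^sup>2)))"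
      unfolding bas prod.reindex[OF inj] o_def by (simp add: inner_axis)
    then show ?thesis
      by (simp add: prod_norm[symmetric] norm_divide prod_dividef add_nonneg_nonneg del: of_real_add of_real_divide)
  qed
  show ?thesis
  proof (rule Bochner_Integration.integrable_bound)
    show "integrable lborel (\<lambda>x. complex_of_real K * ?h x)" by (intro integrable_mult_right h)
    show "f \<in> borel_measurable lborel"
      using borel_measurable_continuous_onI[OF schwartz_continuous[OF f]] by simp
    show "AE x in lborel. norm (f x) \<le> norm (complex_of_real K * ?h x)"
    proof (rule AE_I2)
      fix x :: "real ^ 'n"
      have pos: "(\<Prod>i\<in>UNIV. 1 + (x $ i)\<^sup>2) > 0" by (intro prod_pos) (auto simp: add_pos_nonneg)
      have "norm (f x) \<le> K / (\<Prod>i\<in>UNIV. 1 + (x $ i)\<^sup>2)"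
        using bound[of x] pos by (simp add: pos_le_divide_eq mult.commute)
      also have "\<dots> \<le> norm (complex_of_real K * ?h x)"
        unfolding norm_mult h_eq using pos by (simp add: divide_right_mono)
      finally show "norm (f x) \<le> norm (complex_of_real K * ?h x)" .
    qed
  qed
qed

lemma Lp_norm_2:
  assumes "(\<integral>\<^sup>+x. ennreal ((norm (f x))\<^sup>2) \<partial>lborel) = ennreal r" "r \<ge> 0"
  shows "Lp_norm 2 f = ennreal (sqrt r)"
proof -
  have "enn2real 2 = 2" by (metis enn2real_ennreal ennreal_numeral zero_le_numeral)
  then show ?thesis
    using assms by (simp add: Lp_norm_def powr_half_sqrt)
qed

theorem theorem4p8:
  fixes \<delta> :: real
  assumes "CARD('n::finite) \<ge> 2"
    and "\<delta> > (real CARD('n) - 1) / 2"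
  defines "S \<equiv> (bilinear_bochner_riesz \<delta> ::
      (real ^ 'n \<Rightarrow> complex) \<Rightarrow> (real ^ 'n \<Rightarrow> complex) \<Rightarrow> real ^ 'n \<Rightarrow> complex)"
  shows "bilinear_bounded S 2 \<infinity> 2 \<and> (\<exists>C\<ge>0. bilinear_opnorm S 2 \<infinity> 2 \<le> ennreal C)"
proof -
  obtain D :: ennreal where D: "D < \<infinity>"
    "\<And>(f :: real ^ 'n \<Rightarrow> complex) g M. integrable lborel f \<Longrightarrow> integrable lborel g \<Longrightarrow> AE y in lborel. norm (g y) \<le> M \<Longrightarrow>
      (\<integral>\<^sup>+x. ennreal ((norm (S f g x))\<^sup>2) \<partial>lborel)
        \<le> D * ennreal (M\<^sup>2) * (\<integral>\<^sup>+x. ennreal ((norm (f x))\<^sup>2) \<partial>lborel)"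
    using bilinear_bochner_riesz_L2_bound[OF assms(1,2)] unfolding S_def by blast
  define d where "d = enn2real D"
  have d: "D = ennreal d" "d \<ge> 0" using D(1) by (simp_all add: d_def)
  \<comment> \<open>The preceding estimate is for squared norms, hence the square root; this single
    bound also dominates the infimum that defines the operator norm.\<close>
  have "bilinear_bound S 2 \<infinity> 2 (sqrt d)"
    unfolding bilinear_bound_def
  proof (intro conjI allI impI)
    fix f g :: "real ^ 'n \<Rightarrow> complex"
    assume f: "schwartz f" and g: "schwartz g"
    have fi: "integrable lborel f" and gi: "integrable lborel g"
      using f g by (auto intro: integrable_schwartz)
    have [measurable]: "f \<in> borel_measurable borel" "g \<in> borel_measurable borel" using fi gi by auto
    obtain B where B: "\<And>x. norm (f x) \<le> B" using schwartz_bounded[OF f] by blast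
    obtain B' where B': "\<And>x. norm (g x) \<le> B'" using schwartz_bounded[OF g] by blast
    let ?E = "esssup lborel (\<lambda>x. ennreal (norm (g x)))"
    \<comment> \<open>Boundedness of \<open>g\<close> makes the essential supremum finite, so that
      it can serve as the real bound \<open>M\<close> that holds almost everywhere.\<close>
    have "?E \<le> ennreal B'"
      using B' by (intro esssup_I) (auto intro: ennreal_leI)
    then have E: "?E < \<top>" by (rule le_less_trans) simp
    define M where "M = enn2real ?E"
    have M: "?E = ennreal M" "M \<ge> 0" using E by (simp_all add: M_def)
    have gM: "AE y in lborel. norm (g y) \<le> M"
      using esssup_AE[of "\<lambda>x. ennreal (norm (g x))" lborel] unfolding M(1) by (simp add: M(2))
    let ?I = "\<integral>\<^sup>+x. ennreal ((norm (f x))\<^sup>2) \<partial>lborel"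
    \<comment> \<open>A bounded integrable function is square integrable; finiteness selects the
      real-valued branch in the definition of \<open>Lp_norm\<close>.\<close>
    have "?I \<le> (\<integral>\<^sup>+x. ennreal B * ennreal (norm (f x)) \<partial>lborel)"
    proof (intro nn_integral_mono)
      fix x
      have "(norm (f x))\<^sup>2 \<le> B * norm (f x)"
        unfolding power2_eq_square by (intro mult_right_mono B) simp
      moreover have "B \<ge> 0" using B[of x] norm_ge_zero order_trans by blast
      ultimately show "ennreal ((norm (f x))\<^sup>2) \<le> ennreal B * ennreal (norm (f x))"
        by (simp add: ennreal_leI flip: ennreal_mult)
    qed
    also have "\<dots> = ennreal B * (\<integral>\<^sup>+x. ennreal (norm (f x)) \<partial>lborel)"
      by (rule nn_integral_cmult) measurable
    also have "\<dots> < \<top>" using fi by (simp add: integrable_iff_bounded ennreal_mult_less_top)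
    finally have I: "?I < \<top>" .
    define q where "q = enn2real ?I"
    have q: "?I = ennreal q" "q \<ge> 0" using I by (simp_all add: q_def)
    let ?J = "\<integral>\<^sup>+x. ennreal ((norm (S f g x))\<^sup>2) \<partial>lborel"
    have J: "?J \<le> ennreal (d * M\<^sup>2 * q)"
      using D(2)[OF fi gi gM] d q M by (simp add: ennreal_mult)
    define s where "s = enn2real ?J"
    have s: "?J = ennreal s" "s \<ge> 0" using le_less_trans[OF J] by (simp_all add: s_def)
    have "s \<le> d * M\<^sup>2 * q" using J d(2) q(2) unfolding s by simp
    then have "sqrt s \<le> sqrt (d * M\<^sup>2 * q)" by (rule real_sqrt_le_mono)
    also have "\<dots> = sqrt d * sqrt q * M"
      using M(2) by (simp add: real_sqrt_mult)
    finally have "sqrt s \<le> sqrt d * sqrt q * M" .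
    then show "Lp_norm 2 (S f g) \<le> ennreal (sqrt d) * Lp_norm 2 f * Lp_norm \<infinity> g"
      unfolding Lp_norm_2[OF s] Lp_norm_2[OF q]
      using M d q by (simp add: Lp_norm_def ennreal_leI flip: ennreal_mult)
  qed (simp add: d)
  then show ?thesis
    unfolding bilinear_bounded_def bilinear_opnorm_def
    using d(2) by (intro conjI exI[of _ "sqrt d"] INF_lower) auto
qed

end
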